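(* Let $V:\mathbb R\to\mathbb R$ be twice differentiable with $0<C_-\le V''(\cdot)\le C_+$ for constants $C_\pm$, and let $\rho\in\mathbb R$. Consider on $\mathbb Z$ the conservative Ginzburg-Landau dynamics $\eta(t)$ with Hamiltonian $H(\eta)=\sum_xV(\eta_x)$ and the coupled random walk $X(t)$ on the bonds of $\mathbb Z$, as defined in the context. Then for every $i\in\mathbb Z$ and every $t\ge0$, $$\big\langle V'(\eta_0(0));\eta_i(t)\big\rangle_\rho=\Big\langle\mathbb E^\eta_{(0,1)}\big(1_{X(t)=(i,i+1)}\big)\Big\rangle_\rho .$$
   Context: Dynamics on $\mathbb Z$: $\eta(t)\in\mathbb R^{\mathbb Z}$ solves, for every $i\in\mathbb Z$, $$d\eta_i(t)=\big(V'(\eta_{i+1})+V'(\eta_{i-1})-2V'(\eta_i)\big)dt+\sqrt2\,\big(dB_{(i,i+1)}(t)-dB_{(i-1,i)}(t)\big),$$ with $(B_{(i,i+1)})_{i\in\mathbb Z}$ independent standard Brownian motions; solutions are taken with values in the weighted spaces $\{\zeta:\sum_i\zeta_i^2e^{-r|i|}<\infty\}$, $r>0$. Invariant measure: $\langle\cdot\rangle_\rho$ is expectation under $\mu_\rho$, the product invariant measure on $\mathbb R^{\mathbb Z}$ with mean density $\rho$, i.e. the i.i.d. product measure with single-site density proportional to $e^{-V(x)+\lambda x}$, where $\lambda=\lambda(\rho)\in\mathbb R$ is chosen so that the single-site mean is $\rho$. For functions of the path, $\langle F(\eta(0));G(\eta(t))\rangle_\rho$ denotes the covariance of $F(\eta(0))$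 and $G(\eta(t))$ when $\eta(0)$ has law $\mu_\rho$ and $\eta(\cdot)$ evolves by the dynamics. Random walk: $X(t)$ is a continuous-time walk on the bonds $\{(i,i+1):i\in\mathbb Z\}$ which, when at $(i,i+1)$ at time $t$, jumps to $(i+1,i+2)$ at rate $V''(\eta_{i+1}(t))$ and to $(i-1,i)$ at rate $V''(\eta_i(t))$. $\mathbb E^\eta_b$ denotes expectation for the joint process $(\eta(t),X(t))$ started at $\eta(0)=\eta$, $X(0)=b$; on the right-hand side of the identity, $\langle\cdot\rangle_\rho$ averages over the initial configuration $\eta$. *)

theory Defs
  imports "HOL-Probability.Probability"
begin

type_synonym config = "int \<Rightarrow> real"
type_synonym bond = "int \<times> int"

definition bonds :: "bond set" where
  "bonds = range (\<lambda>i. (i, i + 1))"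

definition site_measure :: "(real \<Rightarrow> real) \<Rightarrow> real \<Rightarrow> real measure" where
  "site_measure V l = density lborel
     (\<lambda>x. ennreal (exp (- V x + l * x) / (\<integral>y. exp (- V y + l * y) \<partial>lborel)))"

definition chem_pot :: "(real \<Rightarrow> real) \<Rightarrow> real \<Rightarrow> real" where
  "chem_pot V \<rho> = (THE l. (\<integral>x. x \<partial>site_measure V l) = \<rho>)"

definition invariant_measure :: "(real \<Rightarrow> real) \<Rightarrow> real \<Rightarrow> config measure" where
  "invariant_measure V \<rho> = PiM UNIV (\<lambda>_. site_measure V (chem_pot V \<rho>))"

abbreviation config_space :: "config measure" where
  "config_space \<equiv> PiM UNIV (\<lambda>_. borel)"

definition brownian_motion :: "'w measure \<Rightarrow> (real \<Rightarrow> 'w \<Rightarrow> real) \<Rightarrow> bool" where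
  "brownian_motion M W \<longleftrightarrow>
     (\<forall>t\<ge>0. W t \<in> borel_measurable M) \<and>
     (AE \<omega> in M. W 0 \<omega> = 0) \<and>
     (AE \<omega> in M. continuous_on {0..} (\<lambda>t. W t \<omega>)) \<and>
     (\<forall>s t. 0 \<le> s \<longrightarrow> s < t \<longrightarrow>
        distributed M lborel (\<lambda>\<omega>. W t \<omega> - W s \<omega>) (normal_density 0 (sqrt (t - s)))) \<and>
     (\<forall>(n::nat) \<tau>. 0 \<le> \<tau> 0 \<longrightarrow> (\<forall>k<n. \<tau> k < \<tau> (Suc k)) \<longrightarrow>
        prob_space.indep_vars M (\<lambda>_. borel) (\<lambda>k \<omega>. W (\<tau> (Suc k)) \<omega> - W (\<tau> k) \<omega>) {..<n})"

definition independent_brownian_motions ::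
    "'w measure \<Rightarrow> bond set \<Rightarrow> (bond \<Rightarrow> real \<Rightarrow> 'w \<Rightarrow> real) \<Rightarrow> bool" where
  "independent_brownian_motions M I B \<longleftrightarrow>
     (\<forall>b\<in>I. brownian_motion M (B b)) \<and>
     prob_space.indep_vars M (\<lambda>_. PiM {0..} (\<lambda>_. borel)) (\<lambda>b \<omega>. \<lambda>t\<in>{0..}. B b t \<omega>) I"

definition weighted_norm_sq :: "real \<Rightarrow> config \<Rightarrow> real" where
  "weighted_norm_sq r \<zeta> = (\<Sum>\<^sub>\<infinity>i. (\<zeta> i)\<^sup>2 * exp (- r * \<bar>real_of_int i\<bar>))"

definition weighted_space :: "real \<Rightarrow> config set" where
  "weighted_space r = {\<zeta>. (\<lambda>i. (\<zeta> i)\<^sup>2 * exp (- r * \<bar>real_of_int i\<bar>)) summable_on UNIV}"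

definition gl_drift :: "(real \<Rightarrow> real) \<Rightarrow> config \<Rightarrow> config" where
  "gl_drift V \<zeta> i = deriv V (\<zeta> (i + 1)) + deriv V (\<zeta> (i - 1)) - 2 * deriv V (\<zeta> i)"

text \<open>
  The noise is additive, so the stochastic differential equation is a pathwise integral
  equation. Solutions are continuous processes with values in the weighted space.
\<close>

definition gl_path :: "(real \<Rightarrow> real) \<Rightarrow> real \<Rightarrow> (bond \<Rightarrow> real \<Rightarrow> real) \<Rightarrow> (real \<Rightarrow> config) \<Rightarrow> bool" where
  "gl_path V r \<beta> h \<longleftrightarrow>
     (\<forall>t\<ge>0. h t \<in> weighted_space r) \<and>
     (\<forall>t\<ge>0. ((\<lambda>s. weighted_norm_sq r (\<lambda>i. h s i - h t i)) \<longlongrightarrow> 0) (at t within {0..})) \<and>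
     (\<forall>t\<ge>0. \<forall>i. h t i = h 0 i + (LBINT s:{0..t}. gl_drift V (h s) i)
                  + sqrt 2 * (\<beta> (i, i + 1) t - \<beta> (i - 1, i) t))"

definition gl_dynamics ::
    "'w measure \<Rightarrow> (real \<Rightarrow> real) \<Rightarrow> real \<Rightarrow> (bond \<Rightarrow> real \<Rightarrow> 'w \<Rightarrow> real) \<Rightarrow> (real \<Rightarrow> 'w \<Rightarrow> config) \<Rightarrow> bool"
  where
  "gl_dynamics M V r B \<eta> \<longleftrightarrow>
     prob_space M \<and>
     independent_brownian_motions M bonds B \<and>
     (\<forall>t\<ge>0. \<eta> t \<in> measurable M config_space) \<and>
     prob_space.indep_set M
       (sets (vimage_algebra (space M) (\<eta> 0) config_space))
       (sets (vimage_algebra (space M) (\<lambda>\<omega>. \<lambda>(b, t)\<in>bonds \<times> {0..}. B b t \<omega>)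
                (PiM (bonds \<times> {0..}) (\<lambda>_. borel)))) \<and>
     (AE \<omega> in M. gl_path V r (\<lambda>b t. B b t \<omega>) (\<lambda>t. \<eta> t \<omega>))"

definition jump_rate :: "(real \<Rightarrow> real) \<Rightarrow> config \<Rightarrow> bond \<Rightarrow> bond \<Rightarrow> real" where
  "jump_rate V \<zeta> b b' = (case b of (x, y) \<Rightarrow>
     if b' = (y, y + 1) then deriv (deriv V) (\<zeta> y)
     else if b' = (x - 1, x) then deriv (deriv V) (\<zeta> x)
     else 0)"

definition step_path :: "(real \<Rightarrow> bond) \<Rightarrow> bool" where
  "step_path p \<longleftrightarrow>
     (\<forall>t\<ge>0. p t \<in> bonds) \<and>
     (\<forall>t\<ge>0. eventually (\<lambda>s. p s = p t) (at_right t)) \<and>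
     (\<forall>t>0. \<exists>b. eventually (\<lambda>s. p s = b) (at_left t))"

text \<open>For a step path the following sets of jump times are finite, so \<open>card\<close> counts them.\<close>

definition jump_times :: "(real \<Rightarrow> bond) \<Rightarrow> bond \<Rightarrow> bond \<Rightarrow> real \<Rightarrow> real \<Rightarrow> real set" where
  "jump_times p b b' s t = {u \<in> {s<..t}. p u = b' \<and> eventually (\<lambda>v. p v = b) (at_left u)}"

definition compensated_jumps ::
    "(real \<Rightarrow> real) \<Rightarrow> (real \<Rightarrow> config) \<Rightarrow> (real \<Rightarrow> bond) \<Rightarrow> bond \<Rightarrow> bond \<Rightarrow> real \<Rightarrow> real \<Rightarrow> real" where
  "compensated_jumps V h p b b' s t =
     real (card (jump_times p b b' s t))
     - (LBINT u:{s..t}. of_bool (p u = b) * jump_rate V (h u) b b')"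

definition walk_past ::
    "'w measure \<Rightarrow> (real \<Rightarrow> 'w \<Rightarrow> config) \<Rightarrow> (real \<Rightarrow> 'w \<Rightarrow> bond) \<Rightarrow> real \<Rightarrow> 'w measure" where
  "walk_past M \<eta> X s = vimage_algebra (space M)
     (\<lambda>\<omega>. (\<lambda>u\<in>{0..}. \<eta> u \<omega>, \<lambda>u\<in>{0..s}. X u \<omega>))
     (PiM {0..} (\<lambda>_. config_space) \<Otimes>\<^sub>M PiM {0..s} (\<lambda>_. count_space UNIV))"

text \<open>
  ``Jumps from \<open>b\<close> to \<open>b'\<close> at rate \<open>q(t)\<close> when at \<open>b\<close>'' means that the process counting these
  jumps has stochastic intensity \<open>1(X(t) = b) q(t)\<close>, that is, becomes a martingale after
  subtraction of the integrated intensity. The trajectory of the environment is put into the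
  past, so that \<open>X\<close> is, given \<open>\<eta>\<close>, a walk with prescribed time-dependent rates. The rates are
  \<open>0\<close> for pairs of bonds that are not neighbours.
\<close>

definition walk_in_environment ::
    "'w measure \<Rightarrow> (real \<Rightarrow> real) \<Rightarrow> (real \<Rightarrow> 'w \<Rightarrow> config) \<Rightarrow> (real \<Rightarrow> 'w \<Rightarrow> bond) \<Rightarrow> bool" where
  "walk_in_environment M V \<eta> X \<longleftrightarrow>
     (\<forall>t\<ge>0. X t \<in> measurable M (count_space UNIV)) \<and>
     (AE \<omega> in M. step_path (\<lambda>t. X t \<omega>)) \<and>
     (\<forall>b\<in>bonds. \<forall>b'\<in>bonds. b \<noteq> b' \<longrightarrow> (\<forall>s t. 0 \<le> s \<longrightarrow> s \<le> t \<longrightarrow>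
        integrable M (\<lambda>\<omega>. real (card (jump_times (\<lambda>u. X u \<omega>) b b' s t))) \<and>
        integrable M (\<lambda>\<omega>. compensated_jumps V (\<lambda>u. \<eta> u \<omega>) (\<lambda>u. X u \<omega>) b b' s t) \<and>
        (AE \<omega> in M. real_cond_exp M (walk_past M \<eta> X s)
           (\<lambda>\<omega>. compensated_jumps V (\<lambda>u. \<eta> u \<omega>) (\<lambda>u. X u \<omega>) b b' s t) \<omega> = 0)))"

definition joint_process ::
    "'w measure \<Rightarrow> (real \<Rightarrow> real) \<Rightarrow> real \<Rightarrow> (bond \<Rightarrow> real \<Rightarrow> 'w \<Rightarrow> real) \<Rightarrow> (real \<Rightarrow> 'w \<Rightarrow> config) \<Rightarrow>
     (real \<Rightarrow> 'w \<Rightarrow> bond) \<Rightarrow> config \<Rightarrow> bond \<Rightarrow> bool" where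
  "joint_process M V r B \<eta> X \<zeta> b \<longleftrightarrow>
     gl_dynamics M V r B \<eta> \<and> walk_in_environment M V \<eta> X \<and>
     (AE \<omega> in M. \<eta> 0 \<omega> = \<zeta>) \<and> (AE \<omega> in M. X 0 \<omega> = b)"

definition covariance :: "'w measure \<Rightarrow> ('w \<Rightarrow> real) \<Rightarrow> ('w \<Rightarrow> real) \<Rightarrow> real" where
  "covariance M F G = (\<integral>\<omega>. F \<omega> * G \<omega> \<partial>M) - (\<integral>\<omega>. F \<omega> \<partial>M) * (\<integral>\<omega>. G \<omega> \<partial>M)"

end

theory Submission
  imports Defs
begin

text \<open>
  The discrete divergence of the forward equation of the bond walk is the linearisation of the
  dynamics: if \<open>p\<^sub>i(t)\<close> is the probability of \<open>X(t) = (i, i+1)\<close> given the environment, then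
  \<open>p\<^sub>i\<^sub>-\<^sub>1 - p\<^sub>i\<close> solves the same linear equation, with the same initial value, as
  \<open>\<partial>\<eta>\<^sub>i(t)/\<partial>\<eta>\<^sub>1(0) - \<partial>\<eta>\<^sub>i(t)/\<partial>\<eta>\<^sub>0(0)\<close>. Integration by parts against the product Gibbs measure turns
  the mean of the latter into the difference of the covariances of \<open>\<eta>\<^sub>i(t)\<close> with \<open>V'(\<eta>\<^sub>1(0))\<close> and
  \<open>V'(\<eta>\<^sub>0(0))\<close>, that is, by translation invariance, into the difference of the left-hand sides at
  \<open>i - 1\<close> and \<open>i\<close>. So the two sides of the identity differ by a constant in \<open>i\<close>, and both tend to \<open>0\<close>
  as \<open>i\<close> tends to infinity.

  Since \<open>V''\<close> need not be continuous, derivatives are replaced by difference quotients in a single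
  coordinate: they solve linear equations whose rates converge pointwise to \<open>V''(\<eta>)\<close>.
\<close>

section \<open>Linear equations with bounded rates\<close>

text \<open>The two sides live on unrelated probability spaces: \<open>M\<close> carries the process
  started from the Gibbs law, each \<open>P \<zeta>\<close> a walk of its own. They share only the
  law of the noise. So the solution is written as a fixed measurable function
  \<open>euler_limit\<close> of initial configuration and noise, and solutions from shifted
  configurations are built on the same noise. Occupation indicators of the walk solve the linear
  equation only after conditioning on the environment. Instead of choosing versions of conditional
  expectations, they are tested against bounded functions of the environment. Neither the derivative
  of the flow nor the walk is shown to be the solution of a linear equation. Both are compared with
  the same Picard iterate \<open>lin_iter\<close>, up to an error of the form K (4Ct)^n / n!; here 4
  is the sum of the absolute coefficients of the discrete Laplacian and C bounds V''. The decay in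
  \<open>i\<close> comes from a Lipschitz bound with weight exp(-|i|) for the flow, and from
  dominated convergence for the walk. The summation over sites also yields measurability of the walk
  probabilities in \<open>\<zeta>\<close>, which is not assumed.\<close>

lemma set_integrable_bounded:
  fixes g :: "real \<Rightarrow> real"
  assumes [measurable]: "g \<in> borel_measurable borel" and "\<And>s. s \<in> {a..b} \<Longrightarrow> \<bar>g s\<bar> \<le> K"
  shows "set_integrable lborel {a..b} g"
  unfolding set_integrable_def
proof (rule integrableI_bounded_set[where A = "{a..b}" and B = K])
  show "emeasure lborel {a..b} < \<infinity>" by (simp add: emeasure_lborel_Icc_eq)
qed (use assms in \<open>auto simp: indicator_def\<close>)

lemma set_integral_refl: "(LBINT s:{a..a::real}. f s) = (0::real)"
  unfolding set_lebesgue_integral_def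
  by (rule integral_eq_zero_AE, use AE_lborel_singleton[of a] in eventually_elim) (simp add: indicator_def)

text \<open>Integrability is asked of the majorant only: a non-integrable \<open>f\<close> has
  integral 0 by convention, and the majorant is nonnegative on \<open>S\<close>.\<close>

lemma abs_set_integral_le:
  fixes f g :: "real \<Rightarrow> real"
  assumes "set_integrable lborel S g" "\<And>s. s \<in> S \<Longrightarrow> \<bar>f s\<bar> \<le> g s"
  shows "\<bar>LBINT s:S. f s\<bar> \<le> (LBINT s:S. g s)"
proof (cases "set_integrable lborel S f")
  case True
  have "\<bar>LBINT s:S. f s\<bar> \<le> (LBINT s:S. \<bar>f s\<bar>)"
    using set_integral_norm_bound[OF True] by simp
  also have "\<dots> \<le> (LBINT s:S. g s)"
    by (intro set_integral_mono assms set_integrable_abs True)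
  finally show ?thesis .
next
  case False
  then have "(LBINT s:S. f s) = 0"
    unfolding set_integrable_def set_lebesgue_integral_def by (rule not_integrable_integral_eq)
  moreover have "0 \<le> (LBINT s:S. g s)"
    unfolding set_lebesgue_integral_def
    by (rule Bochner_Integration.integral_nonneg)
       (metis abs_ge_zero assms(2) indicator_simps(1,2) mult_zero_left order.trans real_scaleR_def scaleR_one order_refl)
  ultimately show ?thesis by simp
qed

lemma set_integral_power_eq:
  assumes "0 \<le> (t::real)"
  shows "set_integrable lborel {0..t} (\<lambda>s. s ^ n)" "(LBINT s:{0..t}. s ^ n) = t ^ Suc n / Suc n"
proof -
  show "set_integrable lborel {0..t} (\<lambda>s. s ^ n)"
    by (intro borel_integrable_atLeastAtMost') (intro continuous_intros)
  show "(LBINT s:{0..t}. s ^ n) = t ^ Suc n / Suc n"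
    using integral_power[OF assms, of n]
    by (simp add: set_lebesgue_integral_def mult.commute)
qed

text \<open>The step shared by the Picard inductions: a map with Lipschitz constant \<open>L\<close>
  turns the n-th bound into this integrand, and integration in time raises the factorial.\<close>

lemma abs_set_integral_power_le:
  fixes g :: "real \<Rightarrow> real"
  assumes "0 \<le> t" "\<And>s. s \<in> {0..t} \<Longrightarrow> \<bar>g s\<bar> \<le> L * (K * (L * s) ^ n / fact n)"
  shows "\<bar>LBINT s:{0..t}. g s\<bar> \<le> K * (L * t) ^ Suc n / fact (Suc n)"
proof -
  let ?c = "K * L ^ Suc n / fact n"
  have *: "L * (K * (L * s) ^ n / fact n) = ?c * s ^ n" for s
    by (simp add: power_mult_distrib)
  have "\<bar>LBINT s:{0..t}. g s\<bar> \<le> (LBINT s:{0..t}. ?c * s ^ n)"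
    using assms(2) unfolding * using set_integral_power_eq(1)[OF assms(1)]
    by (intro abs_set_integral_le) auto
  also have "\<dots> = ?c * (t ^ Suc n / Suc n)"
    using set_integral_power_eq(2)[OF assms(1)] by simp
  also have "\<dots> = K * (L * t) ^ Suc n / fact (Suc n)"
    by (simp add: power_mult_distrib field_simps)
  finally show ?thesis .
qed

lemma power_div_fact_LIMSEQ_zero: "(\<lambda>n. K * (x::real) ^ n / fact n) \<longlonglongrightarrow> 0"
  using tendsto_mult_right_zero[OF summable_LIMSEQ_zero[OF summable_exp[of x]], of K]
  by (simp add: field_simps)

lemma set_integral_dominated_LIMSEQ:
  fixes f :: "nat \<Rightarrow> real \<Rightarrow> real"
  assumes [measurable]: "\<And>m. f m \<in> borel_measurable borel" "g \<in> borel_measurable borel"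
    and "\<And>s. s \<in> {a..b} \<Longrightarrow> (\<lambda>m. f m s) \<longlonglongrightarrow> g s"
    and "\<And>m s. s \<in> {a..b} \<Longrightarrow> \<bar>f m s\<bar> \<le> K"
  shows "(\<lambda>m. LBINT s:{a..b}. f m s) \<longlonglongrightarrow> (LBINT s:{a..b}. g s)"
  unfolding set_lebesgue_integral_def
proof (rule integral_dominated_convergence[where w = "\<lambda>s. indicator {a..b} s *\<^sub>R K"])
  show "integrable lborel (\<lambda>s. indicator {a..b} s *\<^sub>R K)"
    using set_integrable_bounded[of "\<lambda>_. K" a b "\<bar>K\<bar>"] unfolding set_integrable_def by simp
  show "AE s in lborel. (\<lambda>m. indicator {a..b} s *\<^sub>R f m s) \<longlonglongrightarrow> indicator {a..b} s *\<^sub>R g s"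
    using assms(3) by (auto simp: indicator_def)
  show "AE s in lborel. norm (indicator {a..b} s *\<^sub>R f m s) \<le> indicator {a..b} s *\<^sub>R K" for m
    using assms(4) by (auto simp: indicator_def)
qed auto

text \<open>The upper limit moves into the integrand as a condition, so that measurability of
  parameter integrals over the whole line applies.\<close>

lemma interval_integral_measurable:
  fixes g :: "'a \<Rightarrow> real \<Rightarrow> real"
  assumes [measurable]: "(\<lambda>w. g (fst w) (snd w)) \<in> borel_measurable (N \<Otimes>\<^sub>M borel)" "T \<in> borel_measurable N"
  shows "(\<lambda>z. LBINT s:{0..T z}. g z s) \<in> borel_measurable N"
proof -
  have [measurable]: "Measurable.pred (N \<Otimes>\<^sub>M borel) (\<lambda>w. snd w \<in> {0..T (fst w)})"
    unfolding atLeastAtMost_iff by measurable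
  have "(\<lambda>z. \<integral>s. (if s \<in> {0..T z} then g z s else 0) \<partial>lborel) \<in> borel_measurable N"
    by measurable
  moreover have "(LBINT s:{0..u}. f s) = (\<integral>s. (if s \<in> {0..u} then f s else 0) \<partial>lborel)" for f :: "real \<Rightarrow> real" and u
    unfolding set_lebesgue_integral_def by (intro Bochner_Integration.integral_cong) auto
  ultimately show ?thesis by simp
qed

definition lapl :: "config \<Rightarrow> config" where
  "lapl x i = x (i + 1) + x (i - 1) - 2 * x i"

lemma gl_drift_eq_lapl: "gl_drift V \<zeta> = lapl (\<lambda>j. deriv V (\<zeta> j))"
  by (auto simp: gl_drift_def lapl_def)

lemma lapl_diff: "lapl (\<lambda>j. x j - y j) i = lapl x i - lapl y i"
  by (simp add: lapl_def)

lemma abs_lapl_le: "(\<And>j. \<bar>x j\<bar> \<le> K) \<Longrightarrow> \<bar>lapl x i\<bar> \<le> 4 * K"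
proof -
  assume "\<And>j. \<bar>x j\<bar> \<le> K"
  from this[of i] this[of "i - 1"] this[of "i + 1"] show ?thesis
    unfolding lapl_def by linarith
qed

text \<open>Picard iterates for v' = \<open>lapl\<close> (a v) with v(0) = x. Being finite
  expressions in the rates, they inherit measurability and pointwise limits from them, and they
  serve as the common reference for flow and walk.\<close>

primrec lin_iter :: "(real \<Rightarrow> config) \<Rightarrow> config \<Rightarrow> nat \<Rightarrow> real \<Rightarrow> config" where
  "lin_iter a x 0 t = x"
| "lin_iter a x (Suc n) t = (\<lambda>i. x i + (LBINT s:{0..t}. lapl (\<lambda>j. a s j * lin_iter a x n s j) i))"

locale bounded_rates =
  fixes a :: "real \<Rightarrow> config" and C :: real
  assumes rate_measurable [measurable]: "\<And>j. (\<lambda>s. a s j) \<in> borel_measurable borel"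
    and rate_bound: "\<And>s j. \<bar>a s j\<bar> \<le> C"
begin

lemma C_nonneg: "0 \<le> C"
  using rate_bound[of 0 0] by linarith

lemma lin_iter_measurable [measurable]: "(\<lambda>t. lin_iter a x n t i) \<in> borel_measurable borel"
proof (induction n arbitrary: i)
  case (Suc n)
  note [measurable] = Suc
  show ?case
    unfolding lin_iter.simps lapl_def
    by (intro borel_measurable_add borel_measurable_const interval_integral_measurable) measurable
qed simp

lemma lapl_lin_iter_measurable [measurable]:
  "(\<lambda>s. lapl (\<lambda>j. a s j * lin_iter a x n s j) i) \<in> borel_measurable borel"
  unfolding lapl_def by measurable

lemma abs_mult_rate_le: "\<bar>y\<bar> \<le> K \<Longrightarrow> \<bar>a s j * y\<bar> \<le> C * K"
  by (simp add: abs_mult mult_mono rate_bound C_nonneg)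

text \<open>Crude on purpose: each iteration costs at most a factor 1 + 4CT. This is enough for a
  dominating constant.\<close>

lemma lin_iter_bound:
  assumes "\<And>j. \<bar>x j\<bar> \<le> K" "t \<in> {0..T}"
  shows "\<bar>lin_iter a x n t i\<bar> \<le> K * (1 + 4 * C * T) ^ n"
  using assms(2)
proof (induction n arbitrary: t i)
  case 0
  then show ?case using assms(1) by simp
next
  case (Suc n)
  have K: "0 \<le> K" using assms(1)[of 0] by linarith
  have T: "0 \<le> T" using Suc.prems by auto
  let ?B = "K * (1 + 4 * C * T) ^ n"
  have "\<bar>LBINT s:{0..t}. lapl (\<lambda>j. a s j * lin_iter a x n s j) i\<bar>
      \<le> ?B * (4 * C * t) ^ Suc 0 / fact (Suc 0)"
  proof (rule abs_set_integral_power_le)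
    fix s assume "s \<in> {0..t}"
    then show "\<bar>lapl (\<lambda>j. a s j * lin_iter a x n s j) i\<bar> \<le> 4 * C * (?B * (4 * C * s) ^ 0 / fact 0)"
      using abs_lapl_le[of "\<lambda>j. a s j * lin_iter a x n s j" "C * ?B" i]
        abs_mult_rate_le[OF Suc.IH] Suc.prems by simp
  qed (use Suc.prems in auto)
  also have "\<dots> \<le> ?B * (4 * C * T)"
    using Suc.prems K C_nonneg T by (simp add: mult_left_mono)
  moreover have "K \<le> ?B"
    using mult_left_mono[OF one_le_power[of "1 + 4 * C * T" n] K] C_nonneg T by simp
  ultimately show ?case
    using assms(1)[of i] by (simp add: algebra_simps)
qed

lemma lin_iter_integrable:
  assumes "\<And>j. \<bar>x j\<bar> \<le> K"
  shows "set_integrable lborel {0..t} (\<lambda>s. lapl (\<lambda>j. a s j * lin_iter a x n s j) i)"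
  by (rule set_integrable_bounded[where K = "4 * (C * (K * (1 + 4 * C * t) ^ n))"])
     (use abs_mult_rate_le lin_iter_bound[OF assms] in \<open>auto intro!: abs_lapl_le\<close>)

lemma lin_iter_diff:
  assumes "\<And>j. \<bar>x j\<bar> \<le> K" "\<And>j. \<bar>y j\<bar> \<le> K'"
  shows "lin_iter a (\<lambda>j. x j - y j) n t i = lin_iter a x n t i - lin_iter a y n t i"
proof (induction n arbitrary: t i)
  case (Suc n)
  show ?case
    by (simp add: Suc right_diff_distrib lapl_diff
        set_integral_diff(2)[OF lin_iter_integrable[OF assms(1)] lin_iter_integrable[OF assms(2)]])
qed simp

text \<open>At order 0 the difference is at most 2K, because \<open>x\<close> is the value of
  \<open>v\<close> at time 0 and obeys the same bound; each further order integrates the difference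
  once more.\<close>

lemma lin_iter_error:
  assumes v: "\<And>t i. t \<in> {0..T} \<Longrightarrow> v t i = x i + (LBINT s:{0..t}. lapl (\<lambda>j. a s j * v s j) i)"
    and v_meas [measurable]: "\<And>j. (\<lambda>s. v s j) \<in> borel_measurable borel"
    and v_bound: "\<And>t j. t \<in> {0..T} \<Longrightarrow> \<bar>v t j\<bar> \<le> K"
    and "t \<in> {0..T}"
  shows "\<bar>v t i - lin_iter a x n t i\<bar> \<le> 2 * K * (4 * C * t) ^ n / fact n"
  using \<open>t \<in> {0..T}\<close>
proof (induction n arbitrary: t i)
  case x: 0
  have "v 0 i = x i"
    using v[of 0 i] x by (simp only: set_integral_refl) simp
  then show ?case
    using v_bound[of t i] v_bound[of 0 i] x by auto
next
  case (Suc n)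
  have x: "\<bar>x j\<bar> \<le> K" for j
    using v[of 0 j] v_bound[of 0 j] Suc.prems by (simp only: set_integral_refl) simp
  have int: "set_integrable lborel {0..t} (\<lambda>s. lapl (\<lambda>j. a s j * v s j) i)"
    by (rule set_integrable_bounded[where K = "4 * (C * K)"])
       (use abs_mult_rate_le v_bound Suc.prems in \<open>auto simp: lapl_def[abs_def] intro!: abs_lapl_le[unfolded lapl_def]\<close>)
  have "v t i - lin_iter a x (Suc n) t i
      = (LBINT s:{0..t}. lapl (\<lambda>j. a s j * (v s j - lin_iter a x n s j)) i)"
    using v[OF Suc.prems, of i]
    by (simp add: right_diff_distrib lapl_diff set_integral_diff(2)[OF int lin_iter_integrable[OF x]])
  also have "\<bar>\<dots>\<bar> \<le> 2 * K * (4 * C * t) ^ Suc n / fact (Suc n)"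
  proof (rule abs_set_integral_power_le)
    fix s assume "s \<in> {0..t}"
    then show "\<bar>lapl (\<lambda>j. a s j * (v s j - lin_iter a x n s j)) i\<bar>
      \<le> 4 * C * (2 * K * (4 * C * s) ^ n / fact n)"
      using abs_lapl_le[of "\<lambda>j. a s j * (v s j - lin_iter a x n s j)"
          "C * (2 * K * (4 * C * s) ^ n / fact n)" i]
        abs_mult_rate_le[OF Suc.IH] Suc.prems by simp
  qed (use Suc.prems in auto)
  finally show ?case .
qed

end

text \<open>Dominated convergence at every order: the constant from \<open>lin_iter_bound\<close>
  does not depend on \<open>m\<close>.\<close>

lemma lin_iter_LIMSEQ:
  assumes a: "bounded_rates a C" and am: "\<And>m. bounded_rates (am m) C"
    and lim: "\<And>s j. s \<in> {0..T} \<Longrightarrow> (\<lambda>m. am m s j) \<longlonglongrightarrow> a s j"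
    and x: "\<And>j. \<bar>x j\<bar> \<le> K" and "t \<in> {0..T}"
  shows "(\<lambda>m. lin_iter (am m) x n t i) \<longlonglongrightarrow> lin_iter a x n t i"
  using \<open>t \<in> {0..T}\<close>
proof (induction n arbitrary: t i)
  case (Suc n)
  have "(\<lambda>m. LBINT s:{0..t}. lapl (\<lambda>j. am m s j * lin_iter (am m) x n s j) i)
      \<longlonglongrightarrow> (LBINT s:{0..t}. lapl (\<lambda>j. a s j * lin_iter a x n s j) i)"
  proof (rule set_integral_dominated_LIMSEQ[where K = "4 * (C * (K * (1 + 4 * C * T) ^ n))"])
    show "(\<lambda>s. lapl (\<lambda>j. am m s j * lin_iter (am m) x n s j) i) \<in> borel_measurable borel" for m
      by (rule bounded_rates.lapl_lin_iter_measurable[OF am])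
    show "(\<lambda>s. lapl (\<lambda>j. a s j * lin_iter a x n s j) i) \<in> borel_measurable borel"
      by (rule bounded_rates.lapl_lin_iter_measurable[OF a])
    show "(\<lambda>m. lapl (\<lambda>j. am m s j * lin_iter (am m) x n s j) i)
        \<longlonglongrightarrow> lapl (\<lambda>j. a s j * lin_iter a x n s j) i" if "s \<in> {0..t}" for s
      unfolding lapl_def using that Suc.prems by (intro tendsto_intros lim Suc.IH) auto
    show "\<bar>lapl (\<lambda>j. am m s j * lin_iter (am m) x n s j) i\<bar> \<le> 4 * (C * (K * (1 + 4 * C * T) ^ n))"
      if "s \<in> {0..t}" for s m
      using that Suc.prems
      by (intro abs_lapl_le bounded_rates.abs_mult_rate_le[OF am] bounded_rates.lin_iter_bound[OF am x]) auto
  qed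
  then show ?case by (auto intro!: tendsto_add)
qed simp

text \<open>The error bound is the same for all \<open>m\<close>, so an iterate of high fixed order
  hands its convergence in \<open>m\<close> over to the solutions. The limit is not shown to solve
  an equation; its distance to the iterates is what is used later.\<close>

lemma linear_solutions_converge:
  assumes a: "bounded_rates a C" and am: "\<And>m. bounded_rates (am m) C"
    and lim: "\<And>s j. s \<in> {0..T} \<Longrightarrow> (\<lambda>m. am m s j) \<longlonglongrightarrow> a s j"
    and v: "\<And>m t i. t \<in> {0..T} \<Longrightarrow> v m t i = x i + (LBINT s:{0..t}. lapl (\<lambda>j. am m s j * v m s j) i)"
    and v_meas: "\<And>m j. (\<lambda>s. v m s j) \<in> borel_measurable borel"
    and v_bound: "\<And>m t j. t \<in> {0..T} \<Longrightarrow> \<bar>v m t j\<bar> \<le> K"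
    and t: "t \<in> {0..T}"
  obtains l where "(\<lambda>m. v m t i) \<longlonglongrightarrow> l"
    and "\<And>n. \<bar>l - lin_iter a x n t i\<bar> \<le> 2 * K * (4 * C * t) ^ n / fact n"
proof -
  let ?e = "\<lambda>n. 2 * K * (4 * C * t) ^ n / fact n"
  have err: "\<bar>v m t i - lin_iter (am m) x n t i\<bar> \<le> ?e n" for m n
    by (rule bounded_rates.lin_iter_error[OF am v v_meas v_bound t])
  have x: "\<bar>x j\<bar> \<le> K" for j
    using v[of 0 0 j] v_bound[of 0 0 j] t by (simp only: set_integral_refl) simp
  have iter: "(\<lambda>m. lin_iter (am m) x n t i) \<longlonglongrightarrow> lin_iter a x n t i" for n
    by (rule lin_iter_LIMSEQ[OF a am lim x t])
  have "Cauchy (\<lambda>m. v m t i)"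
  proof (rule metric_CauchyI)
    fix e :: real assume e: "0 < e"
    have "\<forall>\<^sub>F n in sequentially. ?e n < e / 3"
      using power_div_fact_LIMSEQ_zero[of "2 * K" "4 * C * t"] e by (intro order_tendstoD) auto
    then obtain n where n: "?e n < e / 3" by (auto simp: eventually_sequentially)
    obtain N where N: "\<And>m m'. m \<ge> N \<Longrightarrow> m' \<ge> N \<Longrightarrow>
        dist (lin_iter (am m) x n t i) (lin_iter (am m') x n t i) < e / 3"
      using metric_CauchyD[OF LIMSEQ_imp_Cauchy[OF iter[of n]], of "e / 3"] e by auto
    have "dist (v m t i) (v m' t i) < e" if "m \<ge> N" "m' \<ge> N" for m m'
      using err[of m n] err[of m' n] N[OF that] n unfolding dist_real_def by linarith
    then show "\<exists>N. \<forall>m\<ge>N. \<forall>m'\<ge>N. dist (v m t i) (v m' t i) < e" by blast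
  qed
  then obtain l where l: "(\<lambda>m. v m t i) \<longlonglongrightarrow> l"
    using Cauchy_convergent_iff convergent_def by blast
  have "\<bar>l - lin_iter a x n t i\<bar> \<le> ?e n" for n
    by (rule tendsto_upperbound[OF tendsto_rabs[OF tendsto_diff[OF l iter]]]) (use err in auto)
  with l show ?thesis by (rule that)
qed

section \<open>The Euler scheme for the dynamics\<close>

text \<open>The weight may change by a factor \<open>c\<close> between neighbours. Three choices
  occur: the constant 1, the growing exp(r|i|) for convergence in infinite volume, and the decaying
  exp(-|i|) for locality of the flow.\<close>

lemma abs_lapl_weight_le:
  assumes "\<And>j. w (j + 1) \<le> c * w j" "\<And>j. w (j - 1) \<le> c * w j" "1 \<le> c" "0 \<le> K" "\<And>j. 0 \<le> w j"
    and "\<And>j. \<bar>x j\<bar> \<le> K * w j"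
  shows "\<bar>lapl x i\<bar> \<le> 4 * c * K * w i"
proof -
  have "\<bar>x (i + 1)\<bar> \<le> K * (c * w i)" "\<bar>x (i - 1)\<bar> \<le> K * (c * w i)"
    using assms(6)[of "i + 1"] assms(6)[of "i - 1"] mult_left_mono[OF assms(1) \<open>0 \<le> K\<close>, of i]
      mult_left_mono[OF assms(2) \<open>0 \<le> K\<close>, of i] by linarith+
  moreover have "\<bar>x i\<bar> \<le> K * (c * w i)"
    using assms(6)[of i] mult_left_mono[of "w i" "c * w i" K] assms(3-5) mult_right_mono[OF assms(3) assms(5)[of i]]
    by simp
  ultimately show ?thesis unfolding lapl_def by (simp add: algebra_simps abs_le_iff)
qed

lemma set_integral_diff_Icc:
  fixes g :: "real \<Rightarrow> real"
  assumes "set_integrable lborel {0..b} g" "0 \<le> a" "a \<le> b"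
  shows "(LBINT s:{0..b}. g s) - (LBINT s:{0..a}. g s) = (LBINT s:{a..b}. g s)"
proof -
  have "set_integrable lborel {0..a} g" "set_integrable lborel {a..b} g"
    using assms by (auto intro: set_integrable_subset)
  then show ?thesis
    using assms Henstock_Kurzweil_Integration.integral_combine[of 0 a b g]
    by (simp add: set_borel_integral_eq_integral)
qed

lemma set_integral_const_Icc: "a \<le> b \<Longrightarrow> (LBINT s:{a..b}. (c::real)) = (b - a) * c"
  by (simp add: set_lebesgue_integral_def mult.commute)

text \<open>Explicit Euler steps of length \<open>\<tau>\<close> with exact noise increments. Each
  value uses finitely many coordinates, which makes the scheme jointly measurable in configuration
  and noise.\<close>

primrec euler :: "(real \<Rightarrow> real) \<Rightarrow> real \<Rightarrow> (bond \<times> real \<Rightarrow> real) \<Rightarrow> config \<Rightarrow> nat \<Rightarrow> config" where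
  "euler V \<tau> \<beta> \<zeta> 0 = \<zeta>"
| "euler V \<tau> \<beta> \<zeta> (Suc k) = (\<lambda>i. euler V \<tau> \<beta> \<zeta> k i + \<tau> * gl_drift V (euler V \<tau> \<beta> \<zeta> k) i
     + sqrt 2 * ((\<beta> ((i, i + 1), \<tau> * Suc k) - \<beta> ((i, i + 1), \<tau> * k))
               - (\<beta> ((i - 1, i), \<tau> * Suc k) - \<beta> ((i - 1, i), \<tau> * k))))"

text \<open>\<open>Suc n\<close> steps of length t/(n+1) end exactly at time \<open>t\<close>. This
  is the solution map as a function on configurations and noises, free of any probability
  space.\<close>

definition euler_limit :: "(real \<Rightarrow> real) \<Rightarrow> real \<Rightarrow> (bond \<times> real \<Rightarrow> real) \<Rightarrow> config \<Rightarrow> config" where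
  "euler_limit V t \<beta> \<zeta> i = lim (\<lambda>n. euler V (t / Suc n) \<beta> \<zeta> (Suc n) i)"

text \<open>Continuity is asked in a weighted supremum norm, and only of differences in time. The
  Euler scheme converges under this condition, and the condition is kept when a bounded correction
  that is Lipschitz in time is added.\<close>

definition mild_path :: "(real \<Rightarrow> real) \<Rightarrow> real \<Rightarrow> (bond \<times> real \<Rightarrow> real) \<Rightarrow> (real \<Rightarrow> config) \<Rightarrow> bool" where
  "mild_path V r \<beta> h \<longleftrightarrow>
     (\<forall>t\<ge>0. \<forall>e>0. \<exists>d>0. \<forall>s\<ge>0. \<bar>s - t\<bar> < d \<longrightarrow>
        (\<forall>i. \<bar>h s i - h t i\<bar> \<le> e * exp (r * \<bar>real_of_int i\<bar>))) \<and>
     (\<forall>t\<ge>0. \<forall>i. h t i = h 0 i + (LBINT s:{0..t}. gl_drift V (h s) i)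
                  + sqrt 2 * (\<beta> ((i, i + 1), t) - \<beta> ((i - 1, i), t)))"

lemma mild_path_eq:
  "mild_path V r \<beta> h \<Longrightarrow> 0 \<le> t \<Longrightarrow> h t i = h 0 i + (LBINT s:{0..t}. gl_drift V (h s) i)
     + sqrt 2 * (\<beta> ((i, i + 1), t) - \<beta> ((i - 1, i), t))"
  unfolding mild_path_def by blast

text \<open>A single term of the weighted sum is at most the sum; taking square roots halves the
  exponent.\<close>

lemma gl_path_imp_mild_path:
  assumes "gl_path V r (\<lambda>b t. \<beta> (b, t)) h"
  shows "mild_path V (r / 2) \<beta> h"
  unfolding mild_path_def
proof (intro conjI allI impI)
  fix t e :: real assume t: "0 \<le> t" and e: "0 < e"
  have "((\<lambda>s. weighted_norm_sq r (\<lambda>i. h s i - h t i)) \<longlongrightarrow> 0) (at t within {0..})"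
    using assms t unfolding gl_path_def by blast
  then have "\<forall>\<^sub>F s in at t within {0..}. weighted_norm_sq r (\<lambda>i. h s i - h t i) < e\<^sup>2"
    using e by (intro order_tendstoD) auto
  then obtain d where d: "0 < d"
    "\<And>s. s \<ge> 0 \<Longrightarrow> s \<noteq> t \<Longrightarrow> dist s t < d \<Longrightarrow> weighted_norm_sq r (\<lambda>i. h s i - h t i) < e\<^sup>2"
    unfolding eventually_at by auto
  have "\<bar>h s i - h t i\<bar> \<le> e * exp (r / 2 * \<bar>real_of_int i\<bar>)" if s: "0 \<le> s" "\<bar>s - t\<bar> < d" for s i
  proof (cases "s = t")
    case False
    let ?f = "\<lambda>i. (h s i - h t i)\<^sup>2 * exp (- r * \<bar>real_of_int i\<bar>)"
    have w: "h s \<in> weighted_space r" "h t \<in> weighted_space r"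
      using assms s t unfolding gl_path_def by auto
    \<comment> \<open>Summability has to be checked: a divergent infinite sum is 0 by default and
      would not bound its terms.\<close>
    have "(\<lambda>i. 2 * ((h s i)\<^sup>2 * exp (- r * \<bar>real_of_int i\<bar>)) + 2 * ((h t i)\<^sup>2 * exp (- r * \<bar>real_of_int i\<bar>))) summable_on UNIV"
      using w unfolding weighted_space_def by (auto intro!: summable_on_add summable_on_cmult_right)
    then have sum: "?f summable_on UNIV"
    proof (rule summable_on_comparison_test)
      fix i
      have "(h s i - h t i)\<^sup>2 \<le> 2 * (h s i)\<^sup>2 + 2 * (h t i)\<^sup>2"
        using zero_le_power2[of "h s i + h t i"] by (simp add: power2_eq_square algebra_simps)
      from mult_right_mono[OF this, of "exp (- r * \<bar>real_of_int i\<bar>)"]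
      show "?f i \<le> 2 * ((h s i)\<^sup>2 * exp (- r * \<bar>real_of_int i\<bar>)) + 2 * ((h t i)\<^sup>2 * exp (- r * \<bar>real_of_int i\<bar>))"
        by (simp add: algebra_simps)
    qed simp
    have "?f i \<le> (\<Sum>\<^sub>\<infinity>i. ?f i)"
      using infsum_mono_neutral[of ?f "{i}" ?f UNIV] sum by simp
    also have "\<dots> < e\<^sup>2"
      using d(2)[OF s(1) False] s(2) by (simp add: weighted_norm_sq_def dist_real_def)
    finally have less: "?f i < e\<^sup>2" .
    let ?A = "exp (r / 2 * \<bar>real_of_int i\<bar>)"
    have one: "exp (- r * \<bar>real_of_int i\<bar>) * ?A\<^sup>2 = 1"
      unfolding exp_double[symmetric] by (simp add: mult_exp_exp)
    have "(h s i - h t i)\<^sup>2 = ?f i * ?A\<^sup>2"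
      by (simp only: mult.assoc one mult_1_right)
    also have "\<dots> \<le> e\<^sup>2 * ?A\<^sup>2"
      using less by (intro mult_right_mono) auto
    finally have "\<bar>h s i - h t i\<bar>\<^sup>2 \<le> (e * ?A)\<^sup>2"
      by (simp only: power2_abs power_mult_distrib)
    then show ?thesis by (rule power2_le_imp_le) (use e in auto)
  qed (use e in auto)
  then show "\<exists>d>0. \<forall>s\<ge>0. \<bar>s - t\<bar> < d \<longrightarrow> (\<forall>i. \<bar>h s i - h t i\<bar> \<le> e * exp (r / 2 * \<bar>real_of_int i\<bar>))"
    using d(1) by blast
next
  fix t :: real and i assume "0 \<le> t"
  then show "h t i = h 0 i + (LBINT s:{0..t}. gl_drift V (h s) i)
                  + sqrt 2 * (\<beta> ((i, i + 1), t) - \<beta> ((i - 1, i), t))"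
    using assms unfolding gl_path_def by blast
qed

lemma mild_path_continuous_on:
  assumes "mild_path V r \<beta> h"
  shows "continuous_on {0..} (\<lambda>s. h s i)"
  unfolding continuous_on_iff
proof (intro ballI allI impI)
  fix t e :: real assume "t \<in> {0..}" "0 < e"
  then obtain d where d: "d > 0"
    "\<And>s. s \<ge> 0 \<Longrightarrow> \<bar>s - t\<bar> < d \<Longrightarrow> \<bar>h s i - h t i\<bar> \<le> e / 2 / exp (r * \<bar>real_of_int i\<bar>) * exp (r * \<bar>real_of_int i\<bar>)"
    using assms[unfolded mild_path_def, THEN conjunct1, rule_format,
        of t "e / 2 / exp (r * \<bar>real_of_int i\<bar>)"] by (metis atLeast_iff divide_pos_pos exp_gt_zero zero_less_numeral)
  have "dist (h s i) (h t i) < e" if "s \<in> {0..}" "dist s t < d" for s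
    using d(2)[of s] that \<open>0 < e\<close> by (simp add: dist_real_def)
  with d(1) show "\<exists>d>0. \<forall>s\<in>{0..}. dist s t < d \<longrightarrow> dist (h s i) (h t i) < e" by blast
qed

text \<open>Heine-Cantor through a Lebesgue number for the cover of [0,T] by balls on which
  \<open>h\<close> varies by at most half of \<open>e\<close> in the weighted norm; the modulus
  thereby is uniform over all sites.\<close>

lemma mild_path_uniformly_continuous:
  assumes "mild_path V r \<beta> h" "0 < e"
  obtains d where "0 < d" "\<And>s u i. s \<in> {0..T} \<Longrightarrow> u \<in> {0..T} \<Longrightarrow> \<bar>s - u\<bar> < d \<Longrightarrow>
    \<bar>h s i - h u i\<bar> \<le> e * exp (r * \<bar>real_of_int i\<bar>)"
proof -
  have "\<forall>t\<in>{0..T}. \<exists>d>0. \<forall>s\<ge>0. \<bar>s - t\<bar> < d \<longrightarrow> (\<forall>i. \<bar>h s i - h t i\<bar> \<le> e / 2 * exp (r * \<bar>real_of_int i\<bar>))"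
    using assms(1)[unfolded mild_path_def, THEN conjunct1, rule_format, of _ "e / 2"] half_gt_zero[OF assms(2)]
    by (meson atLeastAtMost_iff)
  then obtain d where d: "\<And>t. t \<in> {0..T} \<Longrightarrow> d t > 0"
    "\<And>t s i. t \<in> {0..T} \<Longrightarrow> s \<ge> 0 \<Longrightarrow> \<bar>s - t\<bar> < d t \<Longrightarrow> \<bar>h s i - h t i\<bar> \<le> e / 2 * exp (r * \<bar>real_of_int i\<bar>)"
    by metis
  obtain c where c: "0 < c" "\<And>x. x \<in> {0..T} \<Longrightarrow> \<exists>G\<in>(\<lambda>t. ball t (d t)) ` {0..T}. ball x c \<subseteq> G"
  proof (rule Heine_Borel_lemma[of "{0..T}" "(\<lambda>t. ball t (d t)) ` {0..T}"])
    show "{0..T} \<subseteq> \<Union> ((\<lambda>t. ball t (d t)) ` {0..T})"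
      using d(1) by (intro subsetI UN_I) auto
  qed auto
  show thesis
  proof (rule that[OF c(1)])
    fix s u i assume su: "s \<in> {0..T}" "u \<in> {0..T}" "\<bar>s - u\<bar> < c"
    then obtain t where t: "t \<in> {0..T}" "ball s c \<subseteq> ball t (d t)"
      using c(2) by blast
    have "s \<in> ball t (d t)" "u \<in> ball t (d t)"
      using t(2) su c(1) by (auto simp: subset_iff dist_real_def)
    then have "\<bar>h s i - h t i\<bar> \<le> e * exp (r * \<bar>real_of_int i\<bar>) / 2" "\<bar>h u i - h t i\<bar> \<le> e * exp (r * \<bar>real_of_int i\<bar>) / 2"
      using d(2)[OF t(1), of s i] d(2)[OF t(1), of u i] su by (auto simp: dist_real_def abs_minus_commute)
    then show "\<bar>h s i - h u i\<bar> \<le> e * exp (r * \<bar>real_of_int i\<bar>)" by linarith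
  qed
qed

locale potential =
  fixes V :: "real \<Rightarrow> real" and Cmin C :: real
  assumes V_differentiable: "\<And>x. V differentiable (at x)"
    and V'_differentiable: "\<And>x. deriv V differentiable (at x)"
    and Cmin_pos: "0 < Cmin"
    and V''_ge: "\<And>x. Cmin \<le> deriv (deriv V) x"
    and V''_le: "\<And>x. deriv (deriv V) x \<le> C"
begin

lemma C_pos: "0 < C"
  using Cmin_pos V''_ge[of 0] V''_le[of 0] by linarith

lemma V'_DERIV: "(deriv V has_real_derivative deriv (deriv V) x) (at x)"
  using V'_differentiable by (simp add: DERIV_deriv_iff_real_differentiable)

lemma V_DERIV: "(V has_real_derivative deriv V x) (at x)"
  using V_differentiable by (simp add: DERIV_deriv_iff_real_differentiable)

lemma V''_abs_le: "\<bar>deriv (deriv V) x\<bar> \<le> C"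
  using V''_ge[of x] V''_le[of x] Cmin_pos by linarith

lemma V'_lipschitz: "\<bar>deriv V x - deriv V y\<bar> \<le> C * \<bar>x - y\<bar>"
  using field_differentiable_bound[of UNIV "deriv V" "deriv (deriv V)" C x y] V'_DERIV V''_abs_le
  by simp

lemma V'_continuous: "continuous_on S (deriv V)"
  by (meson DERIV_isCont V'_DERIV continuous_at_imp_continuous_on)

lemma V'_measurable [measurable]: "deriv V \<in> borel_measurable borel"
  by (intro borel_measurable_continuous_onI V'_continuous)

lemma V_measurable [measurable]: "V \<in> borel_measurable borel"
  by (intro borel_measurable_continuous_onI) (meson DERIV_isCont V_DERIV continuous_at_imp_continuous_on)

text \<open>\<open>deriv (deriv V)\<close> need not be continuous, but it is a pointwise limit of
  difference quotients of the continuous \<open>deriv V\<close>.\<close>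

lemma V''_measurable [measurable]: "deriv (deriv V) \<in> borel_measurable borel"
proof (rule borel_measurable_LIMSEQ_real)
  fix x
  have "(\<lambda>n. 1 / real (Suc n)) \<longlonglongrightarrow> 0"
    using LIMSEQ_inverse_real_of_nat by (simp add: inverse_eq_divide)
  then have "filterlim (\<lambda>n. 1 / real (Suc n)) (at 0) sequentially"
    by (intro filterlim_atI) auto
  from filterlim_compose[OF V'_DERIV[of x, unfolded DERIV_def] this]
  show "(\<lambda>n. (deriv V (x + 1 / Suc n) - deriv V x) / (1 / Suc n)) \<longlonglongrightarrow> deriv (deriv V) x" .
qed measurable

lemma drift_integrable:
  fixes h :: "real \<Rightarrow> config"
  assumes "\<And>j. continuous_on {0..} (\<lambda>s. h s j)"
  shows "set_integrable lborel {0..t} (\<lambda>s. gl_drift V (h s) i)"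
proof -
  have "continuous_on {0..t} (\<lambda>s. deriv V (h s j))" for j
    by (rule continuous_on_compose2[OF V'_continuous[of UNIV] continuous_on_subset[OF assms]]) auto
  then have "continuous_on {0..t} (\<lambda>s. gl_drift V (h s) i)"
    unfolding gl_drift_def by (intro continuous_intros)
  then show ?thesis by (rule borel_integrable_atLeastAtMost')
qed

text \<open>Both schemes use the same noise, which cancels. \<open>deriv V\<close> contributes a
  factor \<open>C\<close> and the weighted Laplacian \<open>4 * c\<close>, so one step expands the
  weighted distance by at most \<open>1 + 4 * c * C * \<tau>\<close>.\<close>

lemma euler_lipschitz:
  assumes w: "\<And>j. w (j + 1) \<le> c * w j" "\<And>j. w (j - 1) \<le> c * w j" "1 \<le> c" "\<And>j. 0 \<le> w j"
    and "0 \<le> \<tau>" "0 \<le> K" and "\<And>j. \<bar>\<zeta> j - \<zeta>' j\<bar> \<le> K * w j"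
  shows "\<bar>euler V \<tau> \<beta> \<zeta> k i - euler V \<tau> \<beta> \<zeta>' k i\<bar> \<le> K * (1 + 4 * c * C * \<tau>) ^ k * w i"
proof (induction k arbitrary: i)
  case 0
  then show ?case using assms by simp
next
  case (Suc k)
  let ?z = "euler V \<tau> \<beta> \<zeta> k" and ?z' = "euler V \<tau> \<beta> \<zeta>' k"
  let ?K = "K * (1 + 4 * c * C * \<tau>) ^ k"
  have K: "0 \<le> ?K" using assms C_pos by auto
  have "\<bar>deriv V (?z j) - deriv V (?z' j)\<bar> \<le> C * ?K * w j" for j
    using order_trans[OF V'_lipschitz mult_left_mono[OF Suc.IH[of j], of C]] C_pos
    by (simp only: mult.assoc less_imp_le)
  from abs_lapl_weight_le[OF w(1-3) _ w(4) this, of i]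
  have "\<bar>lapl (\<lambda>j. deriv V (?z j) - deriv V (?z' j)) i\<bar> \<le> 4 * c * (C * ?K) * w i"
    using K C_pos by (simp add: mult.assoc)
  from mult_left_mono[OF this \<open>0 \<le> \<tau>\<close>]
  have "\<bar>\<tau> * (gl_drift V ?z i - gl_drift V ?z' i)\<bar> \<le> \<tau> * (4 * c * (C * ?K) * w i)"
    using \<open>0 \<le> \<tau>\<close> by (simp add: gl_drift_eq_lapl lapl_diff abs_mult)
  then show ?case
    using Suc.IH[of i] by (simp add: algebra_simps abs_le_iff)
qed

text \<open>The noise enters the scheme exactly, so the only local error is the oscillation of
  \<open>h\<close> within a step, at most \<open>e * w\<close>. The bound solves the recursion that
  sends E to E + 4cC\<tau>(E + e), started at 0; this is where the -1 comes from.\<close>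

lemma euler_error:
  fixes \<tau> :: real
  assumes w: "\<And>j. w (j + 1) \<le> c * w j" "\<And>j. w (j - 1) \<le> c * w j" "1 \<le> c" "\<And>j. 0 \<le> w j"
    and "0 \<le> \<tau>" "0 \<le> e" and h: "mild_path V r \<beta> h"
    and e: "\<And>k s j. k < N \<Longrightarrow> s \<in> {\<tau> * k..\<tau> * Suc k} \<Longrightarrow> \<bar>h s j - h (\<tau> * k) j\<bar> \<le> e * w j"
    and "k \<le> N"
  shows "\<bar>h (\<tau> * k) i - euler V \<tau> \<beta> (h 0) k i\<bar> \<le> e * ((1 + 4 * c * C * \<tau>) ^ k - 1) * w i"
  using \<open>k \<le> N\<close>
proof (induction k arbitrary: i)
  case 0
  then show ?case by simp
next
  case (Suc k)
  let ?z = "euler V \<tau> \<beta> (h 0) k"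
  let ?I = "{\<tau> * real k..\<tau> * real (Suc k)}"
  let ?K = "e * (1 + 4 * c * C * \<tau>) ^ k"
  have K: "0 \<le> ?K" using assms C_pos by auto
  have le: "0 \<le> \<tau> * k" "\<tau> * k \<le> \<tau> * Suc k" using \<open>0 \<le> \<tau>\<close> by (auto intro: mult_left_mono)
  have int0: "set_integrable lborel {0..\<tau> * Suc k} (\<lambda>s. gl_drift V (h s) i)"
    by (intro drift_integrable mild_path_continuous_on[OF h])
  have int: "set_integrable lborel ?I (\<lambda>s. gl_drift V (h s) i)"
    by (rule set_integrable_subset[OF int0]) (use le in auto)
  have intc: "set_integrable lborel ?I (\<lambda>s. c)" for c :: real
    by (rule set_integrable_bounded[where K = "\<bar>c\<bar>"]) auto
  have "h (\<tau> * Suc k) i - h (\<tau> * k) i = (LBINT s:?I. gl_drift V (h s) i)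
     + sqrt 2 * ((\<beta> ((i, i + 1), \<tau> * Suc k) - \<beta> ((i, i + 1), \<tau> * k))
               - (\<beta> ((i - 1, i), \<tau> * Suc k) - \<beta> ((i - 1, i), \<tau> * k)))"
    using mild_path_eq[OF h, of "\<tau> * k" i] mild_path_eq[OF h, of "\<tau> * Suc k" i] le
      set_integral_diff_Icc[OF int0 le] by (simp add: algebra_simps)
  then have eq: "h (\<tau> * Suc k) i - euler V \<tau> \<beta> (h 0) (Suc k) i
      = (h (\<tau> * k) i - ?z i) + ((LBINT s:?I. gl_drift V (h s) i) - \<tau> * gl_drift V ?z i)"
    by simp
  have "(LBINT s:?I. gl_drift V (h s) i) - \<tau> * gl_drift V ?z i
      = (LBINT s:?I. gl_drift V (h s) i) - (LBINT s:?I. gl_drift V ?z i)"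
    by (simp only: set_integral_const_Icc[OF le(2)]) (simp add: algebra_simps)
  also have "\<dots> = (LBINT s:?I. gl_drift V (h s) i - gl_drift V ?z i)"
    using int intc by (simp add: set_integral_diff)
  finally have diff: "(LBINT s:?I. gl_drift V (h s) i) - \<tau> * gl_drift V ?z i
      = (LBINT s:?I. gl_drift V (h s) i - gl_drift V ?z i)" .
  have "\<bar>LBINT s:?I. gl_drift V (h s) i - gl_drift V ?z i\<bar> \<le> (LBINT s:?I. 4 * c * (C * ?K) * w i)"
  proof (rule abs_set_integral_le[OF intc])
    fix s assume s: "s \<in> ?I"
    have lip: "\<bar>deriv V x - deriv V y\<bar> \<le> C * ?K * w j" if "\<bar>x - y\<bar> \<le> ?K * w j" for x y j
      using order_trans[OF V'_lipschitz mult_left_mono[OF that, of C]] C_pos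
      by (simp only: mult.assoc less_imp_le)
    have "\<bar>h s j - ?z j\<bar> \<le> ?K * w j" for j
    proof -
      have "\<bar>h s j - h (\<tau> * k) j\<bar> \<le> e * w j" using e[OF _ s, of j] Suc.prems by simp
      moreover have "\<bar>h (\<tau> * k) j - ?z j\<bar> \<le> ?K * w j - e * w j"
        using Suc.IH[of j] Suc.prems by (simp add: algebra_simps)
      ultimately show ?thesis by linarith
    qed
    from lip[OF this] have "\<bar>deriv V (h s j) - deriv V (?z j)\<bar> \<le> C * ?K * w j" for j .
    from abs_lapl_weight_le[OF w(1-3) _ w(4) this, of i]
    show "\<bar>gl_drift V (h s) i - gl_drift V ?z i\<bar> \<le> 4 * c * (C * ?K) * w i"
      using K C_pos by (simp add: gl_drift_eq_lapl lapl_diff mult.assoc)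
  qed
  also have "\<dots> = \<tau> * (4 * c * (C * ?K) * w i)"
    by (simp only: set_integral_const_Icc[OF le(2)]) (simp add: algebra_simps)
  finally show ?case
    using Suc.IH[of i] Suc.prems unfolding eq diff
    by (intro order_trans[OF abs_triangle_ineq]) (simp add: algebra_simps)
qed

lemma euler_growth_le:
  assumes "0 \<le> t" "0 \<le> c"
  shows "(1 + 4 * c * C * (t / Suc n)) ^ Suc n \<le> exp (4 * c * C * t)"
proof -
  have "0 \<le> 4 * c * C * t" using assms C_pos by simp
  then have "- real (Suc n) \<le> 4 * c * C * t" by linarith
  from exp_ge_one_plus_x_over_n_power_n[OF this] show ?thesis
    by (simp del: power_Suc of_nat_Suc)
qed

lemma exp_abs_shift_le:
  assumes "0 \<le> r"
  shows "exp (r * \<bar>real_of_int (j + 1)\<bar>) \<le> exp r * exp (r * \<bar>real_of_int j\<bar>)"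
    "exp (r * \<bar>real_of_int (j - 1)\<bar>) \<le> exp r * exp (r * \<bar>real_of_int j\<bar>)"
  using mult_left_mono[OF _ assms, of "\<bar>real_of_int (j + 1)\<bar>" "1 + \<bar>real_of_int j\<bar>"]
    mult_left_mono[OF _ assms, of "\<bar>real_of_int (j - 1)\<bar>" "1 + \<bar>real_of_int j\<bar>"]
  by (auto simp flip: exp_add simp: algebra_simps)

theorem euler_converges:
  assumes h: "mild_path V r \<beta> h" and "0 \<le> r" "0 \<le> t"
  shows "(\<lambda>n. euler V (t / Suc n) \<beta> (h 0) (Suc n) i) \<longlonglongrightarrow> h t i"
proof (rule metric_LIMSEQ_I)
  fix e :: real assume "0 < e"
  let ?w = "\<lambda>j. exp (r * \<bar>real_of_int j\<bar>)"
  let ?G = "exp (4 * exp r * C * t)"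
  \<comment> \<open>Chosen so that \<open>e' * ?G * ?w i\<close> equals \<open>e\<close>;
    \<open>?G\<close> bounds the growth of the scheme for every number of steps.\<close>
  define e' where "e' = e / (?G * ?w i)"
  have e': "0 < e'" unfolding e'_def using \<open>0 < e\<close> by simp
  obtain d where d: "0 < d" "\<And>s u i. s \<in> {0..t} \<Longrightarrow> u \<in> {0..t} \<Longrightarrow> \<bar>s - u\<bar> < d \<Longrightarrow>
    \<bar>h s i - h u i\<bar> \<le> e' * ?w i"
    using mild_path_uniformly_continuous[OF h e', of t] by blast
  have "(\<lambda>n. t * (1 / real (Suc n))) \<longlonglongrightarrow> t * 0"
    using LIMSEQ_inverse_real_of_nat by (intro tendsto_mult tendsto_const) (simp add: inverse_eq_divide)
  then have "\<forall>\<^sub>F n in sequentially. t * (1 / real (Suc n)) < d"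
    using d(1) by (intro order_tendstoD) auto
  then obtain n0 where n0: "\<And>n. n \<ge> n0 \<Longrightarrow> t / Suc n < d" by (auto simp: eventually_sequentially)
  have "dist (euler V (t / Suc n) \<beta> (h 0) (Suc n) i) (h t i) < e" if n: "n \<ge> n0" for n
  proof -
    let ?\<tau> = "t / Suc n"
    have tt: "?\<tau> * Suc n = t" by simp
    have "\<bar>h (?\<tau> * Suc n) i - euler V ?\<tau> \<beta> (h 0) (Suc n) i\<bar>
        \<le> e' * ((1 + 4 * exp r * C * ?\<tau>) ^ Suc n - 1) * ?w i"
    proof (rule euler_error[where N = "Suc n"])
      fix k s j assume k: "k < Suc n" and s: "s \<in> {?\<tau> * k..?\<tau> * Suc k}"
      have "?\<tau> * Suc k \<le> ?\<tau> * Suc n" "0 \<le> ?\<tau> * k" "?\<tau> * k \<le> ?\<tau> * Suc k"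
        using k \<open>0 \<le> t\<close> by (intro mult_left_mono mult_nonneg_nonneg; simp)+
      moreover have "x * real (Suc k) - x * real k = x" for x
        by (simp add: algebra_simps)
      note this[of ?\<tau>]
      ultimately have "s \<in> {0..t}" "?\<tau> * k \<in> {0..t}" "\<bar>s - ?\<tau> * k\<bar> < d"
        using s n0[OF n] tt unfolding atLeastAtMost_iff by linarith+
      then show "\<bar>h s j - h (?\<tau> * k) j\<bar> \<le> e' * ?w j" by (rule d(2))
    qed (use assms e' exp_abs_shift_le[OF \<open>0 \<le> r\<close>] in auto)
    also have "\<dots> \<le> e' * (?G - 1) * ?w i"
      using euler_growth_le[of t "exp r" n] \<open>0 \<le> t\<close> e' by (intro mult_right_mono mult_left_mono) auto
    also have "\<dots> < e' * ?G * ?w i"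
      using e' by simp
    also have "\<dots> = e" unfolding e'_def by simp
    finally show ?thesis unfolding tt by (simp add: dist_real_def abs_minus_commute)
  qed
  then show "\<exists>n0. \<forall>n\<ge>n0. dist (euler V (t / Suc n) \<beta> (h 0) (Suc n) i) (h t i) < e" by blast
qed

lemma euler_limit_eq:
  assumes "mild_path V r \<beta> h" "0 \<le> r" "0 \<le> t"
  shows "euler_limit V t \<beta> (h 0) i = h t i"
  unfolding euler_limit_def by (rule limI[OF euler_converges[OF assms]])

text \<open>The bound for the two Euler schemes with common noise passes to the limit, in place of a
  Gronwall argument for the infinite system. Equal initial values give uniqueness.\<close>

lemma mild_path_lipschitz:
  assumes "mild_path V r \<beta> h" "mild_path V r \<beta> h'" "0 \<le> r" "0 \<le> t"
    and w: "\<And>j. w (j + 1) \<le> c * w j" "\<And>j. w (j - 1) \<le> c * w j" "1 \<le> c" "\<And>j. 0 \<le> w j"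
    and "0 \<le> K" and "\<And>j. \<bar>h 0 j - h' 0 j\<bar> \<le> K * w j"
  shows "\<bar>h t i - h' t i\<bar> \<le> K * exp (4 * c * C * t) * w i"
proof (rule tendsto_upperbound)
  show "(\<lambda>n. \<bar>euler V (t / Suc n) \<beta> (h 0) (Suc n) i - euler V (t / Suc n) \<beta> (h' 0) (Suc n) i\<bar>)
      \<longlonglongrightarrow> \<bar>h t i - h' t i\<bar>"
    using assms(1-4) by (intro tendsto_intros euler_converges)
  have "\<bar>euler V (t / Suc n) \<beta> (h 0) (Suc n) i - euler V (t / Suc n) \<beta> (h' 0) (Suc n) i\<bar>
      \<le> K * exp (4 * c * C * t) * w i" for n
  proof -
    have "\<bar>euler V (t / Suc n) \<beta> (h 0) (Suc n) i - euler V (t / Suc n) \<beta> (h' 0) (Suc n) i\<bar>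
        \<le> K * (1 + 4 * c * C * (t / Suc n)) ^ Suc n * w i"
      by (rule euler_lipschitz[OF w]) (use assms in auto)
    also have "\<dots> \<le> K * exp (4 * c * C * t) * w i"
      using assms euler_growth_le[of t c n] by (intro mult_right_mono mult_left_mono) auto
    finally show ?thesis .
  qed
  then show "\<forall>\<^sub>F n in sequentially. \<bar>euler V (t / Suc n) \<beta> (h 0) (Suc n) i - euler V (t / Suc n) \<beta> (h' 0) (Suc n) i\<bar>
      \<le> K * exp (4 * c * C * t) * w i" by simp
qed simp

end

section \<open>Perturbed solutions and the linearised dynamics\<close>

text \<open>Iterates for the difference of two solutions driven by the same noise: the noise drops
  out and a bounded unknown remains, although \<open>h\<close> itself may be unbounded in
  space.\<close>

primrec picard :: "(real \<Rightarrow> real) \<Rightarrow> (real \<Rightarrow> config) \<Rightarrow> config \<Rightarrow> nat \<Rightarrow> real \<Rightarrow> config" where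
  "picard V h x 0 t = x"
| "picard V h x (Suc n) t = (\<lambda>i. x i + (LBINT s:{0..t}.
     gl_drift V (\<lambda>j. h s j + picard V h x n s j) i - gl_drift V (h s) i))"

context potential
begin

lemma abs_drift_diff_le:
  assumes "\<And>j. \<bar>y j - z j\<bar> \<le> K"
  shows "\<bar>gl_drift V y i - gl_drift V z i\<bar> \<le> 4 * C * K"
proof -
  have "\<bar>deriv V (y j) - deriv V (z j)\<bar> \<le> C * K" for j
    using order_trans[OF V'_lipschitz mult_left_mono[OF assms, of C]] C_pos by simp
  from abs_lapl_le[of "\<lambda>j. deriv V (y j) - deriv V (z j)", OF this, of i] show ?thesis
    by (simp add: gl_drift_eq_lapl lapl_diff mult.assoc)
qed

lemma drift_measurable [measurable]:
  assumes [measurable]: "\<And>j. (\<lambda>s. h s j) \<in> borel_measurable M"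
  shows "(\<lambda>s. gl_drift V (h s) i) \<in> borel_measurable M"
  unfolding gl_drift_def by measurable

lemma picard_measurable:
  assumes [measurable]: "\<And>j. (\<lambda>s. h s j) \<in> borel_measurable borel"
  shows "(\<lambda>t. picard V h x n t i) \<in> borel_measurable borel"
proof (induction n arbitrary: i)
  case (Suc n)
  note [measurable] = Suc
  show ?case
    unfolding picard.simps
    by (intro borel_measurable_add borel_measurable_const interval_integral_measurable) measurable
qed simp

lemma sum_power_fact_le_exp: "0 \<le> x \<Longrightarrow> (\<Sum>k<n. x ^ k / fact k) \<le> exp (x::real)"
  unfolding exp_def
  using sum_le_suminf[OF summable_exp_generic[of x], of "{..<n}"]
  by (simp add: divide_inverse mult.commute)

text \<open>The drift difference is Lipschitz in the supremum norm of the perturbation with constant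
  4C, uniformly over \<open>h\<close>, so Picard iteration converges at all times.\<close>

lemma perturbed_flow_exists:
  assumes h_meas [measurable]: "\<And>j. (\<lambda>s. h s j) \<in> borel_measurable borel"
    and x: "\<And>j. \<bar>x j\<bar> \<le> K"
  obtains \<delta> where "\<And>j. (\<lambda>s. \<delta> s j) \<in> borel_measurable borel"
    and "\<And>t i. 0 \<le> t \<Longrightarrow> \<bar>\<delta> t i\<bar> \<le> K * exp (4 * C * t)"
    and "\<And>t i. 0 \<le> t \<Longrightarrow> \<delta> t i = x i + (LBINT s:{0..t}. gl_drift V (\<lambda>j. h s j + \<delta> s j) i - gl_drift V (h s) i)"
proof -
  let ?p = "picard V h x"
  note [measurable] = picard_measurable[where h = h and x = x, OF h_meas]
  have K: "0 \<le> K" using x[of 0] by linarith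
  \<comment> \<open>Size and increment go through one induction: the size bound supplies the
    integrability needed to subtract two integrals in the increment bound.\<close>
  have partial: "(\<forall>i. \<bar>?p n t i\<bar> \<le> K * (\<Sum>k<Suc n. (4 * C * t) ^ k / fact k))
    \<and> (\<forall>i. \<bar>?p (Suc n) t i - ?p n t i\<bar> \<le> K * (4 * C * t) ^ Suc n / fact (Suc n))" if "0 \<le> t" for n t
    using that
  proof (induction n arbitrary: t)
    case 0
    have "\<bar>LBINT s:{0..t}. gl_drift V (\<lambda>j. h s j + x j) i - gl_drift V (h s) i\<bar>
        \<le> K * (4 * C * t) ^ Suc 0 / fact (Suc 0)" for i
      by (rule abs_set_integral_power_le[OF 0], simp, rule abs_drift_diff_le) (simp add: x)
    then show ?case using x by simp
  next
    case (Suc n)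
    have 1: "\<bar>?p (Suc n) t i\<bar> \<le> K * (\<Sum>k<Suc (Suc n). (4 * C * t) ^ k / fact k)" if "0 \<le> t" for t i
    proof -
      have "K * (\<Sum>k<Suc (Suc n). (4 * C * t) ^ k / fact k)
          = K * (\<Sum>k<Suc n. (4 * C * t) ^ k / fact k) + K * (4 * C * t) ^ Suc n / fact (Suc n)"
        by (simp only: sum.lessThan_Suc[of _ "Suc n"] distrib_left times_divide_eq_right)
      moreover have "\<bar>?p n t i\<bar> \<le> K * (\<Sum>k<Suc n. (4 * C * t) ^ k / fact k)"
        "\<bar>?p (Suc n) t i - ?p n t i\<bar> \<le> K * (4 * C * t) ^ Suc n / fact (Suc n)"
        using Suc.IH[OF that] by blast+
      ultimately show ?thesis by linarith
    qed
    have int: "set_integrable lborel {0..t} (\<lambda>s. gl_drift V (\<lambda>j. h s j + ?p m s j) i - gl_drift V (h s) i)"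
      if m: "m = n \<or> m = Suc n" for m i
    proof (rule set_integrable_bounded)
      fix s assume s: "s \<in> {0..t}"
      have "\<bar>?p m s j\<bar> \<le> K * exp (4 * C * t)" for j
      proof -
        have "\<bar>?p m s j\<bar> \<le> K * (\<Sum>k<Suc m. (4 * C * s) ^ k / fact k)"
          using 1[of s j] Suc.IH[of s] s m by (auto simp del: picard.simps)
        also have "\<dots> \<le> K * exp (4 * C * s)"
          using s C_pos K by (intro mult_left_mono sum_power_fact_le_exp) auto
        also have "\<dots> \<le> K * exp (4 * C * t)"
          using s C_pos K by (intro mult_left_mono) auto
        finally show ?thesis .
      qed
      then show "\<bar>gl_drift V (\<lambda>j. h s j + ?p m s j) i - gl_drift V (h s) i\<bar> \<le> 4 * C * (K * exp (4 * C * t))"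
        by (intro abs_drift_diff_le) simp
    qed measurable
    have "?p (Suc (Suc n)) t i - ?p (Suc n) t i
      = (LBINT s:{0..t}. gl_drift V (\<lambda>j. h s j + ?p (Suc n) s j) i - gl_drift V (\<lambda>j. h s j + ?p n s j) i)" for i
      using set_integral_diff(2)[OF int[of "Suc n" i] int[of n i]] by simp
    moreover have "\<bar>LBINT s:{0..t}. gl_drift V (\<lambda>j. h s j + ?p (Suc n) s j) i - gl_drift V (\<lambda>j. h s j + ?p n s j) i\<bar>
        \<le> K * (4 * C * t) ^ Suc (Suc n) / fact (Suc (Suc n))" for i
      by (intro abs_set_integral_power_le abs_drift_diff_le Suc.prems)
         (use Suc.IH in \<open>auto simp del: picard.simps fact_Suc power_Suc\<close>)
    ultimately show ?case using 1[OF Suc.prems] by (simp del: picard.simps fact_Suc power_Suc)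
  qed
  have bound: "\<bar>?p n t i\<bar> \<le> K * exp (4 * C * t)" if "0 \<le> t" for n t i
  proof -
    have "\<bar>?p n t i\<bar> \<le> K * (\<Sum>k<Suc n. (4 * C * t) ^ k / fact k)"
      using partial[OF that, of n] by blast
    also have "\<dots> \<le> K * exp (4 * C * t)"
      using that C_pos K by (intro mult_left_mono sum_power_fact_le_exp) auto
    finally show ?thesis .
  qed
  define \<delta> where "\<delta> = (\<lambda>t i. lim (\<lambda>n. ?p n t i))"
  have conv: "(\<lambda>n. ?p n t i) \<longlonglongrightarrow> \<delta> t i" if t: "0 \<le> t" for t i
  proof -
    have "summable (\<lambda>n. (4 * C * t) ^ Suc n / fact (Suc n))"
      using summable_ignore_initial_segment[OF summable_exp[of "4 * C * t"], of 1]
      by (simp add: field_simps)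
    then have "summable (\<lambda>n. K * ((4 * C * t) ^ Suc n / fact (Suc n)))"
      by (rule summable_mult)
    then have "summable (\<lambda>n. ?p (Suc n) t i - ?p n t i)"
    proof (rule summable_comparison_test'[where N = 0])
      show "norm (?p (Suc n) t i - ?p n t i) \<le> K * ((4 * C * t) ^ Suc n / fact (Suc n))" for n
        using partial[OF t, of n] unfolding real_norm_def times_divide_eq_right by blast
    qed
    then have "convergent (\<lambda>n. \<Sum>k<n. ?p (Suc k) t i - ?p k t i)"
      by (simp add: summable_iff_convergent)
    then have "convergent (\<lambda>n. ?p n t i - ?p 0 t i)"
      by (simp only: sum_lessThan_telescope[of "\<lambda>n. ?p n t i"])
    then have "convergent (\<lambda>n. ?p n t i)"
      by (simp add: convergent_diff_const_right_iff)
    then show ?thesis unfolding \<delta>_def by (simp add: convergent_LIMSEQ_iff)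
  qed
  have [measurable]: "(\<lambda>s. \<delta> s j) \<in> borel_measurable borel" for j
    unfolding \<delta>_def by measurable
  show thesis
  proof (rule that)
    show "(\<lambda>s. \<delta> s j) \<in> borel_measurable borel" for j by measurable
    fix t :: real and i assume t: "0 \<le> t"
    show "\<bar>\<delta> t i\<bar> \<le> K * exp (4 * C * t)"
      by (rule tendsto_upperbound[OF tendsto_rabs[OF conv[OF t]]]) (use bound[OF t] in auto)
    have "(\<lambda>n. LBINT s:{0..t}. gl_drift V (\<lambda>j. h s j + ?p n s j) i - gl_drift V (h s) i)
        \<longlonglongrightarrow> (LBINT s:{0..t}. gl_drift V (\<lambda>j. h s j + \<delta> s j) i - gl_drift V (h s) i)"
    proof (rule set_integral_dominated_LIMSEQ)
      fix n s assume s: "s \<in> {0..t}"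
      have *: "(\<lambda>n. deriv V (h s j + ?p n s j)) \<longlonglongrightarrow> deriv V (h s j + \<delta> s j)" for j
        using conv[of s j] s V'_continuous[of UNIV]
        by (intro isCont_tendsto_compose[where g = "deriv V"] tendsto_intros)
           (auto simp: continuous_on_eq_continuous_at)
      show "(\<lambda>n. gl_drift V (\<lambda>j. h s j + ?p n s j) i - gl_drift V (h s) i)
        \<longlonglongrightarrow> gl_drift V (\<lambda>j. h s j + \<delta> s j) i - gl_drift V (h s) i"
        unfolding gl_drift_def by (intro tendsto_intros *)
      have "\<bar>?p n s j\<bar> \<le> K * exp (4 * C * t)" for j
        using order_trans[OF bound[of s n j] mult_left_mono[of "exp (4 * C * s)" "exp (4 * C * t)" K]] s C_pos K
        by auto
      then show "\<bar>gl_drift V (\<lambda>j. h s j + ?p n s j) i - gl_drift V (h s) i\<bar> \<le> 4 * C * (K * exp (4 * C * t))"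
        by (intro abs_drift_diff_le) simp
    qed measurable
    from tendsto_add[OF tendsto_const this, of "x i"]
    have "(\<lambda>n. ?p (Suc n) t i) \<longlonglongrightarrow> x i + (LBINT s:{0..t}. gl_drift V (\<lambda>j. h s j + \<delta> s j) i - gl_drift V (h s) i)"
      by simp
    from LIMSEQ_unique[OF LIMSEQ_Suc[OF conv[OF t, of i]] this]
    show "\<delta> t i = x i + (LBINT s:{0..t}. gl_drift V (\<lambda>j. h s j + \<delta> s j) i - gl_drift V (h s) i)" .
  qed
qed

text \<open>Difference quotients need two solutions with the same noise and different initial
  values. The second one is constructed as \<open>h\<close> plus a bounded correction.\<close>

lemma mild_path_perturbation:
  assumes h: "mild_path V r \<beta> h" and "0 \<le> r" and x: "\<And>j. \<bar>x j\<bar> \<le> K"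
  obtains h' where "mild_path V r \<beta> h'" "h' 0 = (\<lambda>j. h 0 j + x j)"
proof -
  let ?h = "\<lambda>s. h (max 0 s)"
  have "continuous_on UNIV (\<lambda>s. ?h s j)" for j
    by (rule continuous_on_compose2[OF mild_path_continuous_on[OF h]]) (intro continuous_intros, auto)
  then have h_meas: "(\<lambda>s. ?h s j) \<in> borel_measurable borel" for j
    by (rule borel_measurable_continuous_onI)
  note [measurable] = this
  have K: "0 \<le> K" using x[of 0] by linarith
  obtain \<delta> where [measurable]: "\<And>j. (\<lambda>s. \<delta> s j) \<in> borel_measurable borel"
    and \<delta>_bound: "\<And>t i. 0 \<le> t \<Longrightarrow> \<bar>\<delta> t i\<bar> \<le> K * exp (4 * C * t)"
    and \<delta>: "\<And>t i. 0 \<le> t \<Longrightarrow> \<delta> t i = x i + (LBINT s:{0..t}. gl_drift V (\<lambda>j. ?h s j + \<delta> s j) i - gl_drift V (?h s) i)"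
    by (rule perturbed_flow_exists[of ?h x K]) (use h_meas x in auto)
  let ?B = "\<lambda>t. 4 * C * (K * exp (4 * C * t))"
  have g_bound: "\<bar>gl_drift V (\<lambda>j. ?h s j + \<delta> s j) i - gl_drift V (?h s) i\<bar> \<le> ?B t" if "s \<in> {0..t}" for s t i
  proof (rule abs_drift_diff_le)
    show "\<bar>?h s j + \<delta> s j - ?h s j\<bar> \<le> K * exp (4 * C * t)" for j
      using order_trans[OF \<delta>_bound[of s j] mult_left_mono[of "exp (4 * C * s)" "exp (4 * C * t)" K]] that K C_pos
      by auto
  qed
  have g_int: "set_integrable lborel {0..t} (\<lambda>s. gl_drift V (\<lambda>j. ?h s j + \<delta> s j) i - gl_drift V (?h s) i)" for t i
    by (rule set_integrable_bounded[OF _ g_bound]) measurable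
  have d_int: "set_integrable lborel {0..t} (\<lambda>s. gl_drift V (?h s) i)" for t i
    using drift_integrable[where h = h and t = t and i = i, OF mild_path_continuous_on[OF h]]
    by (rule set_integrable_cong[THEN iffD1, rotated -1]) auto
  let ?h' = "\<lambda>t j. h t j + \<delta> t j"
  have \<delta>0: "\<delta> 0 i = x i" for i
    using \<delta>[of 0 i] by (simp only: set_integral_refl)
  \<comment> \<open>A Lipschitz bound in time, uniform over the sites, gives the continuity demanded
    by \<open>mild_path\<close>, since the weight exp(r|i|) is at least 1.\<close>
  have \<delta>_lip: "\<bar>\<delta> s i - \<delta> t i\<bar> \<le> \<bar>s - t\<bar> * ?B T" if "s \<in> {0..T}" "t \<in> {0..T}" for s t T i
    using that
  proof (induction s t rule: linorder_wlog)
    case (le s t)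
    have "\<delta> t i - \<delta> s i = (LBINT u:{s..t}. gl_drift V (\<lambda>j. ?h u j + \<delta> u j) i - gl_drift V (?h u) i)"
      using \<delta>[of s i] \<delta>[of t i] le set_integral_diff_Icc[OF g_int, of s t i] by simp
    also have "\<bar>\<dots>\<bar> \<le> (LBINT u:{s..t}. ?B T)"
      using le g_bound[of _ T i] by (intro abs_set_integral_le set_integrable_bounded[where K = "?B T"]) (use K C_pos in auto)
    also have "\<dots> = (t - s) * ?B T"
      using le by (simp only: set_integral_const_Icc)
    finally show ?case using le by (simp add: abs_minus_commute)
  next
    case (sym a b)
    then show ?case by (simp add: abs_minus_commute)
  qed
  have "mild_path V r \<beta> ?h'"
    unfolding mild_path_def
  proof (intro conjI allI impI)
    fix t e :: real assume t: "0 \<le> t" and e: "0 < e"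
    obtain d where d: "0 < d" "\<And>s i. s \<ge> 0 \<Longrightarrow> \<bar>s - t\<bar> < d \<Longrightarrow> \<bar>h s i - h t i\<bar> \<le> e / 2 * exp (r * \<bar>real_of_int i\<bar>)"
      using h[unfolded mild_path_def, THEN conjunct1, rule_format, OF t half_gt_zero[OF e]] by metis
    have div_mult: "y / b * b = y" if "b \<noteq> 0" for y b :: real using that by simp
    \<comment> \<open>The added 1 keeps the divisor positive when \<open>K\<close> is 0.\<close>
    let ?b = "?B (t + 1) + 1"
    have b: "0 < ?b" using K C_pos by (simp add: add_nonneg_pos)
    let ?d = "min d (min 1 (e / 2 / ?b))"
    have "\<bar>?h' s i - ?h' t i\<bar> \<le> e * exp (r * \<bar>real_of_int i\<bar>)" if s: "0 \<le> s" "\<bar>s - t\<bar> < ?d" for s i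
    proof -
      have "\<bar>\<delta> s i - \<delta> t i\<bar> \<le> \<bar>s - t\<bar> * ?B (t + 1)"
        using s t by (intro \<delta>_lip) auto
      also have "\<dots> \<le> \<bar>s - t\<bar> * ?b" by (intro mult_left_mono) auto
      also have "\<dots> \<le> e / 2 / ?b * ?b"
        using s b by (intro mult_right_mono) auto
      also have "\<dots> = e / 2" by (rule div_mult[of ?b]) (use b in simp)
      also have "\<dots> \<le> e / 2 * exp (r * \<bar>real_of_int i\<bar>)"
        using e \<open>0 \<le> r\<close> by simp
      finally have 1: "\<bar>\<delta> s i - \<delta> t i\<bar> \<le> e * exp (r * \<bar>real_of_int i\<bar>) / 2" by simp
      have 2: "\<bar>h s i - h t i\<bar> \<le> e * exp (r * \<bar>real_of_int i\<bar>) / 2" using d(2)[of s i] s by simp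
      show ?thesis using 1 2 by linarith
    qed
    moreover have "0 < ?d" using d e b by simp
    ultimately show "\<exists>d>0. \<forall>s\<ge>0. \<bar>s - t\<bar> < d \<longrightarrow> (\<forall>i. \<bar>?h' s i - ?h' t i\<bar> \<le> e * exp (r * \<bar>real_of_int i\<bar>))"
      by blast
  next
    fix t :: real and i assume t: "0 \<le> t"
    have "(LBINT s:{0..t}. gl_drift V (?h' s) i)
        = (LBINT s:{0..t}. (gl_drift V (\<lambda>j. ?h s j + \<delta> s j) i - gl_drift V (?h s) i) + gl_drift V (?h s) i)"
      by (intro set_lebesgue_integral_cong) auto
    also have "\<dots> = (\<delta> t i - x i) + (LBINT s:{0..t}. gl_drift V (?h s) i)"
      using \<delta>[OF t, of i] by (simp only: set_integral_add(2)[OF g_int d_int])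
    also have "(LBINT s:{0..t}. gl_drift V (?h s) i) = (LBINT s:{0..t}. gl_drift V (h s) i)"
      by (intro set_lebesgue_integral_cong) auto
    finally show "?h' t i = ?h' 0 i + (LBINT s:{0..t}. gl_drift V (?h' s) i)
                  + sqrt 2 * (\<beta> ((i, i + 1), t) - \<beta> ((i - 1, i), t))"
      using mild_path_eq[OF h t, of i] by (simp add: \<delta>0)
  qed
  moreover have "?h' 0 = (\<lambda>j. h 0 j + x j)" by (simp add: \<delta>0)
  ultimately show thesis by (rule that)
qed

text \<open>The quotients solve exactly a linear equation whose rates are divided differences of
  \<open>deriv V\<close> between the two solutions. These rates are bounded by \<open>C\<close> and
  converge pointwise to V'' along \<open>h\<close>, so \<open>linear_solutions_converge\<close>
  applies.\<close>

lemma difference_quotients_converge: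
  assumes h: "mild_path V r \<beta> h" and r: "0 \<le> r" and x: "\<And>j. \<bar>x j\<bar> \<le> K"
    and \<epsilon>: "\<epsilon> \<longlonglongrightarrow> 0" "\<And>m::nat. \<epsilon> m \<noteq> 0" and T: "0 \<le> T"
  obtains l where
    "(\<lambda>m. (euler_limit V T \<beta> (\<lambda>j. h 0 j + \<epsilon> m * x j) i - euler_limit V T \<beta> (h 0) i) / \<epsilon> m) \<longlonglongrightarrow> l"
    "\<And>n. \<bar>l - lin_iter (\<lambda>s j. deriv (deriv V) (h (max 0 s) j)) x n T i\<bar>
       \<le> 2 * (K * exp (4 * C * T)) * (4 * C * T) ^ n / fact n"
proof -
  have K: "0 \<le> K" using x[of 0] by linarith
  have "\<exists>h'. mild_path V r \<beta> h' \<and> h' 0 = (\<lambda>j. h 0 j + \<epsilon> m * x j)" for m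
    by (rule mild_path_perturbation[OF h r, of "\<lambda>j. \<epsilon> m * x j" "\<bar>\<epsilon> m\<bar> * K"])
       (auto simp: abs_mult intro!: mult_left_mono x)
  then obtain h' where h': "\<And>m. mild_path V r \<beta> (h' m)" "\<And>m. h' m 0 = (\<lambda>j. h 0 j + \<epsilon> m * x j)"
    by metis
  have cont: "continuous_on UNIV (\<lambda>s. g (max 0 s) j)" if "mild_path V r \<beta> g" for g j
    by (rule continuous_on_compose2[OF mild_path_continuous_on[OF that]]) (intro continuous_intros, auto)
  have [measurable]: "(\<lambda>s. h (max 0 s) j) \<in> borel_measurable borel" "(\<lambda>s. h' m (max 0 s) j) \<in> borel_measurable borel" for m j
    by (intro borel_measurable_continuous_onI cont h h')+
  have h'_diff: "\<bar>h' m t j - h t j\<bar> \<le> \<bar>\<epsilon> m\<bar> * K * exp (4 * C * t)" if "0 \<le> t" for m t j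
  proof -
    have "\<bar>h' m t j - h t j\<bar> \<le> (\<bar>\<epsilon> m\<bar> * K) * exp (4 * 1 * C * t) * (\<lambda>j::int. 1) j"
      by (rule mild_path_lipschitz[OF h'(1) h r that])
         (use K in \<open>auto simp: h'(2) abs_mult intro!: mult_left_mono x\<close>)
    then show ?thesis by simp
  qed
  \<comment> \<open>The divided difference of \<open>deriv V\<close>, completed by V'' on the
    diagonal. The product formula then needs no case distinction, and continuity at the base point
    is just differentiability of \<open>deriv V\<close>.\<close>
  define sl where "sl y z = (if z = y then deriv (deriv V) y else (deriv V z - deriv V y) / (z - y))" for y z
  have sl_mult: "sl y z * (z - y) = deriv V z - deriv V y" for y z
    unfolding sl_def by simp
  have sl_bound: "\<bar>sl y z\<bar> \<le> C" for y z
    using V'_lipschitz[of z y] V''_abs_le[of y] by (auto simp: sl_def abs_divide divide_le_eq)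
  have sl_cont: "isCont (sl y) y" for y
  proof -
    have "(\<lambda>z. (deriv V z - deriv V y) / (z - y)) \<midarrow>y\<rightarrow> sl y y"
      using V'_DERIV[of y] by (simp add: has_field_derivative_iff sl_def)
    then show ?thesis unfolding isCont_def
      by (rule Lim_transform_eventually) (auto simp: sl_def eventually_at_filter)
  qed
  define a where "a s j = deriv (deriv V) (h (max 0 s) j)" for s j
  define am where "am m s j = sl (h (max 0 s) j) (h' m (max 0 s) j)" for m s j
  define v where "v m s j = (h' m (max 0 s) j - h (max 0 s) j) / \<epsilon> m" for m s j
  have a: "bounded_rates a C"
    unfolding a_def by standard (auto simp: V''_abs_le)
  have am: "bounded_rates (am m) C" for m
  proof
    show "(\<lambda>s. am m s j) \<in> borel_measurable borel" for j
      unfolding am_def sl_def by measurable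
  qed (simp add: am_def sl_bound)
  have h'_lim: "(\<lambda>m. h' m t j) \<longlonglongrightarrow> h t j" if "0 \<le> t" for t j
  proof (rule LIM_zero_cancel, rule Lim_null_comparison)
    show "\<forall>\<^sub>F m in sequentially. norm (h' m t j - h t j) \<le> \<bar>\<epsilon> m\<bar> * K * exp (4 * C * t)"
      using h'_diff[OF that] by simp
    show "(\<lambda>m. \<bar>\<epsilon> m\<bar> * K * exp (4 * C * t)) \<longlonglongrightarrow> 0"
      using tendsto_mult_left_zero[OF tendsto_mult_left_zero[OF tendsto_rabs_zero[OF \<epsilon>(1)], of K], of "exp (4 * C * t)"] .
  qed
  have v_eq: "v m t i = x i + (LBINT s:{0..t}. lapl (\<lambda>j. am m s j * v m s j) i)" if t: "t \<in> {0..T}" for m t i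
  proof -
    have int: "set_integrable lborel {0..t} (\<lambda>s. gl_drift V (g s) i)" if "mild_path V r \<beta> g" for g
      by (intro drift_integrable mild_path_continuous_on[OF that])
    have "(h' m t i - h t i) = \<epsilon> m * x i + (LBINT s:{0..t}. gl_drift V (h' m s) i - gl_drift V (h s) i)"
      using mild_path_eq[OF h'(1), of t m i] mild_path_eq[OF h, of t i] t
      by (simp add: set_integral_diff[OF int[OF h'(1)] int[OF h]] h'(2))
    then have "v m t i = x i + (LBINT s:{0..t}. gl_drift V (h' m s) i - gl_drift V (h s) i) / \<epsilon> m"
      using \<epsilon>(2)[of m] t by (simp add: v_def add_divide_distrib max_def)
    also have "(LBINT s:{0..t}. gl_drift V (h' m s) i - gl_drift V (h s) i) / \<epsilon> m
        = (LBINT s:{0..t}. (gl_drift V (h' m s) i - gl_drift V (h s) i) / \<epsilon> m)"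
      by simp
    also have "\<dots> = (LBINT s:{0..t}. lapl (\<lambda>j. am m s j * v m s j) i)"
    proof (intro set_lebesgue_integral_cong allI impI)
      fix s assume "s \<in> {0..t}"
      then have "am m s j * v m s j = (deriv V (h' m s j) - deriv V (h s j)) / \<epsilon> m" for j
        using sl_mult[of "h s j" "h' m s j"] by (simp add: am_def v_def max_def)
      then show "(gl_drift V (h' m s) i - gl_drift V (h s) i) / \<epsilon> m = lapl (\<lambda>j. am m s j * v m s j) i"
        by (simp add: gl_drift_def lapl_def diff_divide_distrib add_divide_distrib)
    qed auto
    finally show ?thesis .
  qed
  have v_bound: "\<bar>v m t j\<bar> \<le> K * exp (4 * C * T)" if t: "t \<in> {0..T}" for m t j
  proof -
    have "\<bar>v m t j\<bar> \<le> K * exp (4 * C * t)"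
      using h'_diff[of t m j] t \<epsilon>(2)[of m] by (simp add: v_def abs_divide divide_le_eq max_def ac_simps)
    also have "\<dots> \<le> K * exp (4 * C * T)"
      using t K C_pos by (intro mult_left_mono) auto
    finally show ?thesis .
  qed
  have am_lim: "(\<lambda>m. am m s j) \<longlonglongrightarrow> a s j" if "s \<in> {0..T}" for s j
    using isCont_tendsto_compose[OF sl_cont h'_lim[of s j]] that
    by (simp add: am_def a_def sl_def max_def)
  have v_meas: "(\<lambda>s. v m s j) \<in> borel_measurable borel" for m j
    unfolding v_def by measurable
  obtain l where l: "(\<lambda>m. v m T i) \<longlonglongrightarrow> l"
    "\<And>n. \<bar>l - lin_iter a x n T i\<bar> \<le> 2 * (K * exp (4 * C * T)) * (4 * C * T) ^ n / fact n"
    by (rule linear_solutions_converge[where a = a and am = am and v = v and x = x and t = T and T = T and i = i,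
          OF a am am_lim v_eq v_meas v_bound]) (use T in auto)
  have "v m T i = (euler_limit V T \<beta> (\<lambda>j. h 0 j + \<epsilon> m * x j) i - euler_limit V T \<beta> (h 0) i) / \<epsilon> m" for m
    using euler_limit_eq[OF h'(1) r T, of m i] euler_limit_eq[OF h r T, of i] T
    by (simp add: v_def h'(2) max_def)
  with l show thesis unfolding a_def by (intro that[of l]) auto
qed

end

section \<open>Jump counts and right-continuous regularisation\<close>

abbreviation (input) bond_at :: "int \<Rightarrow> bond" where
  "bond_at j \<equiv> (j, j + 1)"

lemma bonds_iff: "b \<in> bonds \<longleftrightarrow> (\<exists>j. b = bond_at j)"
  by (auto simp: bonds_def)

lemma jump_times_split:
  assumes "s \<le> t" "t \<le> u"
  shows "jump_times p b b' s u = jump_times p b b' s t \<union> jump_times p b b' t u"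
    "jump_times p b b' s t \<inter> jump_times p b b' t u = {}"
  using assms by (auto simp: jump_times_def)

lemma at_left_const_unique:
  assumes "eventually (\<lambda>v. p v = e) (at_left (u::real))" "eventually (\<lambda>v. p v = e') (at_left u)"
  shows "e = e'"
proof -
  have "eventually (\<lambda>v. e = e') (at_left u)" using assms by eventually_elim simp
  then show ?thesis by (simp add: trivial_limit_at_left_real)
qed

lemma step_path_local:
  assumes "step_path p" "0 \<le> x"
  obtains d b0 where "0 < d" "b0 \<in> bonds" "\<And>v. 0 \<le> v \<Longrightarrow> x - d < v \<Longrightarrow> v < x \<Longrightarrow> p v = b0"
    "\<And>v. x \<le> v \<Longrightarrow> v < x + d \<Longrightarrow> p v = p x"
proof -
  have "eventually (\<lambda>v. p v = p x) (at_right x)"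
    using assms unfolding step_path_def by blast
  then obtain y where y: "x < y" "\<And>v. x < v \<Longrightarrow> v < y \<Longrightarrow> p v = p x"
    unfolding eventually_at_right_field by auto
  show thesis
  proof (cases "x = 0")
    case True
    \<comment> \<open>Nothing lies to the left of time 0, so the left value is an arbitrary
      bond.\<close>
    show thesis
    proof (rule that[of "y - x" "(0, 0 + 1)"])
      show "p v = p x" if "x \<le> v" "v < x + (y - x)" for v
        using y(2)[of v] that by (cases "v = x") auto
    qed (use y(1) True in \<open>auto simp: bonds_def\<close>)
  next
    case False
    then obtain b where "eventually (\<lambda>v. p v = b) (at_left x)"
      using assms unfolding step_path_def by force
    then obtain z where z: "z < x" "\<And>v. z < v \<Longrightarrow> v < x \<Longrightarrow> p v = b"
      unfolding eventually_at_left_field by auto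
    have "max 0 z < x" using z(1) assms(2) False by simp
    then obtain w where "max 0 z < w" "w < x" using dense by blast
    then have b: "b \<in> bonds" using z(2)[of w] assms(1) unfolding step_path_def by auto
    show thesis
    proof (rule that[of "min (y - x) (x - z)" b])
      show "p v = p x" if "x \<le> v" "v < x + min (y - x) (x - z)" for v
        using y(2)[of v] that by (cases "v = x") auto
      show "p v = b" if "x - min (y - x) (x - z) < v" "v < x" for v
        using z(2)[of v] that by auto
    qed (use y(1) z(1) b in auto)
  qed
qed

text \<open>In a window shorter than \<open>d\<close> around \<open>x\<close> the path takes the
  value \<open>b0\<close> before \<open>x\<close> and \<open>p x\<close> from \<open>x\<close> on,
  so \<open>x\<close> is the only candidate. The condition \<open>a < x\<close> reflects that
  \<open>jump_times\<close> leaves out the left end of the interval.\<close>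

lemma card_jump_times_local:
  assumes d: "\<And>v. 0 \<le> v \<Longrightarrow> x - d < v \<Longrightarrow> v < x \<Longrightarrow> p v = b0"
    "\<And>v. x \<le> v \<Longrightarrow> v < x + d \<Longrightarrow> p v = p x"
    and "0 \<le> a" "a \<le> x" "x \<le> c" "c - a < d" "b \<noteq> b'"
  shows "jump_times p b b' a c = (if a < x \<and> b0 = b \<and> p x = b' then {x} else {})"
proof -
  have left: "eventually (\<lambda>v. p v = e) (at_left u) \<longleftrightarrow> e = e'"
    if "a < u" "\<And>v. a < v \<Longrightarrow> v < u \<Longrightarrow> p v = e'" for u e e'
  proof -
    have "eventually (\<lambda>v. p v = e') (at_left u)"
      unfolding eventually_at_left_field using that by auto
    then show ?thesis using at_left_const_unique[of p e u e'] by blast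
  qed
  have "u \<in> jump_times p b b' a c \<longleftrightarrow> u = x \<and> a < x \<and> b0 = b \<and> p x = b'" for u
  proof (cases u x rule: linorder_cases)
    case less
    have "p v = b0" if "a < v" "v \<le> u" for v
      using that less assms(3-7) by (intro d(1)) auto
    then show ?thesis using less assms(7) left[of u b0 b] by (auto simp: jump_times_def)
  next
    case equal
    have "p v = b0" if "a < v" "v < x" for v
      using that assms(3-7) by (intro d(1)) auto
    then show ?thesis using equal assms(3-7) left[of u b0 b] by (auto simp: jump_times_def)
  next
    case greater
    have *: "p v = p x" if "x < v" "v \<le> c" for v
      using that assms(3-7) by (intro d(2)) auto
    have "\<not> eventually (\<lambda>v. p v = b) (at_left u)" if "u \<le> c" "p u = b'"
    proof
      assume "eventually (\<lambda>v. p v = b) (at_left u)"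
      moreover have "eventually (\<lambda>v. p v = p x) (at_left u)"
        unfolding eventually_at_left_field using greater that by (intro exI[of _ x] conjI allI impI *) auto
      ultimately have "b = p x"
        by (rule at_left_const_unique)
      then show False using *[of u] that greater assms(7) by simp
    qed
    then show ?thesis using greater by (auto simp: jump_times_def)
  qed
  then show ?thesis by auto
qed

text \<open>Arrivals minus departures. The balance is additive under concatenation of intervals and
  clear on short ones, so Bolzano bisection extends it to [0,T] without enumerating the
  jumps.\<close>

lemma step_path_jump_balance:
  assumes p: "step_path p" and T: "0 \<le> T"
    and nn: "\<And>j k. j \<noteq> k \<Longrightarrow> \<bar>j - k\<bar> \<noteq> 1 \<Longrightarrow> jump_times p (bond_at j) (bond_at k) 0 T = {}"
  shows "of_bool (p T = bond_at j) - of_bool (p 0 = bond_at j) =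
    (real (card (jump_times p (bond_at (j - 1)) (bond_at j) 0 T)) + real (card (jump_times p (bond_at (j + 1)) (bond_at j) 0 T)))
    - (real (card (jump_times p (bond_at j) (bond_at (j - 1)) 0 T)) + real (card (jump_times p (bond_at j) (bond_at (j + 1)) 0 T)))"
proof -
  let ?N = "\<lambda>i k s t. real (card (jump_times p (bond_at i) (bond_at k) s t))"
  \<comment> \<open>Finiteness is carried along because \<open>card\<close> is 0 on infinite sets
    and would then fail to be additive.\<close>
  define P where "P s t \<longleftrightarrow> (0 \<le> s \<and> t \<le> T \<longrightarrow>
    (\<forall>i k. i \<noteq> k \<longrightarrow> finite (jump_times p (bond_at i) (bond_at k) s t)) \<and>
    of_bool (p t = bond_at j) - of_bool (p s = bond_at j) =
      (?N (j - 1) j s t + ?N (j + 1) j s t) - (?N j (j - 1) s t + ?N j (j + 1) s t))" for s t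
  have "P 0 T"
  proof (rule Bolzano[OF T])
    fix a b c assume P: "P a b" "P b c" and le: "a \<le> b" "b \<le> c"
    show "P a c" unfolding P_def
    proof
      assume ac: "0 \<le> a \<and> c \<le> T"
      have fin: "i \<noteq> k \<Longrightarrow> finite (jump_times p (bond_at i) (bond_at k) a b)"
        "i \<noteq> k \<Longrightarrow> finite (jump_times p (bond_at i) (bond_at k) b c)" for i k
        using P le ac unfolding P_def by auto
      have card: "?N i k a c = ?N i k a b + ?N i k b c" if "i \<noteq> k" for i k
        unfolding jump_times_split(1)[OF le]
        by (subst card_Un_disjoint[OF fin(1)[OF that] fin(2)[OF that] jump_times_split(2)[OF le]]) simp
      have "of_bool (p b = bond_at j) - of_bool (p a = bond_at j) =
          (?N (j - 1) j a b + ?N (j + 1) j a b) - (?N j (j - 1) a b + ?N j (j + 1) a b)"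
        and "of_bool (p c = bond_at j) - of_bool (p b = bond_at j) =
          (?N (j - 1) j b c + ?N (j + 1) j b c) - (?N j (j - 1) b c + ?N j (j + 1) b c)"
        using P le ac unfolding P_def by auto
      moreover have "?N (j - 1) j a c = ?N (j - 1) j a b + ?N (j - 1) j b c"
        "?N (j + 1) j a c = ?N (j + 1) j a b + ?N (j + 1) j b c"
        "?N j (j - 1) a c = ?N j (j - 1) a b + ?N j (j - 1) b c"
        "?N j (j + 1) a c = ?N j (j + 1) a b + ?N j (j + 1) b c"
        by (rule card; simp)+
      ultimately have "of_bool (p c = bond_at j) - of_bool (p a = bond_at j) =
          (?N (j - 1) j a c + ?N (j + 1) j a c) - (?N j (j - 1) a c + ?N j (j + 1) a c)"
        by linarith
      then show "(\<forall>i k. i \<noteq> k \<longrightarrow> finite (jump_times p (bond_at i) (bond_at k) a c)) \<and>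
        of_bool (p c = bond_at j) - of_bool (p a = bond_at j) =
        (?N (j - 1) j a c + ?N (j + 1) j a c) - (?N j (j - 1) a c + ?N j (j + 1) a c)"
        using fin by (simp only: jump_times_split(1)[OF le]) blast
    qed
  next
    fix x assume x: "0 \<le> x" "x \<le> T"
    obtain d b0 where d: "0 < d" "b0 \<in> bonds" "\<And>v. 0 \<le> v \<Longrightarrow> x - d < v \<Longrightarrow> v < x \<Longrightarrow> p v = b0"
      "\<And>v. x \<le> v \<Longrightarrow> v < x + d \<Longrightarrow> p v = p x"
      using step_path_local[OF p x(1)] by blast
    have "P a c" if ac: "a \<le> x" "x \<le> c" "c - a < d" for a c
      unfolding P_def
    proof
      assume a: "0 \<le> a \<and> c \<le> T"
      have pc: "p c = p x" using ac by (intro d(4)) auto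
      obtain m where m: "p x = bond_at m"
        using p x unfolding step_path_def by (auto simp: bonds_iff)
      obtain l where l: "b0 = bond_at l" using d(2) by (auto simp: bonds_iff)
      have J: "jump_times p (bond_at i) (bond_at k) a c = (if a < x \<and> l = i \<and> m = k then {x} else {})"
        if "i \<noteq> k" for i k
      proof -
        have "jump_times p (bond_at i) (bond_at k) a c = (if a < x \<and> b0 = bond_at i \<and> p x = bond_at k then {x} else {})"
        proof (rule card_jump_times_local[where d = d])
          show "p v = b0" if "0 \<le> v" "x - d < v" "v < x" for v using that by (rule d(3))
          show "p v = p x" if "x \<le> v" "v < x + d" for v using that by (rule d(4))
        qed (use that a ac in auto)
        then show ?thesis by (simp add: m l)
      qed
      \<comment> \<open>A jump between bonds that are not neighbours would be counted by none of the
        four terms.\<close>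
      have neighbours: "l = m \<or> \<bar>l - m\<bar> = 1" if "a < x"
      proof (rule ccontr)
        assume "\<not> ?thesis"
        then have "x \<in> jump_times p (bond_at l) (bond_at m) a c" "l \<noteq> m" "\<bar>l - m\<bar> \<noteq> 1"
          using that by (auto simp: J)
        then show False using nn[of l m] a by (auto simp: jump_times_def)
      qed
      have pa: "p a = (if a < x then bond_at l else bond_at m)"
        using d(3)[of a] a ac l m by (auto simp: order_le_less)
      show "(\<forall>i k. i \<noteq> k \<longrightarrow> finite (jump_times p (bond_at i) (bond_at k) a c)) \<and>
        of_bool (p c = bond_at j) - of_bool (p a = bond_at j) =
        (?N (j - 1) j a c + ?N (j + 1) j a c) - (?N j (j - 1) a c + ?N j (j + 1) a c)"
      proof (intro conjI)
        show "of_bool (p c = bond_at j) - of_bool (p a = bond_at j) =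
          (?N (j - 1) j a c + ?N (j + 1) j a c) - (?N j (j - 1) a c + ?N j (j + 1) a c)"
        proof -
          have N: "?N i k a c = of_bool (a < x \<and> l = i \<and> m = k)" if "i \<noteq> k" for i k
            by (simp add: J[OF that])
          have "?N (j - 1) j a c = of_bool (a < x \<and> l = j - 1 \<and> m = j)"
            "?N (j + 1) j a c = of_bool (a < x \<and> l = j + 1 \<and> m = j)"
            "?N j (j - 1) a c = of_bool (a < x \<and> l = j \<and> m = j - 1)"
            "?N j (j + 1) a c = of_bool (a < x \<and> l = j \<and> m = j + 1)"
            by (rule N; simp)+
          note N = this
          have "of_bool (p c = bond_at j) = (of_bool (m = j) :: real)"
            "of_bool (p a = bond_at j) = (of_bool (if a < x then l = j else m = j) :: real)"
            by (auto simp: pa pc m)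
          note this[unfolded if_distrib]
          then show ?thesis unfolding N
            using neighbours by (cases "a < x") auto
        qed
      qed (auto simp: J)
    qed
    then show "\<exists>d>0. \<forall>a b. a \<le> x \<and> x \<le> b \<and> b - a < d \<longrightarrow> P a b"
      using d(1) by blast
  qed
  then show ?thesis using T unfolding P_def by simp
qed

lemma step_path_finite_jump_times:
  assumes p: "step_path p" and T: "0 \<le> T" and "b \<noteq> b'"
  shows "finite (jump_times p b b' 0 T)"
proof -
  have "0 \<le> (0::real) \<longrightarrow> finite (jump_times p b b' 0 T)"
  proof (rule Bolzano[OF T, of "\<lambda>s t. 0 \<le> s \<longrightarrow> finite (jump_times p b b' s t)"])
    fix x assume x: "0 \<le> x" "x \<le> T"
    obtain d b0 where d: "0 < d" "b0 \<in> bonds" "\<And>v. 0 \<le> v \<Longrightarrow> x - d < v \<Longrightarrow> v < x \<Longrightarrow> p v = b0"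
      "\<And>v. x \<le> v \<Longrightarrow> v < x + d \<Longrightarrow> p v = p x"
      using step_path_local[OF p x(1)] by blast
    have "finite (jump_times p b b' a c)" if "0 \<le> a" "a \<le> x" "x \<le> c" "c - a < d" for a c
    proof -
      have "jump_times p b b' a c = (if a < x \<and> b0 = b \<and> p x = b' then {x} else {})"
      proof (rule card_jump_times_local[where d = d])
        show "p v = b0" if "0 \<le> v" "x - d < v" "v < x" for v using that by (rule d(3))
        show "p v = p x" if "x \<le> v" "v < x + d" for v using that by (rule d(4))
      qed (use that \<open>b \<noteq> b'\<close> in auto)
      then show ?thesis by simp
    qed
    then show "\<exists>d>0. \<forall>a c. a \<le> x \<and> x \<le> c \<and> c - a < d \<longrightarrow> 0 \<le> a \<longrightarrow> finite (jump_times p b b' a c)"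
      using d(1) by blast
  next
    fix s t u
    assume "0 \<le> s \<longrightarrow> finite (jump_times p b b' s t)" "0 \<le> t \<longrightarrow> finite (jump_times p b b' t u)" and le: "s \<le> t" "t \<le> u"
    then show "0 \<le> s \<longrightarrow> finite (jump_times p b b' s u)"
      unfolding jump_times_split(1)[OF le] by auto
  qed
  then show ?thesis by simp
qed

text \<open>The sample times lie strictly to the right of \<open>u\<close> and tend to it, and for
  fixed \<open>n\<close> only countably many of them occur. Thus measurability at each fixed time
  yields joint measurability in time and sample point, while right-continuous functions are
  reproduced.\<close>

definition right_reg :: "(real \<Rightarrow> real) \<Rightarrow> real \<Rightarrow> real" where
  "right_reg f u = lim (\<lambda>n. f (max 0 ((of_int \<lfloor>real (Suc n) * u\<rfloor> + 1) / real (Suc n))))"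

lemma right_reg_eq:
  assumes f: "(f \<longlongrightarrow> f u) (at_right u)" and u: "0 \<le> u"
  shows "right_reg f u = f u"
  unfolding right_reg_def
proof (rule limI, rule filterlim_compose[OF f])
  let ?g = "\<lambda>n. (of_int \<lfloor>real (Suc n) * u\<rfloor> + 1) / real (Suc n)"
  have gt: "u < ?g n" for n
    using floor_correct[of "real (Suc n) * u"] by (simp add: field_simps)
  have le: "?g n \<le> u + 1 / real (Suc n)" for n
  proof -
    have "?g n \<le> (real (Suc n) * u + 1) / real (Suc n)"
      by (intro divide_right_mono) (use floor_correct[of "real (Suc n) * u"] in auto)
    also have "\<dots> = u + 1 / real (Suc n)" by (simp add: add_divide_distrib)
    finally show ?thesis .
  qed
  have lim: "(\<lambda>n. u + 1 / real (Suc n)) \<longlonglongrightarrow> u + 0"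
    using LIMSEQ_inverse_real_of_nat by (intro tendsto_add tendsto_const) (simp add: inverse_eq_divide)
  have "?g \<longlonglongrightarrow> u"
    by (rule real_tendsto_sandwich[OF _ _ tendsto_const lim[simplified]]) (use le less_imp_le[OF gt] in auto)
  moreover have "max 0 (?g n) = ?g n" for n using gt[of n] u by simp
  ultimately have "(\<lambda>n. max 0 (?g n)) \<longlonglongrightarrow> u" by simp
  then show "filterlim (\<lambda>n. max 0 (?g n)) (at_right u) sequentially"
    by (rule tendsto_imp_filterlim_at_right) (use gt in \<open>auto simp: less_max_iff_disj\<close>)
qed

lemma right_reg_measurable:
  assumes f [measurable]: "\<And>s. 0 \<le> s \<Longrightarrow> f s \<in> borel_measurable M"
  shows "(\<lambda>z. right_reg (\<lambda>s. f s (snd z)) (fst z)) \<in> borel_measurable (borel \<Otimes>\<^sub>M M)"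
  unfolding right_reg_def
proof (rule borel_measurable_lim_metric)
  fix n
  have "(\<lambda>z. (\<lambda>k z. f (max 0 ((of_int k + 1) / real (Suc n))) (snd z)) (\<lfloor>real (Suc n) * fst z\<rfloor>) z)
    \<in> borel_measurable (borel \<Otimes>\<^sub>M M)"
  proof (rule measurable_compose_countable[where f = "\<lambda>k z. f (max 0 ((of_int k + 1) / real (Suc n))) (snd z)"
        and g = "\<lambda>z. \<lfloor>real (Suc n) * fst z\<rfloor>"])
    show "(\<lambda>z. f (max 0 ((of_int k + 1) / real (Suc n))) (snd z)) \<in> borel_measurable (borel \<Otimes>\<^sub>M M)" for k :: int
      by (rule measurable_compose[OF measurable_snd f]) simp
    show "(\<lambda>z. \<lfloor>real (Suc n) * fst z\<rfloor>) \<in> borel \<Otimes>\<^sub>M M \<rightarrow>\<^sub>M count_space UNIV"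
      by measurable
  qed
  then show "(\<lambda>z. f (max 0 ((of_int \<lfloor>real (Suc n) * fst z\<rfloor> + 1) / real (Suc n))) (snd z))
    \<in> borel_measurable (borel \<Otimes>\<^sub>M M)" by simp
qed

section \<open>The walk given the environment\<close>

lemma lin_iter_joint_measurable:
  fixes M :: "'a measure"
  assumes [measurable]: "\<And>j. (\<lambda>z. a (fst z) (snd z) j) \<in> borel_measurable (borel \<Otimes>\<^sub>M M)"
  shows "(\<lambda>z. lin_iter (\<lambda>u. a u (snd z)) x n (fst z) i) \<in> borel_measurable (borel \<Otimes>\<^sub>M M)"
proof (induction n arbitrary: i)
  case (Suc n)
  have pair: "(\<lambda>w::(real \<times> 'a) \<times> real. (snd w, snd (fst w))) \<in> (borel \<Otimes>\<^sub>M M) \<Otimes>\<^sub>M borel \<rightarrow>\<^sub>M borel \<Otimes>\<^sub>M M"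
    by measurable
  have [measurable]: "(\<lambda>w::(real \<times> 'a) \<times> real. a (snd w) (snd (fst w)) j) \<in> borel_measurable ((borel \<Otimes>\<^sub>M M) \<Otimes>\<^sub>M borel)"
    "(\<lambda>w::(real \<times> 'a) \<times> real. lin_iter (\<lambda>u. a u (snd (fst w))) x n (snd w) j) \<in> borel_measurable ((borel \<Otimes>\<^sub>M M) \<Otimes>\<^sub>M borel)" for j
    using measurable_compose[OF pair assms[of j]] measurable_compose[OF pair Suc[of j]] by simp_all
  show ?case
    unfolding lin_iter.simps lapl_def
    by (intro borel_measurable_add borel_measurable_const interval_integral_measurable) measurable
qed simp

lemma (in prob_space) integral_mult_bounded:
  fixes f G :: "'a \<Rightarrow> real"
  assumes [measurable]: "G \<in> borel_measurable M" "f \<in> borel_measurable M"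
    and c: "\<And>\<omega>. \<bar>G \<omega>\<bar> \<le> c" and f: "\<And>\<omega>. \<omega> \<in> space M \<Longrightarrow> \<bar>f \<omega>\<bar> \<le> K"
  shows "integrable M (\<lambda>\<omega>. G \<omega> * f \<omega>)" "\<bar>\<integral>\<omega>. G \<omega> * f \<omega> \<partial>M\<bar> \<le> c * K"
proof -
  have AE: "AE \<omega> in M. \<bar>G \<omega> * f \<omega>\<bar> \<le> c * K"
    unfolding abs_mult by (intro AE_I2 mult_mono c f) (use order_trans[OF abs_ge_zero c] in auto)
  then show int: "integrable M (\<lambda>\<omega>. G \<omega> * f \<omega>)"
    by (intro integrable_const_bound[where B = "c * K"]) auto
  have "\<bar>\<integral>\<omega>. G \<omega> * f \<omega> \<partial>M\<bar> \<le> (\<integral>\<omega>. \<bar>G \<omega> * f \<omega>\<bar> \<partial>M)" by (rule integral_abs_bound)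
  also have "\<dots> \<le> c * K" by (rule integral_le_const) (use AE int in auto)
  finally show "\<bar>\<integral>\<omega>. G \<omega> * f \<omega> \<partial>M\<bar> \<le> c * K" .
qed

lemma (in prob_space) time_average_Fubini:
  fixes y :: "real \<Rightarrow> 'a \<Rightarrow> real"
  assumes y [measurable]: "(\<lambda>z. y (fst z) (snd z)) \<in> borel_measurable (borel \<Otimes>\<^sub>M M)"
    and G [measurable]: "G \<in> borel_measurable M"
    and "\<And>\<omega>. \<bar>G \<omega>\<bar> \<le> c" "\<And>u \<omega>. u \<in> {0..t} \<Longrightarrow> \<omega> \<in> space M \<Longrightarrow> \<bar>y u \<omega>\<bar> \<le> K"
  shows "(\<lambda>\<omega>. LBINT u:{0..t}. y u \<omega>) \<in> borel_measurable M"
    and "(\<integral>\<omega>. G \<omega> * (LBINT u:{0..t}. y u \<omega>) \<partial>M) = (LBINT u:{0..t}. (\<integral>\<omega>. G \<omega> * y u \<omega> \<partial>M))"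
proof -
  interpret lborel_M: pair_sigma_finite lborel M ..
  have y' [measurable]: "(\<lambda>z. y (fst z) (snd z)) \<in> borel_measurable (lborel \<Otimes>\<^sub>M M)"
    using y by (simp cong: measurable_cong_sets sets_pair_measure_cong)
  have swap: "(\<lambda>w. (snd w, fst w)) \<in> M \<Otimes>\<^sub>M lborel \<rightarrow>\<^sub>M lborel \<Otimes>\<^sub>M M" by measurable
  have [measurable]: "(\<lambda>w. y (snd w) (fst w)) \<in> borel_measurable (M \<Otimes>\<^sub>M lborel)"
    using measurable_compose[OF swap y'] by simp
  show "(\<lambda>\<omega>. LBINT u:{0..t}. y u \<omega>) \<in> borel_measurable M"
    unfolding set_lebesgue_integral_def by measurable
  let ?f = "\<lambda>u \<omega>. G \<omega> * (indicator {0..t} u * y u \<omega>)"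
  have "integrable (lborel \<Otimes>\<^sub>M M) (case_prod ?f)"
  proof (rule integrableI_bounded_set[where A = "{0..t} \<times> space M" and B = "c * K"])
    show "{0..t} \<times> space M \<in> sets (lborel \<Otimes>\<^sub>M M)" by measurable
    show "case_prod ?f \<in> borel_measurable (lborel \<Otimes>\<^sub>M M)"
      unfolding split_beta' by measurable
    show "emeasure (lborel \<Otimes>\<^sub>M M) ({0..t} \<times> space M) < \<infinity>"
      by (subst emeasure_pair_measure_Times) (auto simp: emeasure_space_1 emeasure_lborel_Icc_eq)
    show "AE z in lborel \<Otimes>\<^sub>M M. z \<in> {0..t} \<times> space M \<longrightarrow> norm (case_prod ?f z) \<le> c * K"
    proof (rule AE_I2, clarsimp simp: abs_mult)
      fix u \<omega> assume "0 \<le> u" "u \<le> t" "\<omega> \<in> space M"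
      then show "\<bar>G \<omega>\<bar> * \<bar>y u \<omega>\<bar> \<le> c * K"
        using assms(3)[of \<omega>] assms(4)[of u \<omega>] by (intro mult_mono) auto
    qed
  qed (auto simp: indicator_def space_pair_measure)
  note Fubini = lborel_M.Fubini_integral[OF this]
  have "(\<integral>\<omega>. G \<omega> * (LBINT u:{0..t}. y u \<omega>) \<partial>M) = (\<integral>\<omega>. (\<integral>u. ?f u \<omega> \<partial>lborel) \<partial>M)"
    by (simp add: set_lebesgue_integral_def)
  also have "\<dots> = (\<integral>u. (\<integral>\<omega>. ?f u \<omega> \<partial>M) \<partial>lborel)" by (rule Fubini)
  also have "\<dots> = (LBINT u:{0..t}. (\<integral>\<omega>. G \<omega> * y u \<omega> \<partial>M))"
    by (simp add: set_lebesgue_integral_def mult.left_commute[of _ "indicator {0..t} _"])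
  finally show "(\<integral>\<omega>. G \<omega> * (LBINT u:{0..t}. y u \<omega>) \<partial>M) = (LBINT u:{0..t}. (\<integral>\<omega>. G \<omega> * y u \<omega> \<partial>M))" .
qed

locale environment_walk = potential V Cmin C + prob_space M
  for V Cmin C and M :: "'b measure" +
  fixes \<eta> :: "real \<Rightarrow> 'b \<Rightarrow> config" and X :: "real \<Rightarrow> 'b \<Rightarrow> bond"
  assumes environment_measurable: "\<And>t. 0 \<le> t \<Longrightarrow> \<eta> t \<in> measurable M config_space"
    and environment_continuous: "AE \<omega> in M. \<forall>j. continuous_on {0..} (\<lambda>s. \<eta> s \<omega> j)"
    and walk: "walk_in_environment M V \<eta> X"
    and start: "AE \<omega> in M. X 0 \<omega> = bond_at 0"
begin

text \<open>At time 0 the past consists of the whole environment trajectory and of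
  \<open>X 0\<close>, which is almost surely constant. Conditioning on it amounts to conditioning on
  the environment.\<close>

abbreviation "past \<equiv> walk_past M \<eta> X 0"

lemma walk_measurable: "0 \<le> t \<Longrightarrow> X t \<in> measurable M (count_space UNIV)"
  using walk unfolding walk_in_environment_def by blast

lemma past_subalgebra: "subalgebra M past"
  and past_environment: "0 \<le> s \<Longrightarrow> (\<lambda>\<omega>. \<eta> s \<omega> j) \<in> borel_measurable past"
proof -
  let ?f = "\<lambda>\<omega>. (\<lambda>u\<in>{0..}. \<eta> u \<omega>, \<lambda>u\<in>{0..0}. X u \<omega>)"
  let ?N = "PiM {0..} (\<lambda>_. config_space) \<Otimes>\<^sub>M PiM {0..0} (\<lambda>_. count_space UNIV)"
  have f: "?f \<in> M \<rightarrow>\<^sub>M ?N"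
    by (intro measurable_Pair measurable_restrict environment_measurable walk_measurable) auto
  then have f': "?f \<in> space M \<rightarrow> space ?N" by (auto simp: measurable_def)
  have "sets (vimage_algebra (space M) ?f ?N) \<subseteq> sets M"
    unfolding sets_vimage_algebra2[OF f'] using f by (auto simp: measurable_def)
  then show "subalgebra M past"
    by (simp add: subalgebra_def walk_past_def)
  assume s: "0 \<le> s"
  have "(\<lambda>p. fst p s) \<in> ?N \<rightarrow>\<^sub>M config_space"
    using s by (intro measurable_compose[OF measurable_fst measurable_component_singleton]) auto
  from measurable_compose[OF this measurable_component_singleton[of j]]
  have "(\<lambda>p. fst p s j) \<in> borel_measurable ?N" by simp
  from measurable_compose[OF measurable_vimage_algebra1[OF f'] this]
  show "(\<lambda>\<omega>. \<eta> s \<omega> j) \<in> borel_measurable past"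
    using s by (simp add: walk_past_def)
qed

lemma past_measurable_imp: "f \<in> measurable past N \<Longrightarrow> f \<in> measurable M N"
  by (rule measurable_from_subalg[OF past_subalgebra])

text \<open>This and \<open>occ\<close> are versions of the rates and of the occupation indicators
  that are jointly measurable and bounded everywhere; they agree with the processes almost surely
  (\<open>AE_rate_occ\<close>). The clipping in \<open>occ\<close> takes care of the exceptional
  paths.\<close>

definition rate :: "real \<Rightarrow> 'b \<Rightarrow> config" where
  "rate u \<omega> j = deriv (deriv V) (right_reg (\<lambda>s. \<eta> s \<omega> j) (max 0 u))"

definition occ :: "real \<Rightarrow> 'b \<Rightarrow> config" where
  "occ u \<omega> j = max 0 (min 1 (right_reg (\<lambda>s. of_bool (X s \<omega> = bond_at j)) (max 0 u)))"

text \<open>Rates at all later times are measurable with respect to \<open>past\<close> too. This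
  lets a rate be absorbed into the test function \<open>G\<close> in
  \<open>occ_diff_approx\<close>.\<close>

lemma rate_measurable_past: "(\<lambda>\<omega>. rate u \<omega> j) \<in> borel_measurable past"
proof -
  have "(\<lambda>z. right_reg (\<lambda>s. \<eta> s (snd z) j) (fst z)) \<in> borel_measurable (borel \<Otimes>\<^sub>M past)"
    by (rule right_reg_measurable[where f = "\<lambda>s \<omega>. \<eta> s \<omega> j", OF past_environment])
  from measurable_compose[OF _ this, of "\<lambda>\<omega>. (max 0 u, \<omega>)" past]
  have "(\<lambda>\<omega>. right_reg (\<lambda>s. \<eta> s \<omega> j) (max 0 u)) \<in> borel_measurable past" by simp
  then show ?thesis unfolding rate_def by (rule measurable_compose[OF _ V''_measurable])
qed

lemma rate_joint_measurable [measurable]: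
  "(\<lambda>z. rate (fst z) (snd z) j) \<in> borel_measurable (borel \<Otimes>\<^sub>M M)"
proof -
  have m: "(\<lambda>z. right_reg (\<lambda>s. \<eta> s (snd z) j) (fst z)) \<in> borel_measurable (borel \<Otimes>\<^sub>M M)"
    by (rule right_reg_measurable[where f = "\<lambda>s \<omega>. \<eta> s \<omega> j"]) (rule past_measurable_imp[OF past_environment])
  have "(\<lambda>z. right_reg (\<lambda>s. \<eta> s (snd z) j) (max 0 (fst z))) \<in> borel_measurable (borel \<Otimes>\<^sub>M M)"
    using measurable_compose[of "\<lambda>z. (max 0 (fst z), snd z)" "borel \<Otimes>\<^sub>M M", OF _ m] by simp
  then show ?thesis unfolding rate_def by (rule measurable_compose[OF _ V''_measurable])
qed

lemma occ_joint_measurable [measurable]: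
  "(\<lambda>z. occ (fst z) (snd z) j) \<in> borel_measurable (borel \<Otimes>\<^sub>M M)"
proof -
  have m: "(\<lambda>z. right_reg (\<lambda>s. of_bool (X s (snd z) = bond_at j)) (fst z)) \<in> borel_measurable (borel \<Otimes>\<^sub>M M)"
    by (rule right_reg_measurable[where f = "\<lambda>s \<omega>. of_bool (X s \<omega> = bond_at j)"])
       (rule measurable_compose[OF walk_measurable], auto)
  have "(\<lambda>z. right_reg (\<lambda>s. of_bool (X s (snd z) = bond_at j)) (max 0 (fst z))) \<in> borel_measurable (borel \<Otimes>\<^sub>M M)"
    using measurable_compose[of "\<lambda>z. (max 0 (fst z), snd z)" "borel \<Otimes>\<^sub>M M", OF _ m] by simp
  then show ?thesis unfolding occ_def by measurable
qed

lemma rate_bound: "\<bar>rate u \<omega> j\<bar> \<le> C"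
  unfolding rate_def by (rule V''_abs_le)

lemma occ_bounds: "0 \<le> occ u \<omega> j" "occ u \<omega> j \<le> 1"
  unfolding occ_def by auto

lemma section_measurable:
  assumes "(\<lambda>z. f (fst z) (snd z)) \<in> borel_measurable (borel \<Otimes>\<^sub>M M)"
  shows "f u \<in> borel_measurable M" "\<omega> \<in> space M \<Longrightarrow> (\<lambda>u. f u \<omega>) \<in> borel_measurable borel"
  using measurable_compose[of "\<lambda>\<omega>. (u, \<omega>)" M, OF _ assms]
    measurable_compose[of "\<lambda>u. (u, \<omega>)" borel, OF _ assms] by auto

lemmas occ_measurable [measurable] = section_measurable(1)[where f = "\<lambda>u \<omega>. occ u \<omega> j" for j, OF occ_joint_measurable]

lemma AE_rate_occ:
  "AE \<omega> in M. step_path (\<lambda>t. X t \<omega>) \<and> X 0 \<omega> = bond_at 0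
    \<and> (\<forall>u\<ge>0. \<forall>j. occ u \<omega> j = of_bool (X u \<omega> = bond_at j))
    \<and> (\<forall>u j. rate u \<omega> j = deriv (deriv V) (\<eta> (max 0 u) \<omega> j))"
proof -
  have "AE \<omega> in M. step_path (\<lambda>t. X t \<omega>)"
    using walk unfolding walk_in_environment_def by blast
  with environment_continuous start show ?thesis
  proof eventually_elim
    case (elim \<omega>)
    have "right_reg (\<lambda>s. of_bool (X s \<omega> = bond_at j)) u = of_bool (X u \<omega> = bond_at j)" if "0 \<le> u" for u j
    proof (rule right_reg_eq[OF tendsto_eventually that])
      have "eventually (\<lambda>s. X s \<omega> = X u \<omega>) (at_right u)"
        using elim that unfolding step_path_def by blast
      then show "\<forall>\<^sub>F s in at_right u. (of_bool (X s \<omega> = bond_at j) :: real) = of_bool (X u \<omega> = bond_at j)"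
        by eventually_elim simp
    qed
    moreover have "right_reg (\<lambda>s. \<eta> s \<omega> j) u = \<eta> u \<omega> j" if u: "0 \<le> u" for u j
    proof (rule right_reg_eq[OF _ u])
      have "((\<lambda>s. \<eta> s \<omega> j) \<longlongrightarrow> \<eta> u \<omega> j) (at u within {0..})"
        using elim u by (auto simp: continuous_on_def)
      then show "((\<lambda>s. \<eta> s \<omega> j) \<longlongrightarrow> \<eta> u \<omega> j) (at_right u)"
        by (rule tendsto_within_subset) (use u in auto)
    qed
    ultimately show ?case using elim by (simp add: occ_def rate_def)
  qed
qed

section \<open>The forward equation of the walk, tested against functions of the environment\<close>

definition jump_intensity :: "real \<Rightarrow> 'b \<Rightarrow> int \<Rightarrow> int \<Rightarrow> real" where
  "jump_intensity u \<omega> j k = occ u \<omega> j *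
     (if k = j + 1 then rate u \<omega> (j + 1) else if k = j - 1 then rate u \<omega> j else 0)"

lemma jump_intensity_joint_measurable [measurable]:
  "(\<lambda>z. jump_intensity (fst z) (snd z) j k) \<in> borel_measurable (borel \<Otimes>\<^sub>M M)"
  unfolding jump_intensity_def by measurable

lemma jump_intensity_bound: "\<bar>jump_intensity u \<omega> j k\<bar> \<le> C"
proof -
  have "\<bar>jump_intensity u \<omega> j k\<bar> \<le> 1 * C"
    unfolding jump_intensity_def abs_mult using occ_bounds[of u \<omega> j] rate_bound[of u \<omega>] C_pos
    by (intro mult_mono) auto
  then show ?thesis by simp
qed

abbreviation jumps :: "int \<Rightarrow> int \<Rightarrow> real \<Rightarrow> 'b \<Rightarrow> real" where
  "jumps j k t \<omega> \<equiv> real (card (jump_times (\<lambda>u. X u \<omega>) (bond_at j) (bond_at k) 0 t))"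

text \<open>The martingale property of the compensated jump counts, tested against \<open>G\<close>:
  a bounded function measurable with respect to \<open>past\<close> passes into the conditional
  expectation given \<open>past\<close>, which is 0.\<close>

lemma expected_jumps:
  assumes jk: "j \<noteq> k" and t: "0 \<le> t" and G: "G \<in> borel_measurable past" and c: "\<And>\<omega>. \<bar>G \<omega>\<bar> \<le> c"
  shows "integrable M (jumps j k t)"
    and "integrable M (\<lambda>\<omega>. G \<omega> * jumps j k t \<omega>)"
    and "(\<integral>\<omega>. G \<omega> * jumps j k t \<omega> \<partial>M) = (\<integral>\<omega>. G \<omega> * (LBINT u:{0..t}. jump_intensity u \<omega> j k) \<partial>M)"
proof -
  let ?comp = "\<lambda>\<omega>. compensated_jumps V (\<lambda>u. \<eta> u \<omega>) (\<lambda>u. X u \<omega>) (bond_at j) (bond_at k) 0 t"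
  have GM [measurable]: "G \<in> borel_measurable M" by (rule past_measurable_imp[OF G])
  have w: "integrable M (jumps j k t)" "integrable M ?comp" "AE \<omega> in M. real_cond_exp M past ?comp \<omega> = 0"
    using walk jk t unfolding walk_in_environment_def by (auto simp: bonds_iff)
  show "integrable M (jumps j k t)" by fact
  have bounded_mult: "integrable M (\<lambda>\<omega>. G \<omega> * f \<omega>)" if f: "integrable M f" for f
  proof (rule Bochner_Integration.integrable_bound)
    show "integrable M (\<lambda>\<omega>. c * f \<omega>)" using f by simp
    show "AE \<omega> in M. norm (G \<omega> * f \<omega>) \<le> norm (c * f \<omega>)"
      using order_trans[OF c abs_ge_self[of c]] by (auto simp: abs_mult intro!: mult_right_mono)
  qed (use f in measurable)
  show G_jumps: "integrable M (\<lambda>\<omega>. G \<omega> * jumps j k t \<omega>)" by (rule bounded_mult[OF w(1)])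
  interpret finite_measure_subalgebra M past
    by standard (rule past_subalgebra)
  have "(\<integral>\<omega>. G \<omega> * ?comp \<omega> \<partial>M) = (\<integral>\<omega>. G \<omega> * real_cond_exp M past ?comp \<omega> \<partial>M)"
    using w(2) by (intro real_cond_exp_intg(2)[symmetric] bounded_mult G) auto
  also have "\<dots> = (\<integral>\<omega>. 0 \<partial>M)"
    using w(3) by (intro integral_cong_AE) auto
  finally have zero: "(\<integral>\<omega>. G \<omega> * ?comp \<omega> \<partial>M) = 0" by simp
  have int_meas [measurable]: "(\<lambda>\<omega>. LBINT u:{0..t}. jump_intensity u \<omega> j k) \<in> borel_measurable M"
    by (rule time_average_Fubini(1)[where G = G and c = c and K = C]) (use c jump_intensity_bound in auto)
  have AE: "AE \<omega> in M. ?comp \<omega> = jumps j k t \<omega> - (LBINT u:{0..t}. jump_intensity u \<omega> j k)"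
    using AE_rate_occ
  proof eventually_elim
    case (elim \<omega>)
    have "(LBINT u:{0..t}. of_bool (X u \<omega> = bond_at j) * jump_rate V (\<eta> u \<omega>) (bond_at j) (bond_at k))
        = (LBINT u:{0..t}. jump_intensity u \<omega> j k)"
    proof (intro set_lebesgue_integral_cong allI impI)
      fix u assume "u \<in> {0..t}"
      then show "of_bool (X u \<omega> = bond_at j) * jump_rate V (\<eta> u \<omega>) (bond_at j) (bond_at k) = jump_intensity u \<omega> j k"
        using elim by (auto simp: jump_intensity_def jump_rate_def max_def)
    qed auto
    then show ?case by (simp add: compensated_jumps_def)
  qed
  have "integrable M (\<lambda>\<omega>. LBINT u:{0..t}. jump_intensity u \<omega> j k)"
  proof (rule integrable_cong_AE_imp[OF Bochner_Integration.integrable_diff[OF w(1,2)]])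
    show "AE \<omega> in M. jumps j k t \<omega> - ?comp \<omega> = (LBINT u:{0..t}. jump_intensity u \<omega> j k)"
      using AE by eventually_elim simp
  qed measurable
  note G_int = bounded_mult[OF this]
  have "(\<integral>\<omega>. G \<omega> * ?comp \<omega> \<partial>M) = (\<integral>\<omega>. G \<omega> * jumps j k t \<omega> - G \<omega> * (LBINT u:{0..t}. jump_intensity u \<omega> j k) \<partial>M)"
  proof (rule integral_cong_AE)
    show "AE \<omega> in M. G \<omega> * ?comp \<omega> = G \<omega> * jumps j k t \<omega> - G \<omega> * (LBINT u:{0..t}. jump_intensity u \<omega> j k)"
      using AE by eventually_elim (simp add: right_diff_distrib)
  qed (use w(1,2) in \<open>auto intro!: borel_measurable_times borel_measurable_diff\<close>)
  then show "(\<integral>\<omega>. G \<omega> * jumps j k t \<omega> \<partial>M) = (\<integral>\<omega>. G \<omega> * (LBINT u:{0..t}. jump_intensity u \<omega> j k) \<partial>M)"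
    using G_jumps G_int zero by simp
qed

text \<open>These jumps have intensity 0, so their expected number is 0. Passing from
  \<open>card\<close> 0 to the empty set uses that step paths have finitely many jumps.\<close>

lemma AE_only_neighbour_jumps:
  assumes t: "0 \<le> t"
  shows "AE \<omega> in M. \<forall>j k. j \<noteq> k \<longrightarrow> \<bar>j - k\<bar> \<noteq> 1 \<longrightarrow> jump_times (\<lambda>u. X u \<omega>) (bond_at j) (bond_at k) 0 t = {}"
  unfolding AE_all_countable
proof (intro allI)
  fix j k
  show "AE \<omega> in M. j \<noteq> k \<longrightarrow> \<bar>j - k\<bar> \<noteq> 1 \<longrightarrow> jump_times (\<lambda>u. X u \<omega>) (bond_at j) (bond_at k) 0 t = {}"
  proof (cases "j \<noteq> k \<and> \<bar>j - k\<bar> \<noteq> 1")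
    case True
    note e = expected_jumps[where G = "\<lambda>_. 1" and c = 1 and j = j and k = k, OF _ t]
    have "(\<integral>\<omega>. jumps j k t \<omega> \<partial>M) = 0"
    proof -
      have "jump_intensity u \<omega> j k = 0" for u \<omega>
        using True by (auto simp: jump_intensity_def)
      then show ?thesis using e(3) True by (simp add: set_lebesgue_integral_def)
    qed
    then have "AE \<omega> in M. jumps j k t \<omega> = 0"
      using e(1) True by (subst (asm) integral_nonneg_eq_0_iff_AE) auto
    with AE_rate_occ show ?thesis
    proof eventually_elim
      case (elim \<omega>)
      then show ?case
        using step_path_finite_jump_times[of "\<lambda>u. X u \<omega>" t "bond_at j" "bond_at k"] t True by auto
    qed
  qed auto
qed

definition occ_diff :: "real \<Rightarrow> 'b \<Rightarrow> config" where
  "occ_diff u \<omega> j = occ u \<omega> (j - 1) - occ u \<omega> j"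

lemma occ_diff_joint_measurable [measurable]:
  "(\<lambda>z. occ_diff (fst z) (snd z) j) \<in> borel_measurable (borel \<Otimes>\<^sub>M M)"
  unfolding occ_diff_def by measurable

lemma occ_diff_bound: "\<bar>occ_diff u \<omega> j\<bar> \<le> 1"
  using occ_bounds[of u \<omega> j] occ_bounds[of u \<omega> "j - 1"] unfolding occ_diff_def by linarith

text \<open>The value of \<open>occ_diff\<close> at time 0, when the walk sits at the bond
  (0,1).\<close>

definition unit_diff :: config where
  "unit_diff j = of_bool (j = 1) - of_bool (j = 0)"

lemma rate_occ_diff_bound: "\<bar>lapl (\<lambda>j. rate u \<omega> j * occ_diff u \<omega> j) i\<bar> \<le> 4 * C"
proof (rule abs_lapl_le)
  show "\<bar>rate u \<omega> j * occ_diff u \<omega> j\<bar> \<le> C" for j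
    using mult_mono[OF rate_bound[of u \<omega> j] occ_diff_bound[of u \<omega> j]] C_pos by (simp add: abs_mult)
qed

text \<open>Bonds \<open>j - 1\<close> and \<open>j\<close> exchange the walker across site
  \<open>j\<close> at the same rate in both directions, so the net flow across that site is
  \<open>rate u \<omega> j * occ_diff u \<omega> j\<close>. Bond \<open>j\<close> gains the flow
  across \<open>j\<close> and loses the flow across \<open>j + 1\<close>.\<close>

lemma expected_occ:
  assumes t: "0 \<le> t" and G: "G \<in> borel_measurable past" and c: "\<And>\<omega>. \<bar>G \<omega>\<bar> \<le> c"
  shows "(\<integral>\<omega>. G \<omega> * occ t \<omega> j \<partial>M) = (\<integral>\<omega>. G \<omega> \<partial>M) * of_bool (j = 0)
    + (LBINT u:{0..t}. (\<integral>\<omega>. G \<omega> * (rate u \<omega> j * occ_diff u \<omega> j - rate u \<omega> (j + 1) * occ_diff u \<omega> (j + 1)) \<partial>M))"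
proof -
  have GM [measurable]: "G \<in> borel_measurable M" by (rule past_measurable_imp[OF G])
  note e = expected_jumps[OF _ t G c]
  let ?N = "\<lambda>j k \<omega>. G \<omega> * jumps j k t \<omega>"
  have ne: "j - 1 \<noteq> j" "j + 1 \<noteq> j" "j \<noteq> j - 1" "j \<noteq> j + 1" by auto
  have N_int: "integrable M (?N (j - 1) j)" "integrable M (?N (j + 1) j)" "integrable M (?N j (j - 1))" "integrable M (?N j (j + 1))"
    using e(2)[OF ne(1)] e(2)[OF ne(2)] e(2)[OF ne(3)] e(2)[OF ne(4)] by simp_all
  have G_int: "integrable M G"
    by (rule integrable_const_bound[where B = c]) (use c in auto)
  have AE: "AE \<omega> in M. G \<omega> * occ t \<omega> j = G \<omega> * of_bool (j = 0)
      + ((?N (j - 1) j \<omega> + ?N (j + 1) j \<omega>) - (?N j (j - 1) \<omega> + ?N j (j + 1) \<omega>))"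
    using AE_rate_occ AE_only_neighbour_jumps[OF t]
  proof eventually_elim
    case (elim \<omega>)
    then have "of_bool (X t \<omega> = bond_at j) - of_bool (X 0 \<omega> = bond_at j) =
      (jumps (j - 1) j t \<omega> + jumps (j + 1) j t \<omega>) - (jumps j (j - 1) t \<omega> + jumps j (j + 1) t \<omega>)"
      by (intro step_path_jump_balance t) auto
    moreover have "occ t \<omega> j = of_bool (X t \<omega> = bond_at j)" "of_bool (X 0 \<omega> = bond_at j) = (of_bool (j = 0) :: real)"
      using elim t by auto
    ultimately have "occ t \<omega> j = of_bool (j = 0) +
      ((jumps (j - 1) j t \<omega> + jumps (j + 1) j t \<omega>) - (jumps j (j - 1) t \<omega> + jumps j (j + 1) t \<omega>))"
      by linarith
    then show ?case by (simp only: distrib_left right_diff_distrib)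
  qed
  note J_bounded = integral_mult_bounded[OF GM section_measurable(1)[OF jump_intensity_joint_measurable] c jump_intensity_bound]
  note J_int = J_bounded(1)
  let ?J = "\<lambda>i k u. \<integral>\<omega>. G \<omega> * jump_intensity u \<omega> i k \<partial>M"
  have J: "(\<integral>\<omega>. ?N i k \<omega> \<partial>M) = (LBINT u:{0..t}. ?J i k u)" if "i \<noteq> k" for i k
    unfolding e(3)[OF that]
    by (rule time_average_Fubini(2)[where c = c and K = C]) (use c jump_intensity_bound in auto)
  have J_meas: "(\<lambda>u. ?J i k u) \<in> borel_measurable borel" for i k
    by measurable
  have J_sint: "set_integrable lborel {0..t} (?J i k)" for i k
    by (rule set_integrable_bounded[OF J_meas J_bounded(2)])
  have eq: "(?J (j - 1) j u + ?J (j + 1) j u) - (?J j (j - 1) u + ?J j (j + 1) u)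
      = (\<integral>\<omega>. G \<omega> * (rate u \<omega> j * occ_diff u \<omega> j - rate u \<omega> (j + 1) * occ_diff u \<omega> (j + 1)) \<partial>M)" for u
  proof -
    have "(?J (j - 1) j u + ?J (j + 1) j u) - (?J j (j - 1) u + ?J j (j + 1) u)
      = (\<integral>\<omega>. (G \<omega> * jump_intensity u \<omega> (j - 1) j + G \<omega> * jump_intensity u \<omega> (j + 1) j)
          - (G \<omega> * jump_intensity u \<omega> j (j - 1) + G \<omega> * jump_intensity u \<omega> j (j + 1)) \<partial>M)"
      using J_int by simp
    also have "\<dots> = (\<integral>\<omega>. G \<omega> * (rate u \<omega> j * occ_diff u \<omega> j - rate u \<omega> (j + 1) * occ_diff u \<omega> (j + 1)) \<partial>M)"
      by (intro Bochner_Integration.integral_cong) (auto simp: jump_intensity_def occ_diff_def algebra_simps)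
    finally show ?thesis .
  qed
  have "(\<integral>\<omega>. G \<omega> * occ t \<omega> j \<partial>M) = (\<integral>\<omega>. G \<omega> * of_bool (j = 0)
      + ((?N (j - 1) j \<omega> + ?N (j + 1) j \<omega>) - (?N j (j - 1) \<omega> + ?N j (j + 1) \<omega>)) \<partial>M)"
  proof (rule integral_cong_AE[OF _ _ AE])
    show "(\<lambda>\<omega>. G \<omega> * of_bool (j = 0) + ((?N (j - 1) j \<omega> + ?N (j + 1) j \<omega>) - (?N j (j - 1) \<omega> + ?N j (j + 1) \<omega>))) \<in> borel_measurable M"
      by (intro borel_measurable_add borel_measurable_diff N_int[THEN borel_measurable_integrable]) measurable
  qed measurable
  also have "\<dots> = (\<integral>\<omega>. G \<omega> \<partial>M) * of_bool (j = 0)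
      + (((\<integral>\<omega>. ?N (j - 1) j \<omega> \<partial>M) + (\<integral>\<omega>. ?N (j + 1) j \<omega> \<partial>M)) - ((\<integral>\<omega>. ?N j (j - 1) \<omega> \<partial>M) + (\<integral>\<omega>. ?N j (j + 1) \<omega> \<partial>M)))"
  proof -
    have G0: "integrable M (\<lambda>\<omega>. G \<omega> * of_bool (j = 0))" by (cases "j = 0") (use G_int in simp_all)
    show ?thesis
      by (simp only: Bochner_Integration.integral_add Bochner_Integration.integral_diff
          Bochner_Integration.integrable_add Bochner_Integration.integrable_diff N_int G0 integral_mult_left_zero)
  qed
  also have "\<dots> = (\<integral>\<omega>. G \<omega> \<partial>M) * of_bool (j = 0)
      + (LBINT u:{0..t}. (?J (j - 1) j u + ?J (j + 1) j u) - (?J j (j - 1) u + ?J j (j + 1) u))"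
    unfolding J[OF ne(1)] J[OF ne(2)] J[OF ne(3)] J[OF ne(4)]
    by (simp only: set_integral_add set_integral_diff J_sint)
  also have "\<dots> = (\<integral>\<omega>. G \<omega> \<partial>M) * of_bool (j = 0)
    + (LBINT u:{0..t}. (\<integral>\<omega>. G \<omega> * (rate u \<omega> j * occ_diff u \<omega> j - rate u \<omega> (j + 1) * occ_diff u \<omega> (j + 1)) \<partial>M))"
    by (simp only: eq)
  finally show ?thesis .
qed

text \<open>Subtracting the forward equations of two neighbouring bonds turns the differences of
  flows into a discrete Laplacian, which is the form of the linearised dynamics.\<close>

lemma expected_occ_diff:
  assumes t: "0 \<le> t" and G: "G \<in> borel_measurable past" and c: "\<And>\<omega>. \<bar>G \<omega>\<bar> \<le> c"
  shows "(\<integral>\<omega>. G \<omega> * occ_diff t \<omega> i \<partial>M) = (\<integral>\<omega>. G \<omega> \<partial>M) * unit_diff i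
    + (LBINT u:{0..t}. (\<integral>\<omega>. G \<omega> * lapl (\<lambda>j. rate u \<omega> j * occ_diff u \<omega> j) i \<partial>M))"
proof -
  have GM [measurable]: "G \<in> borel_measurable M" by (rule past_measurable_imp[OF G])
  note G_mult = integral_mult_bounded[OF GM _ c]
  let ?f = "\<lambda>j u \<omega>. rate u \<omega> j * occ_diff u \<omega> j - rate u \<omega> (j + 1) * occ_diff u \<omega> (j + 1)"
  have f_joint: "(\<lambda>z. ?f j (fst z) (snd z)) \<in> borel_measurable (borel \<Otimes>\<^sub>M M)" for j
    by measurable
  have f_meas [measurable]: "?f j u \<in> borel_measurable M" for j u
    by (rule section_measurable(1)[OF f_joint])
  have f_bound: "\<bar>?f j u \<omega>\<bar> \<le> 2 * C" for j u \<omega>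
  proof -
    have "\<bar>rate u \<omega> j * occ_diff u \<omega> j\<bar> \<le> C" for j
      using mult_mono[OF rate_bound[of u \<omega> j] occ_diff_bound[of u \<omega> j]] C_pos by (simp add: abs_mult)
    from this[of j] this[of "j + 1"] show ?thesis by linarith
  qed
  note Gf = G_mult[OF f_meas f_bound]
  have sint: "set_integrable lborel {0..t} (\<lambda>u. \<integral>\<omega>. G \<omega> * ?f j u \<omega> \<partial>M)" for j
    by (rule set_integrable_bounded[where K = "c * (2 * C)"]) (use Gf(2) in measurable)
  have eq: "(\<integral>\<omega>. G \<omega> * ?f (i - 1) u \<omega> \<partial>M) - (\<integral>\<omega>. G \<omega> * ?f i u \<omega> \<partial>M)
      = (\<integral>\<omega>. G \<omega> * lapl (\<lambda>j. rate u \<omega> j * occ_diff u \<omega> j) i \<partial>M)" for u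
    by (subst Bochner_Integration.integral_diff[symmetric, OF Gf(1) Gf(1)])
       (intro Bochner_Integration.integral_cong, auto simp: lapl_def algebra_simps)
  have "(\<integral>\<omega>. G \<omega> * occ_diff t \<omega> i \<partial>M) = (\<integral>\<omega>. G \<omega> * occ t \<omega> (i - 1) - G \<omega> * occ t \<omega> i \<partial>M)"
    by (simp add: occ_diff_def right_diff_distrib)
  also have "\<dots> = (\<integral>\<omega>. G \<omega> * occ t \<omega> (i - 1) \<partial>M) - (\<integral>\<omega>. G \<omega> * occ t \<omega> i \<partial>M)"
    by (intro Bochner_Integration.integral_diff G_mult(1)[OF occ_measurable, of _ _ 1]) (use occ_bounds in auto)
  also have "\<dots> = (\<integral>\<omega>. G \<omega> \<partial>M) * unit_diff i
      + (LBINT u:{0..t}. (\<integral>\<omega>. G \<omega> * ?f (i - 1) u \<omega> \<partial>M) - (\<integral>\<omega>. G \<omega> * ?f i u \<omega> \<partial>M))"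
    unfolding expected_occ[OF t G c] set_integral_diff(2)[OF sint sint]
    by (simp add: unit_diff_def algebra_simps)
  also have "\<dots> = (\<integral>\<omega>. G \<omega> \<partial>M) * unit_diff i
    + (LBINT u:{0..t}. (\<integral>\<omega>. G \<omega> * lapl (\<lambda>j. rate u \<omega> j * occ_diff u \<omega> j) i \<partial>M))"
    by (simp only: eq)
  finally show ?thesis .
qed

text \<open>A Picard error estimate in weak form: the linear equation is available only under the
  integral against \<open>G\<close>. The induction runs over all \<open>G\<close> at once, because
  each order multiplies the test function by a rate and its bound by \<open>C\<close>.\<close>

lemma occ_diff_approx:
  assumes t: "0 \<le> t" and G: "G \<in> borel_measurable past" and c: "\<And>\<omega>. \<bar>G \<omega>\<bar> \<le> c"
  shows "\<bar>\<integral>\<omega>. G \<omega> * (occ_diff t \<omega> i - lin_iter (\<lambda>u. rate u \<omega>) unit_diff n t i) \<partial>M\<bar>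
    \<le> c * (2 * (4 * C * t) ^ n / fact n)"
  using t G c
proof (induction n arbitrary: t G c i)
  case 0
  have [measurable]: "G \<in> borel_measurable M" by (rule past_measurable_imp) fact
  have "\<bar>occ_diff t \<omega> i - unit_diff i\<bar> \<le> 2" for \<omega>
    using occ_diff_bound[of t \<omega> i] unfolding unit_diff_def by (auto split: split_of_bool)
  then show ?case
    using integral_mult_bounded(2)[of G "\<lambda>\<omega>. occ_diff t \<omega> i - unit_diff i" c 2] 0(3)
      section_measurable(1)[where f = "\<lambda>u \<omega>. occ_diff u \<omega> i" and u = t, OF occ_diff_joint_measurable]
    by simp
next
  case (Suc n)
  let ?L = "\<lambda>n u \<omega>. lin_iter (\<lambda>u. rate u \<omega>) unit_diff n u"
  let ?g = "\<lambda>u \<omega>. lapl (\<lambda>j. rate u \<omega> j * ?L n u \<omega> j) i"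
  let ?d = "\<lambda>u \<omega>. lapl (\<lambda>j. rate u \<omega> j * occ_diff u \<omega> j) i"
  let ?B = "1 * (1 + 4 * C * t) ^ n"
  have GM [measurable]: "G \<in> borel_measurable M" by (rule past_measurable_imp[OF Suc.prems(2)])
  note c = Suc.prems(3)
  have [measurable]: "(\<lambda>z. ?L n (fst z) (snd z) j) \<in> borel_measurable (borel \<Otimes>\<^sub>M M)" for n j
    by (rule lin_iter_joint_measurable) measurable
  have [measurable]: "(\<lambda>\<omega>. ?L n u \<omega> j) \<in> borel_measurable M" for n u j
    by (rule section_measurable(1)[where f = "\<lambda>u \<omega>. ?L n u \<omega> j"]) measurable
  have [measurable]: "(\<lambda>\<omega>. occ_diff u \<omega> j) \<in> borel_measurable M" "(\<lambda>\<omega>. rate u \<omega> j) \<in> borel_measurable M" for u j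
    by (rule section_measurable(1)[where f = "\<lambda>u \<omega>. occ_diff u \<omega> j"], measurable)
       (rule section_measurable(1)[where f = "\<lambda>u \<omega>. rate u \<omega> j"], measurable)
  have g_joint: "(\<lambda>z. ?g (fst z) (snd z)) \<in> borel_measurable (borel \<Otimes>\<^sub>M M)"
    "(\<lambda>z. ?d (fst z) (snd z)) \<in> borel_measurable (borel \<Otimes>\<^sub>M M)"
    unfolding lapl_def by measurable
  have gM [measurable]: "?g u \<in> borel_measurable M" "?d u \<in> borel_measurable M" for u
    by (rule section_measurable(1)[OF g_joint(1)], rule section_measurable(1)[OF g_joint(2)])
  have rates: "bounded_rates (\<lambda>u. rate u \<omega>) C" if "\<omega> \<in> space M" for \<omega>
    by standard (use section_measurable(2)[where f = "\<lambda>u \<omega>. rate u \<omega> j" for j, OF rate_joint_measurable that] rate_bound in auto)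
  have unit: "\<bar>unit_diff j\<bar> \<le> 1" for j by (auto simp: unit_diff_def)
  have L_bound: "\<bar>?L n u \<omega> j\<bar> \<le> ?B" if "u \<in> {0..t}" "\<omega> \<in> space M" for u \<omega> j
    by (rule bounded_rates.lin_iter_bound[OF rates[OF that(2)] unit that(1)])
  have g_bound: "\<bar>?g u \<omega>\<bar> \<le> 4 * (C * ?B)" if "u \<in> {0..t}" "\<omega> \<in> space M" for u \<omega>
    by (intro abs_lapl_le bounded_rates.abs_mult_rate_le[OF rates[OF that(2)]] L_bound that)
  note G_g = integral_mult_bounded[OF GM gM(1) c g_bound]
  note G_d = integral_mult_bounded[OF GM gM(2) c rate_occ_diff_bound]
  have g_sint: "set_integrable lborel {0..t} (\<lambda>u. \<integral>\<omega>. G \<omega> * ?g u \<omega> \<partial>M)"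
    by (rule set_integrable_bounded[where K = "c * (4 * (C * ?B))"]) (use G_g(2) g_joint in measurable)
  have d_sint: "set_integrable lborel {0..t} (\<lambda>u. \<integral>\<omega>. G \<omega> * ?d u \<omega> \<partial>M)"
    by (rule set_integrable_bounded[where K = "c * (4 * C)"]) (use G_d(2) g_joint in measurable)
  have G_int: "integrable M G"
    by (rule integrable_const_bound[where B = c]) (use c in auto)
  have I_meas: "(\<lambda>\<omega>. LBINT u:{0..t}. ?g u \<omega>) \<in> borel_measurable M"
    by (rule time_average_Fubini(1)[OF g_joint(1) GM c g_bound])
  have I_bound: "\<bar>LBINT u:{0..t}. ?g u \<omega>\<bar> \<le> 4 * (C * ?B) * t" if "\<omega> \<in> space M" for \<omega>
  proof -
    have "\<bar>LBINT u:{0..t}. ?g u \<omega>\<bar> \<le> (LBINT u:{0..t}. 4 * (C * ?B))"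
      by (rule abs_set_integral_le)
         (use g_bound that in \<open>auto intro!: set_integrable_bounded[where K = "\<bar>4 * (C * ?B)\<bar>"]\<close>)
    then show ?thesis using Suc.prems(1) by (simp add: set_integral_const_Icc ac_simps)
  qed
  note G_I = integral_mult_bounded(1)[OF GM I_meas c I_bound]
  have od: "integrable M (\<lambda>\<omega>. G \<omega> * occ_diff t \<omega> i)"
    by (rule integral_mult_bounded(1)[OF GM _ c occ_diff_bound]) measurable
  have G_L: "integrable M (\<lambda>\<omega>. G \<omega> * ?L (Suc n) t \<omega> i)"
    using integrable_mult_left[OF G_int, of "unit_diff i"] G_I by (simp add: distrib_left)
  have "(\<integral>\<omega>. G \<omega> * ?L (Suc n) t \<omega> i \<partial>M) = (\<integral>\<omega>. G \<omega> * unit_diff i + G \<omega> * (LBINT u:{0..t}. ?g u \<omega>) \<partial>M)"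
    by (simp add: distrib_left)
  also have "\<dots> = (\<integral>\<omega>. G \<omega> \<partial>M) * unit_diff i + (LBINT u:{0..t}. (\<integral>\<omega>. G \<omega> * ?g u \<omega> \<partial>M))"
    using integrable_mult_left[OF G_int, of "unit_diff i"] G_I time_average_Fubini(2)[OF g_joint(1) GM c g_bound]
    by simp
  finally have "(\<integral>\<omega>. G \<omega> * (occ_diff t \<omega> i - ?L (Suc n) t \<omega> i) \<partial>M)
      = (LBINT u:{0..t}. (\<integral>\<omega>. G \<omega> * ?d u \<omega> \<partial>M) - (\<integral>\<omega>. G \<omega> * ?g u \<omega> \<partial>M))"
    using od G_L expected_occ_diff[OF Suc.prems, of i] set_integral_diff(2)[OF d_sint g_sint]
    by (simp add: right_diff_distrib del: lin_iter.simps)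
  moreover have "\<bar>LBINT u:{0..t}. (\<integral>\<omega>. G \<omega> * ?d u \<omega> \<partial>M) - (\<integral>\<omega>. G \<omega> * ?g u \<omega> \<partial>M)\<bar>
      \<le> (2 * c) * (4 * C * t) ^ Suc n / fact (Suc n)"
  proof (rule abs_set_integral_power_le[OF Suc.prems(1)])
    fix u assume u: "u \<in> {0..t}"
    let ?D = "\<lambda>j \<omega>. G \<omega> * rate u \<omega> j * (occ_diff u \<omega> j - ?L n u \<omega> j)"
    let ?K = "C * (2 * c * (4 * C * u) ^ n / fact n)"
    have D: "integrable M (?D j)" "\<bar>\<integral>\<omega>. ?D j \<omega> \<partial>M\<bar> \<le> ?K" for j
    proof -
      have Gr: "\<bar>G \<omega> * rate u \<omega> j\<bar> \<le> c * C" for \<omega>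
        unfolding abs_mult using c rate_bound order_trans[OF abs_ge_zero c] by (intro mult_mono) auto
      show "integrable M (?D j)"
      proof (rule integral_mult_bounded(1)[OF _ _ Gr])
        show "\<bar>occ_diff u \<omega> j - ?L n u \<omega> j\<bar> \<le> 1 + ?B" if "\<omega> \<in> space M" for \<omega>
          using L_bound[OF u that, of j] occ_diff_bound[of u \<omega> j] by linarith
      qed measurable
      \<comment> \<open>The induction hypothesis for the test function \<open>G\<close> times the
        rate, which is bounded by \<open>c * C\<close> and again measurable with respect to
        \<open>past\<close>.\<close>
      show "\<bar>\<integral>\<omega>. ?D j \<omega> \<partial>M\<bar> \<le> ?K"
        using Suc.IH[of u "\<lambda>\<omega>. G \<omega> * rate u \<omega> j" "c * C" j] u Suc.prems(2) rate_measurable_past Gr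
        by (simp add: ac_simps)
    qed
    have "(\<integral>\<omega>. G \<omega> * ?d u \<omega> \<partial>M) - (\<integral>\<omega>. G \<omega> * ?g u \<omega> \<partial>M) = (\<integral>\<omega>. G \<omega> * ?d u \<omega> - G \<omega> * ?g u \<omega> \<partial>M)"
      by (rule Bochner_Integration.integral_diff[symmetric, OF G_d(1) G_g(1)[OF u]])
    also have "\<dots> = (\<integral>\<omega>. ?D (i + 1) \<omega> + ?D (i - 1) \<omega> - 2 * ?D i \<omega> \<partial>M)"
      by (intro Bochner_Integration.integral_cong) (auto simp: lapl_def algebra_simps)
    also have "\<dots> = (\<integral>\<omega>. ?D (i + 1) \<omega> \<partial>M) + (\<integral>\<omega>. ?D (i - 1) \<omega> \<partial>M) - 2 * (\<integral>\<omega>. ?D i \<omega> \<partial>M)"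
      using D(1) by simp
    finally show "\<bar>(\<integral>\<omega>. G \<omega> * ?d u \<omega> \<partial>M) - (\<integral>\<omega>. G \<omega> * ?g u \<omega> \<partial>M)\<bar>
        \<le> 4 * C * (2 * c * (4 * C * u) ^ n / fact n)"
      using D(2)[of "i + 1"] D(2)[of "i - 1"] D(2)[of i] by linarith
  qed
  ultimately show ?case by (simp add: mult.left_commute mult.commute del: lin_iter.simps power_Suc fact_Suc)
qed

end

section \<open>Difference quotients of the flow and the walk\<close>

abbreviation noise_space :: "(bond \<times> real \<Rightarrow> real) measure" where
  "noise_space \<equiv> PiM (bonds \<times> {0..}) (\<lambda>_. borel)"

lemma noise_component_measurable:
  "0 \<le> s \<Longrightarrow> (\<lambda>\<beta>. \<beta> ((j, j + 1), s)) \<in> borel_measurable noise_space"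
  "0 \<le> s \<Longrightarrow> (\<lambda>\<beta>. \<beta> ((j - 1, j), s)) \<in> borel_measurable noise_space"
proof -
  show "(\<lambda>\<beta>. \<beta> ((j, j + 1), s)) \<in> borel_measurable noise_space" if "0 \<le> s" for j
    by (rule measurable_component_singleton) (use that in \<open>auto simp: bonds_def\<close>)
  from this[of "j - 1"] show "0 \<le> s \<Longrightarrow> (\<lambda>\<beta>. \<beta> ((j - 1, j), s)) \<in> borel_measurable noise_space" by simp
qed

lemma mild_path_cong:
  assumes "\<And>b t. b \<in> bonds \<Longrightarrow> 0 \<le> t \<Longrightarrow> \<beta> (b, t) = \<beta>' (b, t)"
  shows "mild_path V r \<beta> h \<longleftrightarrow> mild_path V r \<beta>' h"
proof -
  have "bond_at i \<in> bonds" "(i - 1, i) \<in> bonds" for i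
    by (auto simp: bonds_def intro!: image_eqI[of _ _ "i - 1"])
  then show ?thesis unfolding mild_path_def by (simp add: assms)
qed

section \<open>Measurability and Lipschitz bounds of the solution map\<close>

context potential
begin

lemma euler_measurable:
  assumes "0 \<le> \<tau>"
  shows "(\<lambda>p. euler V \<tau> (snd p) (fst p) k i) \<in> borel_measurable (config_space \<Otimes>\<^sub>M noise_space)"
proof (induction k arbitrary: i)
  case 0
  show ?case
    using measurable_compose[OF measurable_fst measurable_component_singleton[of i UNIV "\<lambda>_. borel"]] by simp
next
  case (Suc k)
  note [measurable] = Suc
  have [measurable]: "(\<lambda>p. snd p ((j, j + 1), \<tau> * real m)) \<in> borel_measurable (config_space \<Otimes>\<^sub>M noise_space)"
    "(\<lambda>p. snd p ((j - 1, j), \<tau> * real m)) \<in> borel_measurable (config_space \<Otimes>\<^sub>M noise_space)" for j m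
    using measurable_compose[OF measurable_snd noise_component_measurable(1)[of "\<tau> * real m" j]]
      measurable_compose[OF measurable_snd noise_component_measurable(2)[of "\<tau> * real m" j]] assms by simp_all
  have "(\<lambda>p. gl_drift V (euler V \<tau> (snd p) (fst p) k) i) \<in> borel_measurable (config_space \<Otimes>\<^sub>M noise_space)"
    by (rule drift_measurable) measurable
  note [measurable] = this
  show ?case unfolding euler.simps by measurable
qed

lemma euler_limit_measurable:
  assumes "0 \<le> t"
  shows "(\<lambda>p. euler_limit V t (snd p) (fst p) i) \<in> borel_measurable (config_space \<Otimes>\<^sub>M noise_space)"
  unfolding euler_limit_def by (intro borel_measurable_lim_metric euler_measurable) (use assms in simp)

text \<open>The limit in \<open>euler_limit\<close> is known to exist only along actual solutions,
  so solutions from both perturbed configurations are constructed first; \<open>A\<close> makes this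
  possible, while the estimate depends on \<open>K\<close> and \<open>w\<close>.\<close>

lemma euler_limit_lipschitz:
  assumes h: "mild_path V r \<beta> h" and r: "0 \<le> r" and t: "0 \<le> t"
    and x: "\<And>j. \<bar>x j\<bar> \<le> A" and y: "\<And>j. \<bar>y j\<bar> \<le> A"
    and w: "\<And>j. w (j + 1) \<le> c * w j" "\<And>j. w (j - 1) \<le> c * w j" "1 \<le> c" "\<And>j. 0 \<le> w j"
    and K: "0 \<le> K" "\<And>j. \<bar>x j - y j\<bar> \<le> K * w j"
  shows "\<bar>euler_limit V t \<beta> (\<lambda>j. h 0 j + x j) i - euler_limit V t \<beta> (\<lambda>j. h 0 j + y j) i\<bar>
    \<le> K * exp (4 * c * C * t) * w i"
proof -
  obtain h1 where h1: "mild_path V r \<beta> h1" "h1 0 = (\<lambda>j. h 0 j + x j)"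
    by (rule mild_path_perturbation[OF h r x])
  obtain h2 where h2: "mild_path V r \<beta> h2" "h2 0 = (\<lambda>j. h 0 j + y j)"
    by (rule mild_path_perturbation[OF h r y])
  have "\<bar>h1 t i - h2 t i\<bar> \<le> K * exp (4 * c * C * t) * w i"
    by (rule mild_path_lipschitz[OF h1(1) h2(1) r t w]) (use K in \<open>auto simp: h1 h2\<close>)
  then show ?thesis
    using euler_limit_eq[OF h1(1) r t, of i] euler_limit_eq[OF h2(1) r t, of i] by (simp add: h1 h2)
qed

end

definition site_unit :: "int \<Rightarrow> config" where
  "site_unit k j = of_bool (j = k)"

lemma abs_site_unit_le: "\<bar>site_unit k j\<bar> \<le> 1"
  by (simp add: site_unit_def)

context environment_walk
begin

lemma expectation_occ_diff:
  assumes "0 \<le> t"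
  shows "(\<integral>\<omega>. occ_diff t \<omega> i \<partial>M) =
    (\<integral>\<omega>. of_bool (X t \<omega> = bond_at (i - 1)) \<partial>M) - (\<integral>\<omega>. of_bool (X t \<omega> = bond_at i) \<partial>M)"
proof -
  have m: "(\<lambda>\<omega>. of_bool (X t \<omega> = b) :: real) \<in> borel_measurable M" for b
    by (rule measurable_compose[OF walk_measurable[OF assms]]) auto
  have int: "integrable M (\<lambda>\<omega>. of_bool (X t \<omega> = b) :: real)" for b
    by (rule integrable_const_bound[where B = 1]) (use m in auto)
  have "(\<integral>\<omega>. occ_diff t \<omega> i \<partial>M) = (\<integral>\<omega>. of_bool (X t \<omega> = bond_at (i - 1)) - of_bool (X t \<omega> = bond_at i) \<partial>M)"
  proof (rule integral_cong_AE)
    show "AE \<omega> in M. occ_diff t \<omega> i = of_bool (X t \<omega> = bond_at (i - 1)) - of_bool (X t \<omega> = bond_at i)"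
      using AE_rate_occ by eventually_elim (use assms in \<open>simp add: occ_diff_def\<close>)
    show "(\<lambda>\<omega>. occ_diff t \<omega> i) \<in> borel_measurable M"
      by (rule section_measurable(1)[where f = "\<lambda>u \<omega>. occ_diff u \<omega> i"]) measurable
  qed (intro borel_measurable_diff m)
  then show ?thesis using int by simp
qed

text \<open>The limit \<open>L\<close> of the quotients and \<open>occ_diff\<close> are both close
  to the same random Picard iterate, the former on almost every path, the latter in mean; letting
  the order tend to infinity gives equal expectations. The uniform bound is the Lipschitz estimate
  with weight 1, since the two shifted configurations differ by at most |\<epsilon> m| at each
  site.\<close>

theorem walk_difference_quotient:
  fixes \<epsilon> :: "nat \<Rightarrow> real"
  assumes paths: "AE \<omega> in M. mild_path V r (\<beta> \<omega>) (\<lambda>t. \<eta> t \<omega>)" and r: "0 \<le> r" and t: "0 \<le> t"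
    and init: "AE \<omega> in M. \<eta> 0 \<omega> = \<zeta>"
    and meas: "\<And>\<zeta>. (\<lambda>\<omega>. euler_limit V t (\<beta> \<omega>) \<zeta> i) \<in> borel_measurable M"
    and \<epsilon>: "\<epsilon> \<longlonglongrightarrow> 0" "\<And>m. \<epsilon> m \<noteq> 0"
  shows "(\<lambda>m. \<integral>\<omega>. (euler_limit V t (\<beta> \<omega>) (\<lambda>j. \<zeta> j + \<epsilon> m * site_unit 1 j) i
      - euler_limit V t (\<beta> \<omega>) (\<lambda>j. \<zeta> j + \<epsilon> m * site_unit 0 j) i) / \<epsilon> m \<partial>M)
    \<longlonglongrightarrow> (\<integral>\<omega>. of_bool (X t \<omega> = bond_at (i - 1)) \<partial>M) - (\<integral>\<omega>. of_bool (X t \<omega> = bond_at i) \<partial>M)"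
    and "\<bar>\<integral>\<omega>. (euler_limit V t (\<beta> \<omega>) (\<lambda>j. \<zeta> j + \<epsilon> m * site_unit 1 j) i
      - euler_limit V t (\<beta> \<omega>) (\<lambda>j. \<zeta> j + \<epsilon> m * site_unit 0 j) i) / \<epsilon> m \<partial>M\<bar> \<le> exp (4 * C * t)"
proof -
  define f where "f m \<omega> = (euler_limit V t (\<beta> \<omega>) (\<lambda>j. \<zeta> j + \<epsilon> m * site_unit 1 j) i
      - euler_limit V t (\<beta> \<omega>) (\<lambda>j. \<zeta> j + \<epsilon> m * site_unit 0 j) i) / \<epsilon> m" for m \<omega>
  define L where "L \<omega> = lim (\<lambda>m. f m \<omega>)" for \<omega>
  let ?I = "\<lambda>n \<omega>. lin_iter (\<lambda>u. rate u \<omega>) unit_diff n t i"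
  \<comment> \<open>Twice the error of one coordinate direction, as the initial value is a
    difference of two site units.\<close>
  let ?e = "\<lambda>n. 4 * exp (4 * C * t) * (4 * C * t) ^ n / fact n"
  have f_meas [measurable]: "f m \<in> borel_measurable M" for m
    unfolding f_def using meas by (intro borel_measurable_divide borel_measurable_diff) auto
  have L_meas [measurable]: "L \<in> borel_measurable M"
    unfolding L_def by (intro borel_measurable_lim_metric f_meas)
  have f_bound: "AE \<omega> in M. norm (f m \<omega>) \<le> exp (4 * C * t)" for m
    using paths init
  proof eventually_elim
    case (elim \<omega>)
    have "\<bar>euler_limit V t (\<beta> \<omega>) (\<lambda>j. \<eta> 0 \<omega> j + \<epsilon> m * site_unit 1 j) i
        - euler_limit V t (\<beta> \<omega>) (\<lambda>j. \<eta> 0 \<omega> j + \<epsilon> m * site_unit 0 j) i\<bar>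
      \<le> \<bar>\<epsilon> m\<bar> * exp (4 * 1 * C * t) * (\<lambda>j::int. 1) i"
      by (rule euler_limit_lipschitz[OF elim(1) r t, where A = "\<bar>\<epsilon> m\<bar>"]) (auto simp: site_unit_def)
    then show ?case
      using \<epsilon>(2)[of m] elim(2) by (simp add: f_def abs_divide divide_le_eq mult.commute)
  qed
  have AE_L: "AE \<omega> in M. (\<lambda>m. f m \<omega>) \<longlonglongrightarrow> L \<omega> \<and> (\<forall>n. \<bar>L \<omega> - ?I n \<omega>\<bar> \<le> ?e n)"
    using paths init AE_rate_occ AE_space
  proof eventually_elim
    case (elim \<omega>)
    let ?a = "\<lambda>s j. deriv (deriv V) (\<eta> (max 0 s) \<omega> j)"
    have a_eq: "(\<lambda>u. rate u \<omega>) = ?a" using elim by (intro ext) auto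
    have "bounded_rates (\<lambda>u. rate u \<omega>) C"
      by standard (use section_measurable(2)[where f = "\<lambda>u \<omega>. rate u \<omega> j" for j, OF rate_joint_measurable] elim(4) rate_bound in auto)
    then have rates: "bounded_rates ?a C" unfolding a_eq .
    obtain l1 where l1: "(\<lambda>m. (euler_limit V t (\<beta> \<omega>) (\<lambda>j. \<eta> 0 \<omega> j + \<epsilon> m * site_unit 1 j) i - euler_limit V t (\<beta> \<omega>) (\<eta> 0 \<omega>) i) / \<epsilon> m) \<longlonglongrightarrow> l1"
      "\<And>n. \<bar>l1 - lin_iter ?a (site_unit 1) n t i\<bar> \<le> 2 * (1 * exp (4 * C * t)) * (4 * C * t) ^ n / fact n"
      using difference_quotients_converge[where x = "site_unit 1" and i = i, OF elim(1) r abs_site_unit_le \<epsilon> t] by blast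
    obtain l0 where l0: "(\<lambda>m. (euler_limit V t (\<beta> \<omega>) (\<lambda>j. \<eta> 0 \<omega> j + \<epsilon> m * site_unit 0 j) i - euler_limit V t (\<beta> \<omega>) (\<eta> 0 \<omega>) i) / \<epsilon> m) \<longlonglongrightarrow> l0"
      "\<And>n. \<bar>l0 - lin_iter ?a (site_unit 0) n t i\<bar> \<le> 2 * (1 * exp (4 * C * t)) * (4 * C * t) ^ n / fact n"
      using difference_quotients_converge[where x = "site_unit 0" and i = i, OF elim(1) r abs_site_unit_le \<epsilon> t] by blast
    have lim: "(\<lambda>m. f m \<omega>) \<longlonglongrightarrow> l1 - l0"
      using tendsto_diff[OF l1(1) l0(1)] elim(2) by (simp add: f_def flip: diff_divide_distrib)
    then have L: "L \<omega> = l1 - l0" unfolding L_def by (rule limI)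
    have "\<bar>L \<omega> - ?I n \<omega>\<bar> \<le> ?e n" for n
    proof -
      have "?I n \<omega> = lin_iter ?a (\<lambda>j. site_unit 1 j - site_unit 0 j) n t i"
        unfolding a_eq by (simp add: unit_diff_def[abs_def] site_unit_def)
      also have "\<dots> = lin_iter ?a (site_unit 1) n t i - lin_iter ?a (site_unit 0) n t i"
        by (rule bounded_rates.lin_iter_diff[OF rates abs_site_unit_le abs_site_unit_le])
      finally have I: "?I n \<omega> = lin_iter ?a (site_unit 1) n t i - lin_iter ?a (site_unit 0) n t i" .
      have "4 * a * b / c = 2 * (1 * a) * b / c + 2 * (1 * a) * b / c" for a b c :: real
        by (simp flip: add_divide_distrib)
      from this[of "exp (4 * C * t)" "(4 * C * t) ^ n" "fact n"] show ?thesis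
        using l1(2)[of n] l0(2)[of n] unfolding L I by linarith
    qed
    with lim show ?case unfolding L by blast
  qed
  have f_lim: "AE \<omega> in M. (\<lambda>m. f m \<omega>) \<longlonglongrightarrow> L \<omega>"
    using AE_L by eventually_elim blast
  note dom = L_meas f_meas integrable_const[of "exp (4 * C * t)"] f_lim f_bound
  have L_int: "integrable M L" by (rule integrable_dominated_convergence[OF dom])
  have int_lim: "(\<lambda>m. \<integral>\<omega>. f m \<omega> \<partial>M) \<longlonglongrightarrow> (\<integral>\<omega>. L \<omega> \<partial>M)"
    by (rule integral_dominated_convergence[OF dom])
  have occ_meas: "(\<lambda>\<omega>. occ_diff t \<omega> i) \<in> borel_measurable M"
    by (rule section_measurable(1)[where f = "\<lambda>u \<omega>. occ_diff u \<omega> i"]) measurable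
  have occ_int: "integrable M (\<lambda>\<omega>. occ_diff t \<omega> i)"
    by (rule integrable_const_bound[where B = 1]) (use occ_diff_bound occ_meas in auto)
  have "\<bar>(\<integral>\<omega>. L \<omega> \<partial>M) - (\<integral>\<omega>. occ_diff t \<omega> i \<partial>M)\<bar> \<le> (4 * exp (4 * C * t) + 2) * (4 * C * t) ^ n / fact n" for n
  proof -
    have I_meas: "?I n \<in> borel_measurable M"
      by (rule section_measurable(1)[where f = "\<lambda>s \<omega>. lin_iter (\<lambda>u. rate u \<omega>) unit_diff n s i"])
         (rule lin_iter_joint_measurable, measurable)
    have diff_int: "integrable M (\<lambda>\<omega>. L \<omega> - ?I n \<omega>)"
    proof (rule integrable_const_bound[where B = "?e n"])
      show "AE \<omega> in M. norm (L \<omega> - ?I n \<omega>) \<le> ?e n"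
        using AE_L by eventually_elim (simp only: real_norm_def)
    qed (intro borel_measurable_diff L_meas I_meas)
    have I_int: "integrable M (?I n)"
      using Bochner_Integration.integrable_diff[OF L_int diff_int] by simp
    have "\<bar>\<integral>\<omega>. L \<omega> - ?I n \<omega> \<partial>M\<bar> \<le> (\<integral>\<omega>. \<bar>L \<omega> - ?I n \<omega>\<bar> \<partial>M)" by (rule integral_abs_bound)
    also have "\<dots> \<le> ?e n"
    proof (rule integral_le_const)
      show "AE \<omega> in M. \<bar>L \<omega> - ?I n \<omega>\<bar> \<le> ?e n" using AE_L by eventually_elim blast
    qed (use diff_int in auto)
    finally have 1: "\<bar>(\<integral>\<omega>. L \<omega> \<partial>M) - (\<integral>\<omega>. ?I n \<omega> \<partial>M)\<bar> \<le> ?e n"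
      using L_int I_int by simp
    \<comment> \<open>The constant test function 1 gives the plain expectation.\<close>
    have "\<bar>\<integral>\<omega>. 1 * (occ_diff t \<omega> i - ?I n \<omega>) \<partial>M\<bar> \<le> 1 * (2 * (4 * C * t) ^ n / fact n)"
      by (rule occ_diff_approx[OF t]) auto
    then have 2: "\<bar>(\<integral>\<omega>. occ_diff t \<omega> i \<partial>M) - (\<integral>\<omega>. ?I n \<omega> \<partial>M)\<bar> \<le> 2 * (4 * C * t) ^ n / fact n"
      using occ_int I_int by simp
    have "(4 * exp (4 * C * t) + 2) * (4 * C * t) ^ n / fact n = ?e n + 2 * (4 * C * t) ^ n / fact n"
      by (simp add: distrib_right add_divide_distrib)
    with 1 2 show ?thesis by linarith
  qed
  then have "\<bar>(\<integral>\<omega>. L \<omega> \<partial>M) - (\<integral>\<omega>. occ_diff t \<omega> i \<partial>M)\<bar> \<le> 0"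
    by (intro tendsto_lowerbound[OF power_div_fact_LIMSEQ_zero[of "4 * exp (4 * C * t) + 2" "4 * C * t"]]) auto
  then have "(\<integral>\<omega>. L \<omega> \<partial>M) = (\<integral>\<omega>. occ_diff t \<omega> i \<partial>M)" by simp
  then show "(\<lambda>m. \<integral>\<omega>. (euler_limit V t (\<beta> \<omega>) (\<lambda>j. \<zeta> j + \<epsilon> m * site_unit 1 j) i
      - euler_limit V t (\<beta> \<omega>) (\<lambda>j. \<zeta> j + \<epsilon> m * site_unit 0 j) i) / \<epsilon> m \<partial>M)
    \<longlonglongrightarrow> (\<integral>\<omega>. of_bool (X t \<omega> = bond_at (i - 1)) \<partial>M) - (\<integral>\<omega>. of_bool (X t \<omega> = bond_at i) \<partial>M)"
    using int_lim unfolding expectation_occ_diff[OF t] f_def by simp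
  have "integrable M (f m)" by (rule integrable_const_bound[OF f_bound f_meas])
  then have "(\<integral>\<omega>. \<bar>f m \<omega>\<bar> \<partial>M) \<le> exp (4 * C * t)"
    using f_bound[of m] by (intro integral_le_const) auto
  then show "\<bar>\<integral>\<omega>. (euler_limit V t (\<beta> \<omega>) (\<lambda>j. \<zeta> j + \<epsilon> m * site_unit 1 j) i
      - euler_limit V t (\<beta> \<omega>) (\<lambda>j. \<zeta> j + \<epsilon> m * site_unit 0 j) i) / \<epsilon> m \<partial>M\<bar> \<le> exp (4 * C * t)"
    using integral_abs_bound[of M "f m"] unfolding f_def by linarith
qed

end

section \<open>Uniqueness of the law of the noise\<close>

definition time_grid :: "real set \<Rightarrow> nat \<Rightarrow> real" where
  "time_grid T k = sorted_list_of_set (insert 0 (insert 1 T)) ! k"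

definition grid_size :: "real set \<Rightarrow> nat" where
  "grid_size T = card (insert 0 (insert 1 T)) - 1"

definition grid_index :: "real set \<Rightarrow> real \<Rightarrow> nat" where
  "grid_index T t = (SOME k. k \<le> grid_size T \<and> time_grid T k = t)"

text \<open>The law at the times \<open>T\<close> is read off from the independent increments along a grid that
  contains \<open>T\<close> and starts at \<open>0\<close>; the extra point \<open>1\<close> makes the set of increments nonempty.\<close>

definition brownian_law :: "real set \<Rightarrow> (real \<Rightarrow> real) measure" where
  "brownian_law T = distr
     (PiM {..<grid_size T} (\<lambda>k. density lborel (normal_density 0 (sqrt (time_grid T (Suc k) - time_grid T k)))))
     (PiM T (\<lambda>_. borel)) (\<lambda>x. \<lambda>t\<in>T. \<Sum>k<grid_index T t. x k)"

lemma
  assumes "finite T" "T \<subseteq> {0..}"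
  shows time_grid_0: "time_grid T 0 = 0"
    and time_grid_less: "\<And>k. k < grid_size T \<Longrightarrow> time_grid T k < time_grid T (Suc k)"
    and grid_size_pos: "0 < grid_size T"
    and grid_index: "\<And>t. t \<in> T \<Longrightarrow> grid_index T t \<le> grid_size T \<and> time_grid T (grid_index T t) = t"
proof -
  define S where "S = insert 0 (insert 1 T)"
  let ?l = "sorted_list_of_set S"
  have fin: "finite S" using assms by (simp add: S_def)
  have "card {0, 1::real} \<le> card S" by (rule card_mono[OF fin]) (auto simp: S_def)
  then have card: "card S \<ge> 2" by simp
  then show pos: "0 < grid_size T" by (simp add: grid_size_def flip: S_def)
  have len: "length ?l = Suc (grid_size T)"
    using card by (simp add: grid_size_def flip: S_def)
  have time_grid: "time_grid T k = ?l ! k" for k by (simp add: time_grid_def S_def)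
  have strict: "sorted_wrt (<) ?l" by simp
  show "time_grid T k < time_grid T (Suc k)" if "k < grid_size T" for k
    unfolding time_grid using sorted_wrt_nth_less[OF strict, of k "Suc k"] that len by simp
  have mem: "t \<in> S \<longleftrightarrow> (\<exists>k\<le>grid_size T. time_grid T k = t)" for t
  proof -
    have "t \<in> set ?l \<longleftrightarrow> (\<exists>k<length ?l. ?l ! k = t)" by (rule in_set_conv_nth)
    then show ?thesis unfolding len less_Suc_eq_le time_grid set_sorted_list_of_set[OF fin] .
  qed
  show "grid_index T t \<le> grid_size T \<and> time_grid T (grid_index T t) = t" if "t \<in> T" for t
  proof -
    have "t \<in> S" using that by (simp add: S_def)
    then have "\<exists>k. k \<le> grid_size T \<and> time_grid T k = t" using mem[of t] by blast
    from someI_ex[OF this] show ?thesis unfolding grid_index_def .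
  qed
  obtain k where k: "k \<le> grid_size T" "time_grid T k = 0" using mem[of 0] by (auto simp: S_def)
  have "0 \<le> time_grid T 0" using mem[of "time_grid T 0"] assms(2) by (auto simp: S_def)
  moreover have "time_grid T 0 \<le> time_grid T k"
    unfolding time_grid using sorted_nth_mono[of ?l 0 k] k(1) len by simp
  ultimately show "time_grid T 0 = 0" using k(2) by simp
qed

text \<open>Independent normal increments determine the law at finitely many times: it is the image
  of a product of normal laws under partial sums. These sums telescope to the path because it starts
  at 0 almost surely.\<close>

lemma (in prob_space) distr_brownian_motion:
  assumes W: "brownian_motion M W" and T: "finite T" "T \<subseteq> {0..}"
  shows "distr M (PiM T (\<lambda>_. borel)) (\<lambda>\<omega>. \<lambda>t\<in>T. W t \<omega>) = brownian_law T"
proof -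
  let ?n = "grid_size T" and ?\<tau> = "time_grid T"
  let ?D = "\<lambda>k \<omega>. W (?\<tau> (Suc k)) \<omega> - W (?\<tau> k) \<omega>"
  let ?N = "\<lambda>k. density lborel (normal_density 0 (sqrt (?\<tau> (Suc k) - ?\<tau> k)))"
  let ?g = "\<lambda>x::nat \<Rightarrow> real. \<lambda>t\<in>T. \<Sum>k<grid_index T t. x k"
  note grid = time_grid_0[OF T] time_grid_less[OF T] grid_size_pos[OF T] grid_index[OF T]
  have grid_mono: "k \<le> ?n \<Longrightarrow> 0 \<le> ?\<tau> k" for k
  proof (induction k)
    case (Suc k)
    then show ?case using grid(2)[of k] by auto
  qed (simp add: grid(1))
  have W_meas [measurable]: "0 \<le> t \<Longrightarrow> W t \<in> borel_measurable M" for t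
    using W unfolding brownian_motion_def by blast
  have D_meas: "?D k \<in> borel_measurable M" if "k < ?n" for k
    using grid_mono[of k] grid_mono[of "Suc k"] that by (intro borel_measurable_diff W_meas) auto
  have indep: "indep_vars (\<lambda>_. borel) ?D {..<?n}"
    using W grid(1,2) unfolding brownian_motion_def by auto
  have D_law: "distr M borel (?D k) = ?N k" if "k < ?n" for k
  proof -
    have "distributed M lborel (?D k) (normal_density 0 (sqrt (?\<tau> (Suc k) - ?\<tau> k)))"
      using W grid(2)[OF that] grid_mono[of k] that unfolding brownian_motion_def by auto
    then have "distr M lborel (?D k) = ?N k" by (simp add: distributed_def)
    moreover have "distr M lborel (?D k) = distr M borel (?D k)" by (rule distr_cong) auto
    ultimately show ?thesis by simp
  qed
  have "distr M (PiM {..<?n} (\<lambda>_. borel)) (\<lambda>\<omega>. \<lambda>k\<in>{..<?n}. ?D k \<omega>) = PiM {..<?n} (\<lambda>k. distr M borel (?D k))"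
    using indep_vars_iff_distr_eq_PiM'[where I = "{..<?n}" and X = ?D and M' = "\<lambda>_. borel"] indep D_meas grid(3) by auto
  also have "\<dots> = PiM {..<?n} ?N" by (rule PiM_cong) (auto simp: D_law)
  finally have law: "distr M (PiM {..<?n} (\<lambda>_. borel)) (\<lambda>\<omega>. \<lambda>k\<in>{..<?n}. ?D k \<omega>) = PiM {..<?n} ?N" .
  have g_meas: "?g \<in> PiM {..<?n} (\<lambda>_. borel) \<rightarrow>\<^sub>M PiM T (\<lambda>_. borel)"
  proof (rule measurable_restrict)
    fix t assume t: "t \<in> T"
    show "(\<lambda>x::nat \<Rightarrow> real. \<Sum>k<grid_index T t. x k) \<in> borel_measurable (PiM {..<?n} (\<lambda>_. borel))"
      by (intro borel_measurable_sum measurable_component_singleton) (use grid(4)[OF t] in auto)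
  qed
  have D_restr: "(\<lambda>\<omega>. \<lambda>k\<in>{..<?n}. ?D k \<omega>) \<in> M \<rightarrow>\<^sub>M PiM {..<?n} (\<lambda>_. borel)"
    by (rule measurable_restrict) (use D_meas in auto)
  have "distr M (PiM T (\<lambda>_. borel)) (\<lambda>\<omega>. \<lambda>t\<in>T. W t \<omega>)
      = distr M (PiM T (\<lambda>_. borel)) (\<lambda>\<omega>. ?g (\<lambda>k\<in>{..<?n}. ?D k \<omega>))"
  proof (rule distr_cong_AE)
    have "AE \<omega> in M. W 0 \<omega> = 0" using W unfolding brownian_motion_def by blast
    then show "AE \<omega> in M. (\<lambda>t\<in>T. W t \<omega>) = ?g (\<lambda>k\<in>{..<?n}. ?D k \<omega>)"
    proof eventually_elim
      case (elim \<omega>)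
      have "W t \<omega> = (\<Sum>k<grid_index T t. (\<lambda>k\<in>{..<?n}. ?D k \<omega>) k)" if "t \<in> T" for t
      proof -
        have "(\<Sum>k<grid_index T t. (\<lambda>k\<in>{..<?n}. ?D k \<omega>) k) = (\<Sum>k<grid_index T t. ?D k \<omega>)"
          by (intro sum.cong) (use grid(4)[OF that] in auto)
        also have "\<dots> = W (?\<tau> (grid_index T t)) \<omega> - W (?\<tau> 0) \<omega>"
          by (rule sum_lessThan_telescope)
        finally show ?thesis using grid(4)[OF that] elim by (simp add: grid(1))
      qed
      then show ?case by auto
    qed
    show "(\<lambda>\<omega>. \<lambda>t\<in>T. W t \<omega>) \<in> M \<rightarrow>\<^sub>M PiM T (\<lambda>_. borel)"
      by (rule measurable_restrict) (use T W_meas in auto)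
    show "(\<lambda>\<omega>. ?g (\<lambda>k\<in>{..<?n}. ?D k \<omega>)) \<in> M \<rightarrow>\<^sub>M PiM T (\<lambda>_. borel)"
      by (rule measurable_compose[OF D_restr g_meas])
  qed auto
  also have "\<dots> = distr (distr M (PiM {..<?n} (\<lambda>_. borel)) (\<lambda>\<omega>. \<lambda>k\<in>{..<?n}. ?D k \<omega>)) (PiM T (\<lambda>_. borel)) ?g"
    by (simp add: distr_distr[OF g_meas D_restr] o_def)
  also have "\<dots> = brownian_law T" unfolding law brownian_law_def by simp
  finally show ?thesis .
qed

abbreviation noise :: "(bond \<Rightarrow> real \<Rightarrow> 'w \<Rightarrow> real) \<Rightarrow> 'w \<Rightarrow> bond \<times> real \<Rightarrow> real" where
  "noise B \<omega> \<equiv> \<lambda>(b, t)\<in>bonds \<times> {0..}. B b t \<omega>"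

lemma independent_brownian_motions_measurable:
  "independent_brownian_motions M bonds B \<Longrightarrow> b \<in> bonds \<Longrightarrow> 0 \<le> t \<Longrightarrow> B b t \<in> borel_measurable M"
  unfolding independent_brownian_motions_def brownian_motion_def by blast

lemma noise_measurable:
  assumes "independent_brownian_motions M bonds B"
  shows "noise B \<in> M \<rightarrow>\<^sub>M noise_space"
proof (rule measurable_restrict)
  show "(\<lambda>\<omega>. case p of (b, t) \<Rightarrow> B b t \<omega>) \<in> borel_measurable M" if "p \<in> bonds \<times> {0..}" for p
    using that independent_brownian_motions_measurable[OF assms] by auto
qed

text \<open>A cylinder splits by bonds into independent events, each about one Brownian motion at
  finitely many times. The resulting formula mentions neither \<open>M\<close> nor
  \<open>B\<close>.\<close>

lemma (in prob_space) prob_noise_cylinder: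
  assumes B: "independent_brownian_motions M bonds B"
    and J: "finite J" "J \<subseteq> bonds \<times> {0..}" and A: "\<And>p. p \<in> J \<Longrightarrow> A p \<in> sets borel"
  shows "emeasure (distr M noise_space (noise B)) (prod_emb (bonds \<times> {0..}) (\<lambda>_. borel) J (Pi\<^sub>E J A))
    = ennreal (\<Prod>b\<in>fst ` J. measure (brownian_law {t. (b, t) \<in> J}) (Pi\<^sub>E {t. (b, t) \<in> J} (\<lambda>t. A (b, t))))"
\<comment> \<open>Independence yields the product formula for nonempty index sets only.\<close>
proof (cases "J = {}")
  case True
  have "prod_emb (bonds \<times> {0..}) (\<lambda>_. borel) {} (Pi\<^sub>E {} A) = space (distr M noise_space (noise B))"
    by (auto simp: prod_emb_def space_PiM PiE_def)
  then show ?thesis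
    using prob_space.emeasure_space_1[OF prob_space_distr[OF noise_measurable[OF B]]] by (simp add: True)
next
  case False
  let ?T = "\<lambda>b. {t. (b, t) \<in> J}"
  let ?Z = "\<lambda>b \<omega>. \<lambda>t\<in>{0..}. B b t \<omega>"
  let ?E = "\<lambda>b. prod_emb {0..} (\<lambda>_. borel) (?T b) (Pi\<^sub>E (?T b) (\<lambda>t. A (b, t)))"
  have T_fin: "finite (?T b)" for b
    using finite_vimageI[OF J(1), of "Pair b"] by (simp add: vimage_def inj_on_def)
  have T_sub: "?T b \<subseteq> {0..}" for b using J(2) by auto
  have E: "?E b \<in> sets (PiM {0..} (\<lambda>_. borel))" for b
    by (rule sets_PiM_I[OF T_fin T_sub]) (use A in auto)
  have eq: "noise B -` prod_emb (bonds \<times> {0..}) (\<lambda>_. borel) J (Pi\<^sub>E J A) \<inter> space M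
      = (\<Inter>b\<in>fst ` J. ?Z b -` ?E b \<inter> space M)"
  proof -
    have "noise B \<omega> \<in> prod_emb (bonds \<times> {0..}) (\<lambda>_. borel) J (Pi\<^sub>E J A) \<longleftrightarrow> (\<forall>p\<in>J. B (fst p) (snd p) \<omega> \<in> A p)" for \<omega>
      unfolding prod_emb_iff restrict_PiE_iff using J(2)
      by (simp add: case_prod_beta subset_iff Ball_def cong: imp_cong)
    moreover have "?Z b \<omega> \<in> ?E b \<longleftrightarrow> (\<forall>t\<in>?T b. B b t \<omega> \<in> A (b, t))" for b \<omega>
      unfolding prod_emb_iff restrict_PiE_iff using T_sub[of b] by (simp add: subset_iff Ball_def cong: imp_cong)
    ultimately show ?thesis using False by (auto simp: vimage_def) (metis fst_conv image_eqI snd_conv)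
  qed
  have "emeasure (distr M noise_space (noise B)) (prod_emb (bonds \<times> {0..}) (\<lambda>_. borel) J (Pi\<^sub>E J A))
      = emeasure M (noise B -` prod_emb (bonds \<times> {0..}) (\<lambda>_. borel) J (Pi\<^sub>E J A) \<inter> space M)"
    by (rule emeasure_distr[OF noise_measurable[OF B]]) (rule sets_PiM_I[OF J(1,2)], use A in auto)
  also have "\<dots> = ennreal (prob (\<Inter>b\<in>fst ` J. ?Z b -` ?E b \<inter> space M))"
    unfolding eq by (rule emeasure_eq_measure)
  also have "prob (\<Inter>b\<in>fst ` J. ?Z b -` ?E b \<inter> space M) = (\<Prod>b\<in>fst ` J. prob (?Z b -` ?E b \<inter> space M))"
  proof (rule indep_varsD[where I = bonds and M' = "\<lambda>_. PiM {0..} (\<lambda>_. borel)"])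
    show "indep_vars (\<lambda>_. PiM {0..} (\<lambda>_. borel)) ?Z bonds"
      using B unfolding independent_brownian_motions_def by blast
  qed (use False J E in auto)
  also have "\<dots> = (\<Prod>b\<in>fst ` J. measure (brownian_law (?T b)) (Pi\<^sub>E (?T b) (\<lambda>t. A (b, t))))"
  proof (rule prod.cong[OF refl])
    fix b assume "b \<in> fst ` J"
    then have b: "b \<in> bonds" using J(2) by auto
    have W: "brownian_motion M (B b)" using B b unfolding independent_brownian_motions_def by blast
    have "?Z b -` ?E b \<inter> space M = (\<lambda>\<omega>. \<lambda>t\<in>?T b. B b t \<omega>) -` (Pi\<^sub>E (?T b) (\<lambda>t. A (b, t))) \<inter> space M"
      unfolding prod_emb_iff restrict_PiE_iff vimage_def using T_sub[of b]
      by (auto simp: prod_emb_iff restrict_PiE_iff)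
    moreover have "(\<lambda>\<omega>. \<lambda>t\<in>?T b. B b t \<omega>) \<in> M \<rightarrow>\<^sub>M PiM (?T b) (\<lambda>_. borel)"
      by (rule measurable_restrict) (use independent_brownian_motions_measurable[OF B b] T_sub[of b] in auto)
    ultimately show "prob (?Z b -` ?E b \<inter> space M) = measure (brownian_law (?T b)) (Pi\<^sub>E (?T b) (\<lambda>t. A (b, t)))"
      unfolding distr_brownian_motion[OF W T_fin T_sub, symmetric]
      by (subst measure_distr) (auto intro!: sets_PiM_I_finite T_fin A)
  qed
  finally show ?thesis .
qed

text \<open>The bridge between probability spaces: it carries expectations of functions of the noise
  from \<open>M\<close> to each \<open>P \<zeta>\<close>, and it also gives translation invariance
  of the noise.\<close>

theorem noise_law_unique:
  assumes "prob_space M" "independent_brownian_motions M bonds B"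
    and "prob_space M'" "independent_brownian_motions M' bonds B'"
  shows "distr M noise_space (noise B) = distr M' noise_space (noise B')"
proof (rule measure_eqI_PiM_infinite)
  interpret prob_space M by fact
  show "finite_measure (distr M noise_space (noise B))"
    by (rule prob_space.finite_measure[OF prob_space_distr[OF noise_measurable[OF assms(2)]]])
next
  fix A :: "bond \<times> real \<Rightarrow> real set" and J :: "(bond \<times> real) set"
  assume "finite J" "J \<subseteq> bonds \<times> {0..}" "\<And>p. p \<in> J \<Longrightarrow> A p \<in> sets borel"
  then show "emeasure (distr M noise_space (noise B)) (prod_emb (bonds \<times> {0..}) (\<lambda>_. borel) J (Pi\<^sub>E J A))
    = emeasure (distr M' noise_space (noise B')) (prod_emb (bonds \<times> {0..}) (\<lambda>_. borel) J (Pi\<^sub>E J A))"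
    using prob_space.prob_noise_cylinder[OF assms(1,2)] prob_space.prob_noise_cylinder[OF assms(3,4)] by simp
qed auto

section \<open>Translates of the Gibbs measure\<close>

context potential
begin

text \<open>Uniform convexity: after subtracting the tangent at 0 and
  \<open>Cmin / 2 * x\<^sup>2\<close>, the derivative is nondecreasing and vanishes at 0, so 0 is a
  minimum.\<close>

lemma V_lower_bound: "V 0 + deriv V 0 * x + Cmin / 2 * x\<^sup>2 \<le> V x"
proof -
  define g where "g y = V y - V 0 - deriv V 0 * y - Cmin / 2 * y\<^sup>2" for y
  define g' where "g' y = deriv V y - deriv V 0 - Cmin * y" for y
  have g: "(g has_real_derivative g' y) (at y)" for y
    unfolding g_def g'_def by (auto intro!: derivative_eq_intros V_DERIV)
  have g'_mono: "g' y \<le> g' z" if "y \<le> z" for y z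
  proof (rule DERIV_nonneg_imp_nondecreasing[OF that])
    fix x
    have "(g' has_real_derivative (deriv (deriv V) x - Cmin)) (at x)"
      unfolding g'_def by (auto intro!: derivative_eq_intros V'_DERIV)
    then show "\<exists>D. (g' has_real_derivative D) (at x) \<and> 0 \<le> D" using V''_ge[of x] by (intro exI conjI) auto
  qed
  have g'0: "g' 0 = 0" by (simp add: g'_def)
  have "g 0 \<le> g x"
  proof (cases "0 \<le> x")
    case True
    show ?thesis
      by (rule DERIV_nonneg_imp_nondecreasing[OF True]) (use g g'_mono g'0 in metis)
  next
    case False
    then have "x \<le> 0" by simp
    then show ?thesis
      by (rule DERIV_nonpos_imp_nonincreasing) (use g g'_mono g'0 in metis)
  qed
  then show ?thesis by (simp add: g_def)
qed

text \<open>Gaussian domination. Half of the quadratic lower bound of \<open>V\<close> absorbs all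
  linear terms by completing a square; the other half is the exponent of a normal density of
  variance 2/Cmin.\<close>

lemma integrable_exp_weight: "integrable lborel (\<lambda>x. exp (c * \<bar>x\<bar>) * exp (- V x + l * x))"
proof -
  define \<sigma> where "\<sigma> = sqrt (2 / Cmin)"
  have \<sigma>: "0 < \<sigma>" "\<sigma>\<^sup>2 = 2 / Cmin" using Cmin_pos by (auto simp: \<sigma>_def)
  define m where "m = \<bar>c\<bar> + \<bar>deriv V 0\<bar> + \<bar>l\<bar>"
  define K where "K = exp (m\<^sup>2 / Cmin - V 0) * sqrt (2 * pi * \<sigma>\<^sup>2)"
  show ?thesis
  proof (rule Bochner_Integration.integrable_bound)
    show "integrable lborel (\<lambda>x. K * normal_density 0 \<sigma> x)"
      using integrable_normal_density[OF \<sigma>(1), of 0] by simp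
    show "AE x in lborel. norm (exp (c * \<bar>x\<bar>) * exp (- V x + l * x)) \<le> norm (K * normal_density 0 \<sigma> x)"
    proof (rule AE_I2)
      fix x :: real
      have 1: "c * \<bar>x\<bar> - deriv V 0 * x + l * x \<le> m * \<bar>x\<bar>"
      proof -
        have "c * \<bar>x\<bar> \<le> \<bar>c\<bar> * \<bar>x\<bar>" "- deriv V 0 * x \<le> \<bar>deriv V 0\<bar> * \<bar>x\<bar>" "l * x \<le> \<bar>l\<bar> * \<bar>x\<bar>"
          using abs_ge_self[of "- deriv V 0 * x"] abs_ge_self[of "l * x"]
          by (auto simp: abs_mult intro: mult_right_mono)
        then show ?thesis by (simp add: m_def algebra_simps)
      qed
      have "0 \<le> (m / sqrt Cmin - sqrt Cmin * \<bar>x\<bar> / 2)\<^sup>2" by simp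
      also have "\<dots> = m\<^sup>2 / Cmin - m * \<bar>x\<bar> + Cmin * x\<^sup>2 / 4"
        using Cmin_pos by (simp add: power2_diff power_divide power_mult_distrib)
      finally have 2: "m * \<bar>x\<bar> \<le> m\<^sup>2 / Cmin + Cmin * x\<^sup>2 / 4" by simp
      have "c * \<bar>x\<bar> + (- V x + l * x) \<le> m\<^sup>2 / Cmin - V 0 - Cmin * x\<^sup>2 / 4"
        using V_lower_bound[of x] 1 2 by simp
      then have "exp (c * \<bar>x\<bar>) * exp (- V x + l * x) \<le> exp (m\<^sup>2 / Cmin - V 0 - Cmin * x\<^sup>2 / 4)"
        by (simp flip: exp_add)
      also have "\<dots> = exp (m\<^sup>2 / Cmin - V 0) * exp (- (x - 0)\<^sup>2 / (2 * \<sigma>\<^sup>2))"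
        using Cmin_pos by (simp add: \<sigma>(2) field_simps flip: exp_add)
      also have "\<dots> = K * normal_density 0 \<sigma> x"
        using \<sigma>(1) by (simp add: K_def normal_density_def)
      finally show "norm (exp (c * \<bar>x\<bar>) * exp (- V x + l * x)) \<le> norm (K * normal_density 0 \<sigma> x)"
        by (simp add: abs_mult K_def)
    qed
  qed measurable
qed

definition partition_function :: "real \<Rightarrow> real" where
  "partition_function l = (\<integral>y. exp (- V y + l * y) \<partial>lborel)"

lemma integrable_gibbs: "integrable lborel (\<lambda>x. exp (- V x + l * x))"
  using integrable_exp_weight[of 0 l] by simp

lemma partition_function_pos: "0 < partition_function l"
proof -
  have "partition_function l \<noteq> 0"
  proof
    assume "partition_function l = 0"
    then have "AE x in lborel. exp (- V x + l * x) = 0"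
      using integral_nonneg_eq_0_iff_AE[OF integrable_gibbs[of l]] by (simp add: partition_function_def)
    then have "AE x in (lborel :: real measure). False" by simp
    then show False by (simp add: eventually_False ae_filter_eq_bot_iff)
  qed
  moreover have "0 \<le> partition_function l" unfolding partition_function_def by simp
  ultimately show ?thesis by simp
qed

lemma site_measure_eq:
  "site_measure V l = density lborel (\<lambda>x. ennreal (exp (- V x + l * x) / partition_function l))"
  by (simp add: site_measure_def partition_function_def)

lemma sets_site_measure [simp, measurable_cong]: "sets (site_measure V l) = sets borel"
  and space_site_measure [simp]: "space (site_measure V l) = UNIV"
  by (simp_all add: site_measure_def)

lemma site_measure_prob_space: "prob_space (site_measure V l)"
proof
  have "emeasure (site_measure V l) (space (site_measure V l))
      = (\<integral>\<^sup>+x. ennreal (exp (- V x + l * x) / partition_function l) \<partial>lborel)"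
    unfolding site_measure_eq by (simp add: emeasure_density)
  also have "\<dots> = ennreal (\<integral>x. exp (- V x + l * x) / partition_function l \<partial>lborel)"
    using integrable_gibbs[of l] partition_function_pos[of l]
    by (intro nn_integral_eq_integral) (auto intro: less_imp_le)
  also have "\<dots> = 1"
    using partition_function_pos[of l] by (simp add: partition_function_def)
  finally show "emeasure (site_measure V l) (space (site_measure V l)) = 1" .
qed

lemma site_measure_exp_integrable: "integrable (site_measure V l) (\<lambda>x. exp (c * \<bar>x\<bar>))"
  unfolding site_measure_eq
  using integrable_exp_weight[of c l] partition_function_pos[of l]
  by (subst integrable_density) (auto simp: less_imp_le mult.commute)

text \<open>The Radon-Nikodym density of the site measure translated by \<open>\<epsilon>\<close>
  with respect to the original one.\<close>

definition tilt :: "real \<Rightarrow> real \<Rightarrow> real \<Rightarrow> real" where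
  "tilt l \<epsilon> x = exp (V x - V (x - \<epsilon>) - l * \<epsilon>)"

lemma tilt_measurable [measurable]: "tilt l \<epsilon> \<in> borel_measurable borel"
  unfolding tilt_def by measurable

lemma site_measure_shift:
  "distr (site_measure V l) borel (\<lambda>x. x + \<epsilon>) = density (site_measure V l) (\<lambda>x. ennreal (tilt l \<epsilon> x))"
proof -
  let ?p = "\<lambda>x. exp (- V x + l * x) / partition_function l"
  have p_nonneg: "0 \<le> ?p x" for x using partition_function_pos[of l] by simp
  have "distr (site_measure V l) borel (\<lambda>x. \<epsilon> + x)
      = distr (density lborel (\<lambda>x. ennreal (?p ((\<epsilon> + x) - \<epsilon>)))) borel (\<lambda>x. \<epsilon> + x)"
    by (simp add: site_measure_eq)
  also have "\<dots> = density (distr lborel borel (\<lambda>x. \<epsilon> + x)) (\<lambda>x. ennreal (?p (x - \<epsilon>)))"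
    by (rule density_distr[symmetric]) measurable
  also have "\<dots> = density lborel (\<lambda>x. ennreal (?p (x - \<epsilon>)))"
    by (simp add: lborel_distr_plus)
  also have "\<dots> = density lborel (\<lambda>x. ennreal (?p x) * ennreal (tilt l \<epsilon> x))"
  proof (rule density_cong)
    have "exp (- V (x - \<epsilon>) + l * (x - \<epsilon>)) = exp (- V x + l * x) * tilt l \<epsilon> x" for x
      by (simp add: tilt_def algebra_simps flip: exp_add)
    then show "AE x in lborel. ennreal (?p (x - \<epsilon>)) = ennreal (?p x) * ennreal (tilt l \<epsilon> x)"
      using p_nonneg by (simp flip: ennreal_mult' add: tilt_def)
  qed measurable
  also have "\<dots> = density (site_measure V l) (\<lambda>x. ennreal (tilt l \<epsilon> x))"
    unfolding site_measure_eq by (subst density_density_eq) auto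
  finally show ?thesis by (simp add: add.commute)
qed

text \<open>The square of exp m, where m = |V'(0)| + C + |l| + C|x| bounds the slope of the exponent
  of \<open>tilt\<close> for translations of length at most 1.\<close>

definition tilt_weight :: "real \<Rightarrow> real \<Rightarrow> real" where
  "tilt_weight l x = exp (2 * (\<bar>deriv V 0\<bar> + C + \<bar>l\<bar>) + 2 * C * \<bar>x\<bar>)"

lemma tilt_weight_ge_1: "1 \<le> tilt_weight l x"
  using C_pos by (simp add: tilt_weight_def)

lemma tilt_weight_measurable [measurable]: "tilt_weight l \<in> borel_measurable borel"
  unfolding tilt_weight_def by measurable

text \<open>By the mean value theorem the exponent \<open>y\<close> of the tilt is at most
  |\<epsilon>| m in absolute value. Then |exp y - 1| \<le> |y| exp |y| produces one factor exp m,
  and m \<le> exp m the other.\<close>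

lemma abs_tilt_minus_1_le:
  assumes "\<bar>\<epsilon>\<bar> \<le> 1"
  shows "\<bar>tilt l \<epsilon> x - 1\<bar> \<le> \<bar>\<epsilon>\<bar> * tilt_weight l x"
proof -
  define m where "m = \<bar>deriv V 0\<bar> + C + \<bar>l\<bar> + C * \<bar>x\<bar>"
  have m: "0 \<le> m" using C_pos by (simp add: m_def)
  define y where "y = V x - V (x - \<epsilon>) - l * \<epsilon>"
  have "\<bar>V x - V (x - \<epsilon>)\<bar> \<le> (\<bar>deriv V 0\<bar> + C + C * \<bar>x\<bar>) * \<bar>x - (x - \<epsilon>)\<bar>"
  proof (rule field_differentiable_bound[of "closed_segment (x - \<epsilon>) x" V "deriv V", simplified real_norm_def])
    show "convex (closed_segment (x - \<epsilon>) x)" by (rule convex_closed_segment)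
    fix z assume z: "z \<in> closed_segment (x - \<epsilon>) x"
    show "(V has_field_derivative deriv V z) (at z within closed_segment (x - \<epsilon>) x)"
      by (rule DERIV_subset[OF V_DERIV]) simp
    have "\<bar>z\<bar> \<le> \<bar>x\<bar> + 1"
      using z assms by (auto simp: closed_segment_eq_real_ivl split: if_splits)
    then have "C * \<bar>z\<bar> \<le> C * (\<bar>x\<bar> + 1)" using C_pos by (intro mult_left_mono) auto
    then show "\<bar>deriv V z\<bar> \<le> \<bar>deriv V 0\<bar> + C + C * \<bar>x\<bar>"
      using V'_lipschitz[of z 0] by (simp add: algebra_simps)
  qed auto
  then have "\<bar>V x - V (x - \<epsilon>)\<bar> \<le> \<bar>\<epsilon>\<bar> * (\<bar>deriv V 0\<bar> + C + C * \<bar>x\<bar>)" by (simp add: mult.commute)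
  then have "\<bar>y\<bar> \<le> \<bar>\<epsilon>\<bar> * (\<bar>deriv V 0\<bar> + C + C * \<bar>x\<bar>) + \<bar>\<epsilon>\<bar> * \<bar>l\<bar>"
    unfolding y_def using abs_triangle_ineq4[of "V x - V (x - \<epsilon>)" "l * \<epsilon>"] by (simp add: abs_mult mult.commute)
  then have y: "\<bar>y\<bar> \<le> \<bar>\<epsilon>\<bar> * m" by (simp add: m_def algebra_simps)
  then have y': "\<bar>y\<bar> \<le> m" using mult_right_mono[OF assms m] by simp
  have "\<bar>exp y - 1\<bar> \<le> \<bar>y\<bar> * exp \<bar>y\<bar>"
  proof (cases "0 \<le> y")
    case True
    have "1 - y \<le> exp (- y)" using exp_ge_add_one_self[of "- y"] by simp
    from mult_right_mono[OF this, of "exp y"] have "exp y - y * exp y \<le> 1"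
      by (simp add: algebra_simps flip: exp_add)
    then show ?thesis using True by simp
  next
    case False
    have "1 + y \<le> exp y" by (rule exp_ge_add_one_self)
    moreover have "- y * 1 \<le> - y * exp (- y)" using False by (intro mult_left_mono) auto
    ultimately have "1 - exp y \<le> - y * exp (- y)" by linarith
    then show ?thesis using False by simp
  qed
  also have "\<dots> \<le> (\<bar>\<epsilon>\<bar> * m) * exp m" using y y' m by (intro mult_mono) auto
  also have "\<dots> \<le> \<bar>\<epsilon>\<bar> * (exp m * exp m)"
  proof -
    have "m \<le> exp m" using exp_ge_add_one_self[of m] by linarith
    then show ?thesis unfolding mult.assoc by (intro mult_left_mono mult_right_mono) auto
  qed
  also have "exp m * exp m = tilt_weight l x"
    by (simp add: tilt_weight_def m_def algebra_simps flip: exp_add)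
  finally show ?thesis by (simp add: tilt_def y_def)
qed

text \<open>The limit is minus the logarithmic derivative of the site density, the factor that
  integration by parts produces.\<close>

lemma tilt_difference_quotient:
  assumes "\<epsilon> \<longlonglongrightarrow> 0" "\<And>m::nat. \<epsilon> m \<noteq> 0"
  shows "(\<lambda>m. (tilt l (\<epsilon> m) x - 1) / \<epsilon> m) \<longlonglongrightarrow> deriv V x - l"
proof -
  have "((\<lambda>e. V (x - e)) has_real_derivative - deriv V x) (at 0)"
  proof -
    have "((\<lambda>e. x - e) has_real_derivative -1) (at 0)" by (auto intro!: derivative_eq_intros)
    from DERIV_chain2[OF _ this, of V "deriv V x"] show ?thesis using V_DERIV[of x] by simp
  qed
  then have "((\<lambda>e. tilt l e x) has_real_derivative deriv V x - l) (at 0)"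
    unfolding tilt_def by (auto intro!: derivative_eq_intros)
  then have "(\<lambda>e. (tilt l e x - 1) / e) \<midarrow>0\<rightarrow> deriv V x - l"
    unfolding has_field_derivative_iff by (simp add: tilt_def)
  moreover have "filterlim \<epsilon> (at 0) sequentially"
    using assms by (intro filterlim_atI) auto
  ultimately show ?thesis by (rule filterlim_compose)
qed

section \<open>The product measure and the translation of one coordinate\<close>

definition gibbs :: "real \<Rightarrow> config measure" where
  "gibbs l = PiM UNIV (\<lambda>_. site_measure V l)"

lemma sets_gibbs [simp, measurable_cong]: "sets (gibbs l) = sets config_space"
  unfolding gibbs_def by (rule sets_PiM_cong) auto

lemma space_gibbs [simp]: "space (gibbs l) = UNIV"
  unfolding gibbs_def by (auto simp: space_PiM)

lemma gibbs_prob_space: "prob_space (gibbs l)"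
  unfolding gibbs_def by (intro prob_space_PiM site_measure_prob_space)

lemma gibbs_component: "distr (gibbs l) borel (\<lambda>\<zeta>. \<zeta> k) = site_measure V l"
proof -
  interpret product_prob_space "\<lambda>_::int. site_measure V l" UNIV
    by (intro product_prob_spaceI site_measure_prob_space)
  have "distr (gibbs l) (site_measure V l) (\<lambda>\<zeta>. \<zeta> k) = site_measure V l"
    unfolding gibbs_def by (rule PiM_component) simp
  moreover have "distr (gibbs l) (site_measure V l) (\<lambda>\<zeta>. \<zeta> k) = distr (gibbs l) borel (\<lambda>\<zeta>. \<zeta> k)"
    by (rule distr_cong) auto
  ultimately show ?thesis by simp
qed

text \<open>The measure is split into site \<open>k\<close> and the remaining sites; the translation
  acts on the first factor, where \<open>site_measure_shift\<close> applies, and the parts are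
  joined again.\<close>

lemma gibbs_site_shift:
  "distr (gibbs l) config_space (\<lambda>\<zeta> j. \<zeta> j + \<epsilon> * site_unit k j)
    = density (gibbs l) (\<lambda>\<zeta>. ennreal (tilt l \<epsilon> (\<zeta> k)))"
proof -
  let ?S = "site_measure V l"
  let ?Q = "PiM (UNIV - {k}) (\<lambda>_. ?S)"
  let ?up = "\<lambda>(x, \<zeta>). \<zeta>(k := x)"
  let ?sh = "\<lambda>(x, \<zeta>). (x + \<epsilon>, \<zeta>)"
  interpret S: prob_space ?S by (rule site_measure_prob_space)
  interpret Q: prob_space ?Q by (intro prob_space_PiM site_measure_prob_space)
  have dQ: "distr ?Q ?Q (\<lambda>\<zeta>. \<zeta>) = ?Q" by (rule distr_id)
  have ins: "insert k (UNIV - {k}) = UNIV" by auto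
  have up [measurable]: "?up \<in> ?S \<Otimes>\<^sub>M ?Q \<rightarrow>\<^sub>M gibbs l"
    unfolding gibbs_def split_beta'
  proof (rule measurable_PiM_single')
    show "(\<lambda>p. ((snd p)(k := fst p)) j) \<in> ?S \<Otimes>\<^sub>M ?Q \<rightarrow>\<^sub>M ?S" for j
    proof (cases "j = k")
      case False
      then show ?thesis
        using measurable_compose[OF measurable_snd measurable_component_singleton[of j "UNIV - {k}" "\<lambda>_. ?S"]] by simp
    qed simp
  qed auto
  have gibbs_eq: "gibbs l = distr (?S \<Otimes>\<^sub>M ?Q) (gibbs l) ?up"
    using distr_pair_PiM_eq_PiM[of "UNIV - {k}" "\<lambda>_. ?S" k] site_measure_prob_space
    by (simp add: gibbs_def ins)
  have shift: "(\<lambda>\<zeta> j. \<zeta> j + \<epsilon> * site_unit k j) \<in> gibbs l \<rightarrow>\<^sub>M gibbs l"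
    unfolding gibbs_def
  proof (rule measurable_PiM_single')
    show "(\<lambda>\<zeta>. \<zeta> j + \<epsilon> * site_unit k j) \<in> Pi\<^sub>M UNIV (\<lambda>_. ?S) \<rightarrow>\<^sub>M ?S" for j
      by measurable
  qed auto
  have sh [measurable]: "?sh \<in> ?S \<Otimes>\<^sub>M ?Q \<rightarrow>\<^sub>M ?S \<Otimes>\<^sub>M ?Q"
    unfolding split_beta' by measurable
  have "distr (gibbs l) config_space (\<lambda>\<zeta> j. \<zeta> j + \<epsilon> * site_unit k j)
      = distr (gibbs l) (gibbs l) (\<lambda>\<zeta> j. \<zeta> j + \<epsilon> * site_unit k j)"
    by (rule distr_cong) auto
  also have "\<dots> = distr (?S \<Otimes>\<^sub>M ?Q) (gibbs l) ((\<lambda>\<zeta> j. \<zeta> j + \<epsilon> * site_unit k j) \<circ> ?up)"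
    by (subst gibbs_eq) (rule distr_distr[OF shift up])
  also have "(\<lambda>\<zeta> j. \<zeta> j + \<epsilon> * site_unit k j) \<circ> ?up = ?up \<circ> ?sh"
    by (auto simp: fun_eq_iff site_unit_def)
  also have "distr (?S \<Otimes>\<^sub>M ?Q) (gibbs l) (?up \<circ> ?sh) = distr (distr (?S \<Otimes>\<^sub>M ?Q) (?S \<Otimes>\<^sub>M ?Q) ?sh) (gibbs l) ?up"
    by (rule distr_distr[symmetric, OF up sh])
  also have "distr (?S \<Otimes>\<^sub>M ?Q) (?S \<Otimes>\<^sub>M ?Q) ?sh = distr ?S ?S (\<lambda>x. x + \<epsilon>) \<Otimes>\<^sub>M distr ?Q ?Q (\<lambda>\<zeta>. \<zeta>)"
  proof (rule pair_measure_distr[symmetric])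
    show "sigma_finite_measure (distr ?Q ?Q (\<lambda>\<zeta>. \<zeta>))"
      unfolding dQ by (rule Q.sigma_finite_measure)
    show "(\<lambda>x. x + \<epsilon>) \<in> ?S \<rightarrow>\<^sub>M ?S"
      by (subst measurable_cong_sets[OF sets_site_measure sets_site_measure]) (intro borel_measurable_add measurable_id borel_measurable_const)
    show "(\<lambda>\<zeta>. \<zeta>) \<in> ?Q \<rightarrow>\<^sub>M ?Q" by (rule measurable_ident_sets[OF refl])
  qed
  also have "distr ?S ?S (\<lambda>x. x + \<epsilon>) = density ?S (\<lambda>x. ennreal (tilt l \<epsilon> x))"
    unfolding site_measure_shift[symmetric] by (rule distr_cong) auto
  \<comment> \<open>The untouched factor is written with density 1, so that the rule for products of
    densities applies.\<close>
  also have "density ?S (\<lambda>x. ennreal (tilt l \<epsilon> x)) \<Otimes>\<^sub>M distr ?Q ?Q (\<lambda>\<zeta>. \<zeta>)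
      = density ?S (\<lambda>x. ennreal (tilt l \<epsilon> x)) \<Otimes>\<^sub>M density ?Q (\<lambda>_. 1)"
    by (simp only: dQ density_1)
  also have "\<dots> = density (?S \<Otimes>\<^sub>M ?Q) (\<lambda>(x, \<zeta>). ennreal (tilt l \<epsilon> x) * 1)"
  proof (rule pair_measure_density)
    show "sigma_finite_measure (density ?Q (\<lambda>_. 1))"
      unfolding density_1 by (rule Q.sigma_finite_measure)
    show "(\<lambda>x. ennreal (tilt l \<epsilon> x)) \<in> borel_measurable ?S" by simp
    show "(\<lambda>_. 1) \<in> borel_measurable ?Q" by (rule measurable_const) simp
    show "sigma_finite_measure ?Q" by (rule Q.sigma_finite_measure)
  qed
  also have "(\<lambda>(x, \<zeta>). ennreal (tilt l \<epsilon> x) * 1) = (\<lambda>z. ennreal (tilt l \<epsilon> ((?up z) k)))"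
    by auto
  also have "distr (density (?S \<Otimes>\<^sub>M ?Q) (\<lambda>z. ennreal (tilt l \<epsilon> ((?up z) k)))) (gibbs l) ?up
      = density (distr (?S \<Otimes>\<^sub>M ?Q) (gibbs l) ?up) (\<lambda>\<zeta>. ennreal (tilt l \<epsilon> (\<zeta> k)))"
    by (rule density_distr[symmetric, OF _ up]) measurable
  also have "\<dots> = density (gibbs l) (\<lambda>\<zeta>. ennreal (tilt l \<epsilon> (\<zeta> k)))"
    by (simp only: gibbs_eq[symmetric])
  finally show ?thesis .
qed

end

section \<open>Integration by parts and moments\<close>

lemma brownian_motion_second_moment:
  assumes "prob_space M" "brownian_motion M W" "0 \<le> s"
  shows "integrable M (\<lambda>\<omega>. (W s \<omega>)\<^sup>2)" "(\<integral>\<omega>. (W s \<omega>)\<^sup>2 \<partial>M) = s"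
proof -
  interpret prob_space M by fact
  have [measurable]: "0 \<le> u \<Longrightarrow> W u \<in> borel_measurable M" for u
    using assms unfolding brownian_motion_def by blast
  have W0: "AE \<omega> in M. W 0 \<omega> = 0" using assms unfolding brownian_motion_def by blast
  have "integrable M (\<lambda>\<omega>. (W s \<omega> - W 0 \<omega>)\<^sup>2) \<and> (\<integral>\<omega>. (W s \<omega> - W 0 \<omega>)\<^sup>2 \<partial>M) = s"
  \<comment> \<open>At time 0 the increment is 0 and has no density.\<close>
  proof (cases "s = 0")
    case False
    then have s: "0 < s" using assms by simp
    then have d: "distributed M lborel (\<lambda>\<omega>. W s \<omega> - W 0 \<omega>) (normal_density 0 (sqrt s))"
      using assms unfolding brownian_motion_def by fastforce
    have m: "has_bochner_integral lborel (\<lambda>x. normal_density 0 (sqrt s) x * x\<^sup>2) s"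
      using normal_moment_even[of "sqrt s" 0 1] s by (simp add: power2_eq_square)
    show ?thesis
      using distributed_integrable[OF d, of "\<lambda>x. x\<^sup>2"] distributed_integral[OF d, of "\<lambda>x. x\<^sup>2"]
        m[unfolded has_bochner_integral_iff] s by simp
  qed simp
  moreover have "AE \<omega> in M. (W s \<omega> - W 0 \<omega>)\<^sup>2 = (W s \<omega>)\<^sup>2"
    using W0 by eventually_elim simp
  ultimately show "integrable M (\<lambda>\<omega>. (W s \<omega>)\<^sup>2)" "(\<integral>\<omega>. (W s \<omega>)\<^sup>2 \<partial>M) = s"
    using integrable_cong_AE[of "\<lambda>\<omega>. (W s \<omega> - W 0 \<omega>)\<^sup>2" M "\<lambda>\<omega>. (W s \<omega>)\<^sup>2"]
      integral_cong_AE[of "\<lambda>\<omega>. (W s \<omega> - W 0 \<omega>)\<^sup>2" M "\<lambda>\<omega>. (W s \<omega>)\<^sup>2"] assms(3) by auto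
qed

lemma abs_mult_le_sum_squares: "\<bar>a * b\<bar> \<le> a\<^sup>2 + (b::real)\<^sup>2"
proof -
  have "0 \<le> (\<bar>a\<bar> - \<bar>b\<bar>)\<^sup>2" by simp
  then have "2 * \<bar>a\<bar> * \<bar>b\<bar> \<le> a\<^sup>2 + b\<^sup>2" by (simp add: power2_diff)
  moreover have "0 \<le> \<bar>a\<bar> * \<bar>b\<bar>" by simp
  ultimately show ?thesis unfolding abs_mult by linarith
qed

text \<open>Integrability and bound are kept together: the integral of a non-integrable function is
  0 by convention, so the bound alone would say nothing.\<close>

definition L1_bounded :: "'a measure \<Rightarrow> ('a \<Rightarrow> real) \<Rightarrow> real \<Rightarrow> bool" where
  "L1_bounded M f K \<longleftrightarrow> integrable M f \<and> (\<integral>x. \<bar>f x\<bar> \<partial>M) \<le> K"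

lemma L1_bounded_mono:
  assumes "L1_bounded M h K" "f \<in> borel_measurable M" "\<And>x. \<bar>f x\<bar> \<le> \<bar>h x\<bar>"
  shows "L1_bounded M f K"
proof -
  have f: "integrable M f"
    using assms unfolding L1_bounded_def by (intro Bochner_Integration.integrable_bound[of M h f]) auto
  have "(\<integral>x. \<bar>f x\<bar> \<partial>M) \<le> (\<integral>x. \<bar>h x\<bar> \<partial>M)"
    using assms f unfolding L1_bounded_def by (intro integral_mono integrable_abs) auto
  then show ?thesis using assms(1) f unfolding L1_bounded_def by linarith
qed

lemma L1_bounded_abs: "L1_bounded M f K \<Longrightarrow> L1_bounded M (\<lambda>x. \<bar>f x\<bar>) K"
  unfolding L1_bounded_def by simp

lemma L1_bounded_cmult: "L1_bounded M f K \<Longrightarrow> L1_bounded M (\<lambda>x. c * f x) (\<bar>c\<bar> * K)"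
  unfolding L1_bounded_def by (auto simp: abs_mult intro: mult_left_mono)

lemma L1_bounded_add:
  assumes "L1_bounded M f K" "L1_bounded M h L"
  shows "L1_bounded M (\<lambda>x. f x + h x) (K + L)"
proof -
  have "(\<integral>x. \<bar>f x + h x\<bar> \<partial>M) \<le> (\<integral>x. \<bar>f x\<bar> + \<bar>h x\<bar> \<partial>M)"
    using assms unfolding L1_bounded_def by (intro integral_mono) auto
  then show ?thesis using assms unfolding L1_bounded_def by simp
qed

lemma L1_bounded_diff:
  "L1_bounded M f K \<Longrightarrow> L1_bounded M h L \<Longrightarrow> L1_bounded M (\<lambda>x. f x - h x) (K + L)"
  using L1_bounded_add[of M f K "\<lambda>x. (-1) * h x" L] L1_bounded_cmult[of M h L "-1"] by simp

lemma L1_bounded_mult_of_squares: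
  fixes f g :: "'a \<Rightarrow> real"
  assumes "f \<in> borel_measurable M" "g \<in> borel_measurable M"
    and "integrable M (\<lambda>x. (f x)\<^sup>2)" "integrable M (\<lambda>x. (g x)\<^sup>2)"
  shows "L1_bounded M (\<lambda>x. f x * g x) ((\<integral>x. (f x)\<^sup>2 \<partial>M) + (\<integral>x. (g x)\<^sup>2 \<partial>M))"
proof (rule L1_bounded_mono)
  show "L1_bounded M (\<lambda>x. (f x)\<^sup>2 + (g x)\<^sup>2) ((\<integral>x. (f x)\<^sup>2 \<partial>M) + (\<integral>x. (g x)\<^sup>2 \<partial>M))"
    using assms by (simp add: L1_bounded_def)
  show "\<bar>f x * g x\<bar> \<le> \<bar>(f x)\<^sup>2 + (g x)\<^sup>2\<bar>" for x
    using abs_mult_le_sum_squares[of "f x" "g x"] by linarith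
qed (use assms in simp)

context potential
begin

lemma site_measure_second_moment: "integrable (site_measure V l) (\<lambda>x. x\<^sup>2)"
proof (rule Bochner_Integration.integrable_bound[OF site_measure_exp_integrable[of l 2]])
  have "x\<^sup>2 \<le> exp (2 * \<bar>x\<bar>)" for x :: real
  proof -
    have "\<bar>x\<bar> \<le> exp \<bar>x\<bar>" using exp_ge_add_one_self[of "\<bar>x\<bar>"] by linarith
    then have "\<bar>x\<bar>\<^sup>2 \<le> (exp \<bar>x\<bar>)\<^sup>2" by (intro power_mono) auto
    then show ?thesis by (simp add: exp_double)
  qed
  then show "AE x in site_measure V l. norm (x\<^sup>2) \<le> norm (exp (2 * \<bar>x\<bar>))" by simp
qed simp

lemma tilt_weight_integrable: "integrable (site_measure V l) (tilt_weight l)"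
  "integrable (site_measure V l) (\<lambda>x. (tilt_weight l x)\<^sup>2)"
proof -
  let ?a = "exp (2 * (\<bar>deriv V 0\<bar> + C + \<bar>l\<bar>))"
  have eq: "tilt_weight l x = ?a * exp (2 * C * \<bar>x\<bar>)" "(tilt_weight l x)\<^sup>2 = ?a\<^sup>2 * exp (4 * C * \<bar>x\<bar>)" for x
    by (simp_all add: tilt_weight_def exp_add power_mult_distrib flip: exp_double)
  show "integrable (site_measure V l) (tilt_weight l)"
    unfolding eq(1)[abs_def] using site_measure_exp_integrable[of l "2 * C"] by simp
  show "integrable (site_measure V l) (\<lambda>x. (tilt_weight l x)\<^sup>2)"
    unfolding eq(2) using site_measure_exp_integrable[of l "4 * C"] by simp
qed

lemma gibbs_integral_component:
  fixes f :: "real \<Rightarrow> real"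
  assumes [measurable]: "f \<in> borel_measurable borel"
  shows "integrable (gibbs l) (\<lambda>\<zeta>. f (\<zeta> k)) \<longleftrightarrow> integrable (site_measure V l) f"
    "(\<integral>\<zeta>. f (\<zeta> k) \<partial>gibbs l) = (\<integral>x. f x \<partial>site_measure V l)"
  unfolding gibbs_component[of l k, symmetric]
  by (subst integrable_distr_eq; simp)+ (subst integral_distr; simp)

lemma joint_site_shift:
  assumes N: "prob_space N" "sets N = sets noise_space"
  shows "distr (gibbs l \<Otimes>\<^sub>M N) (config_space \<Otimes>\<^sub>M noise_space) (\<lambda>(\<zeta>, \<beta>). (\<lambda>j. \<zeta> j + \<epsilon> * site_unit k j, \<beta>))
    = density (gibbs l \<Otimes>\<^sub>M N) (\<lambda>(\<zeta>, \<beta>). ennreal (tilt l \<epsilon> (\<zeta> k)))"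
proof -
  interpret N: prob_space N by fact
  have idN: "distr N noise_space (\<lambda>\<beta>. \<beta>) = N" by (rule distr_id2[OF N(2)[symmetric]])
  have shift: "(\<lambda>\<zeta> j. \<zeta> j + \<epsilon> * site_unit k j) \<in> gibbs l \<rightarrow>\<^sub>M config_space"
  proof (rule measurable_PiM_single')
    show "(\<lambda>\<zeta>. \<zeta> j + \<epsilon> * site_unit k j) \<in> borel_measurable (gibbs l)" for j by measurable
  qed auto
  have "distr (gibbs l \<Otimes>\<^sub>M N) (config_space \<Otimes>\<^sub>M noise_space) (\<lambda>(\<zeta>, \<beta>). (\<lambda>j. \<zeta> j + \<epsilon> * site_unit k j, \<beta>))
    = distr (gibbs l) config_space (\<lambda>\<zeta> j. \<zeta> j + \<epsilon> * site_unit k j) \<Otimes>\<^sub>M distr N noise_space (\<lambda>\<beta>. \<beta>)"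
  proof (rule pair_measure_distr[symmetric, OF shift])
    show "(\<lambda>\<beta>. \<beta>) \<in> N \<rightarrow>\<^sub>M noise_space" by (rule measurable_ident_sets[OF N(2)])
    show "sigma_finite_measure (distr N noise_space (\<lambda>\<beta>. \<beta>))" unfolding idN by (rule N.sigma_finite_measure)
  qed
  also have "\<dots> = density (gibbs l) (\<lambda>\<zeta>. ennreal (tilt l \<epsilon> (\<zeta> k))) \<Otimes>\<^sub>M density N (\<lambda>_. 1)"
    by (simp only: idN gibbs_site_shift density_1)
  also have "\<dots> = density (gibbs l \<Otimes>\<^sub>M N) (\<lambda>(\<zeta>, \<beta>). ennreal (tilt l \<epsilon> (\<zeta> k)) * 1)"
  proof (rule pair_measure_density)
    show "sigma_finite_measure (density N (\<lambda>_. 1))" unfolding density_1 by (rule N.sigma_finite_measure)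
    show "sigma_finite_measure N" by (rule N.sigma_finite_measure)
  qed measurable
  finally show ?thesis by simp
qed

text \<open>Integration by parts against the Gibbs density, in the form of a derivative of translates.
  The weight dominates the difference quotients of the density.\<close>

lemma shift_difference_quotient:
  fixes \<Phi> :: "config \<times> (bond \<times> real \<Rightarrow> real) \<Rightarrow> real" and N :: "(bond \<times> real \<Rightarrow> real) measure" and \<epsilon> :: "nat \<Rightarrow> real"
  assumes N: "prob_space N" "sets N = sets noise_space"
    and \<Phi>: "\<Phi> \<in> borel_measurable (config_space \<Otimes>\<^sub>M noise_space)"
    and int: "integrable (gibbs l \<Otimes>\<^sub>M N) (\<lambda>p. \<Phi> p * tilt_weight l (fst p k))"
    and \<epsilon>: "\<epsilon> \<longlonglongrightarrow> 0" "\<And>m. \<epsilon> m \<noteq> 0" "\<And>m. \<bar>\<epsilon> m\<bar> \<le> 1"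
  defines "\<nu> \<equiv> gibbs l \<Otimes>\<^sub>M N"
  defines "sh \<equiv> \<lambda>m (p :: config \<times> (bond \<times> real \<Rightarrow> real)). (\<lambda>j. fst p j + \<epsilon> m * site_unit k j, snd p)"
  shows "integrable \<nu> \<Phi>" "integrable \<nu> (\<lambda>p. \<Phi> (sh m p))"
    "integrable \<nu> (\<lambda>p. \<Phi> p * (deriv V (fst p k) - l))"
    "(\<lambda>m. ((\<integral>p. \<Phi> (sh m p) \<partial>\<nu>) - (\<integral>p. \<Phi> p \<partial>\<nu>)) / \<epsilon> m) \<longlonglongrightarrow> (\<integral>p. \<Phi> p * (deriv V (fst p k) - l) \<partial>\<nu>)"
proof -
  have sets_\<nu>: "sets \<nu> = sets (config_space \<Otimes>\<^sub>M noise_space)"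
    unfolding \<nu>_def by (rule sets_pair_measure_cong) (simp_all add: N)
  have [measurable]: "\<Phi> \<in> borel_measurable \<nu>"
    using \<Phi> by (simp add: measurable_cong_sets[OF sets_\<nu> refl])
  have comp: "(\<lambda>p. fst p k) \<in> borel_measurable \<nu>"
    unfolding measurable_cong_sets[OF sets_\<nu> refl]
    using measurable_compose[OF measurable_fst measurable_component_singleton[of k UNIV "\<lambda>_. borel"]] by simp
  note [measurable] = comp
  have sh_meas: "sh m \<in> \<nu> \<rightarrow>\<^sub>M config_space \<Otimes>\<^sub>M noise_space" for m
    unfolding sh_def measurable_cong_sets[OF sets_\<nu> refl]
  proof (rule measurable_Pair)
    show "(\<lambda>p j. fst p j + \<epsilon> m * site_unit k j) \<in> config_space \<Otimes>\<^sub>M noise_space \<rightarrow>\<^sub>M config_space"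
    proof (rule measurable_PiM_single')
      have "(\<lambda>p. fst p j) \<in> borel_measurable (config_space \<Otimes>\<^sub>M noise_space)" for j
        using measurable_compose[OF measurable_fst measurable_component_singleton[of j UNIV "\<lambda>_. borel"]] by simp
      then show "(\<lambda>p. fst p j + \<epsilon> m * site_unit k j) \<in> borel_measurable (config_space \<Otimes>\<^sub>M noise_space)" for j
        by (intro borel_measurable_add) simp_all
    qed auto
  qed (rule measurable_snd)
  have law: "distr \<nu> (config_space \<Otimes>\<^sub>M noise_space) (sh m) = density \<nu> (\<lambda>p. ennreal (tilt l (\<epsilon> m) (fst p k)))" for m
    using joint_site_shift[OF N, of l "\<epsilon> m" k] unfolding \<nu>_def sh_def split_beta' .
  let ?w = "\<lambda>p :: config \<times> (bond \<times> real \<Rightarrow> real). tilt_weight l (fst p k)"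
  have w1: "1 \<le> ?w p" for p by (rule tilt_weight_ge_1)
  have t_nonneg: "0 \<le> tilt l e x" for e x by (simp add: tilt_def)
  have t_bound: "\<bar>tilt l (\<epsilon> m) (fst p k) - 1\<bar> \<le> \<bar>\<epsilon> m\<bar> * ?w p" for m and p :: "config \<times> (bond \<times> real \<Rightarrow> real)"
    by (rule abs_tilt_minus_1_le[OF \<epsilon>(3)])
  have t_bound2: "tilt l (\<epsilon> m) (fst p k) \<le> 2 * ?w p" for m p
    using t_bound[of m p] w1[of p] mult_right_mono[OF \<epsilon>(3)[of m], of "?w p"] by linarith
  have int': "integrable \<nu> (\<lambda>p. \<Phi> p * ?w p)" using int unfolding \<nu>_def .
  show int\<Phi>: "integrable \<nu> \<Phi>"
  proof (rule Bochner_Integration.integrable_bound[OF int'])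
    show "AE p in \<nu>. norm (\<Phi> p) \<le> norm (\<Phi> p * ?w p)"
    proof (rule AE_I2)
      fix p show "norm (\<Phi> p) \<le> norm (\<Phi> p * ?w p)"
        using mult_left_mono[OF w1[of p] abs_ge_zero[of "\<Phi> p"]] w1[of p] by (simp add: abs_mult)
    qed
  qed measurable
  have int_t: "integrable \<nu> (\<lambda>p. tilt l (\<epsilon> m) (fst p k) * \<Phi> p)" for m
  proof (rule Bochner_Integration.integrable_bound)
    show "integrable \<nu> (\<lambda>p. 2 * (\<Phi> p * ?w p))" using int' by simp
    show "AE p in \<nu>. norm (tilt l (\<epsilon> m) (fst p k) * \<Phi> p) \<le> norm (2 * (\<Phi> p * ?w p))"
    proof (rule AE_I2)
      fix p show "norm (tilt l (\<epsilon> m) (fst p k) * \<Phi> p) \<le> norm (2 * (\<Phi> p * ?w p))"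
        using mult_right_mono[OF t_bound2[of m p] abs_ge_zero[of "\<Phi> p"]] w1[of p] t_nonneg
        by (simp add: abs_mult ac_simps)
    qed
  qed measurable
  have "integrable (distr \<nu> (config_space \<Otimes>\<^sub>M noise_space) (sh m)) \<Phi>" for m
    unfolding law using int_t t_nonneg by (subst integrable_density) auto
  then show int_sh: "integrable \<nu> (\<lambda>p. \<Phi> (sh m p))" for m
    using integrable_distr_eq[OF sh_meas \<Phi>] by blast
  \<comment> \<open>The translation of the argument is traded for the density \<open>tilt\<close>.
    The quotient then falls on this explicit function, and \<open>\<Phi>\<close> need not be
    differentiable.\<close>
  have eq: "(\<integral>p. \<Phi> (sh m p) \<partial>\<nu>) = (\<integral>p. tilt l (\<epsilon> m) (fst p k) * \<Phi> p \<partial>\<nu>)" for m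
  proof -
    have "(\<integral>p. \<Phi> (sh m p) \<partial>\<nu>) = (\<integral>p. \<Phi> p \<partial>distr \<nu> (config_space \<Otimes>\<^sub>M noise_space) (sh m))"
      by (rule integral_distr[symmetric, OF sh_meas \<Phi>])
    also have "\<dots> = (\<integral>p. tilt l (\<epsilon> m) (fst p k) * \<Phi> p \<partial>\<nu>)"
      unfolding law using t_nonneg by (subst integral_density) auto
    finally show ?thesis .
  qed
  let ?f = "\<lambda>m p. \<Phi> p * ((tilt l (\<epsilon> m) (fst p k) - 1) / \<epsilon> m)"
  have lim: "AE p in \<nu>. (\<lambda>m. ?f m p) \<longlonglongrightarrow> \<Phi> p * (deriv V (fst p k) - l)"
    by (intro AE_I2 tendsto_mult tendsto_const tilt_difference_quotient \<epsilon>)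
  have bound: "AE p in \<nu>. norm (?f m p) \<le> \<bar>\<Phi> p * ?w p\<bar>" for m
  proof (rule AE_I2)
    fix p
    have "\<bar>(tilt l (\<epsilon> m) (fst p k) - 1) / \<epsilon> m\<bar> \<le> ?w p"
      using t_bound[of m p] \<epsilon>(2)[of m] by (simp add: abs_divide divide_le_eq mult.commute)
    from mult_left_mono[OF this abs_ge_zero[of "\<Phi> p"]]
    show "norm (?f m p) \<le> \<bar>\<Phi> p * ?w p\<bar>" using w1[of p] by (simp add: abs_mult)
  qed
  have meas: "(\<lambda>p. \<Phi> p * (deriv V (fst p k) - l)) \<in> borel_measurable \<nu>" "?f m \<in> borel_measurable \<nu>" for m
    by measurable
  note dom = meas integrable_abs[OF int'] lim bound
  show "integrable \<nu> (\<lambda>p. \<Phi> p * (deriv V (fst p k) - l))"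
    by (rule integrable_dominated_convergence[OF dom])
  have f_eq: "(\<integral>p. ?f m p \<partial>\<nu>) = ((\<integral>p. \<Phi> (sh m p) \<partial>\<nu>) - (\<integral>p. \<Phi> p \<partial>\<nu>)) / \<epsilon> m" for m
  proof -
    have "(\<integral>p. ?f m p \<partial>\<nu>) = (\<integral>p. (tilt l (\<epsilon> m) (fst p k) * \<Phi> p - \<Phi> p) / \<epsilon> m \<partial>\<nu>)"
      by (intro Bochner_Integration.integral_cong) (auto simp: algebra_simps)
    also have "\<dots> = ((\<integral>p. \<Phi> (sh m p) \<partial>\<nu>) - (\<integral>p. \<Phi> p \<partial>\<nu>)) / \<epsilon> m"
      unfolding eq using int_t int\<Phi> by simp
    finally show ?thesis .
  qed
  show "(\<lambda>m. ((\<integral>p. \<Phi> (sh m p) \<partial>\<nu>) - (\<integral>p. \<Phi> p \<partial>\<nu>)) / \<epsilon> m) \<longlonglongrightarrow> (\<integral>p. \<Phi> p * (deriv V (fst p k) - l) \<partial>\<nu>)"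
    using integral_dominated_convergence[OF dom] unfolding f_eq .
qed

text \<open>Integration by parts is applied to the solution at time \<open>t\<close>, so its product
  with the exponential weight must be integrable. Weighted first moments are bounded uniformly along
  the Euler schemes and pass to the solution by Fatou.\<close>

lemma weighted_moment:
  assumes M: "prob_space M" and B: "independent_brownian_motions M bonds B"
    and \<eta>: "\<eta> 0 \<in> measurable M config_space" "distr M config_space (\<eta> 0) = gibbs l"
    and r: "0 \<le> r" and t: "0 \<le> t" and \<eta>t: "(\<lambda>\<omega>. \<eta> t \<omega> i) \<in> borel_measurable M"
    and paths: "AE \<omega> in M. mild_path V r (noise B \<omega>) (\<lambda>t. \<eta> t \<omega>)"
  shows "integrable M (\<lambda>\<omega>. \<eta> t \<omega> i * tilt_weight l (\<eta> 0 \<omega> k))"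
proof -
  interpret prob_space M by fact
  note [measurable] = \<eta>(1) \<eta>t
  define g where "g \<omega> = tilt_weight l (\<eta> 0 \<omega> k)" for \<omega>
  have \<eta>0 [measurable]: "(\<lambda>\<omega>. \<eta> 0 \<omega> j) \<in> borel_measurable M" for j
    by (rule measurable_compose[OF \<eta>(1)]) simp
  have g_meas [measurable]: "g \<in> borel_measurable M" unfolding g_def by measurable
  have g1: "1 \<le> g \<omega>" for \<omega> unfolding g_def by (rule tilt_weight_ge_1)
  have g_abs: "\<bar>g \<omega>\<bar> = g \<omega>" for \<omega> using g1[of \<omega>] by simp
  have component: "integrable M (\<lambda>\<omega>. f (\<eta> 0 \<omega> j))" "(\<integral>\<omega>. f (\<eta> 0 \<omega> j) \<partial>M) = (\<integral>x. f x \<partial>site_measure V l)"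
    if f [measurable]: "f \<in> borel_measurable borel" and "integrable (site_measure V l) f" for f :: "real \<Rightarrow> real" and j
  proof -
    have c: "(\<lambda>\<zeta>. f (\<zeta> j)) \<in> borel_measurable config_space" by measurable
    have "integrable (distr M config_space (\<eta> 0)) (\<lambda>\<zeta>. f (\<zeta> j))"
      using that gibbs_integral_component(1)[OF f, of l j] unfolding \<eta>(2) by simp
    then show "integrable M (\<lambda>\<omega>. f (\<eta> 0 \<omega> j))" using integrable_distr_eq[OF \<eta>(1) c] by simp
    show "(\<integral>\<omega>. f (\<eta> 0 \<omega> j) \<partial>M) = (\<integral>x. f x \<partial>site_measure V l)"
      using integral_distr[OF \<eta>(1) c] gibbs_integral_component(2)[OF f, of l j] unfolding \<eta>(2) by simp
  qed
  have gg: "integrable M (\<lambda>\<omega>. (g \<omega>)\<^sup>2)" and g_int: "integrable M g"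
    unfolding g_def by (intro component tilt_weight_integrable; simp)+
  define q where "q = (\<integral>\<omega>. (g \<omega>)\<^sup>2 \<partial>M)"
  define v where "v = (\<integral>x. x\<^sup>2 \<partial>site_measure V l)"
  have q: "0 \<le> q" and v: "0 \<le> v" unfolding q_def v_def by simp_all
  have z: "L1_bounded M (\<lambda>\<omega>. g \<omega> * \<eta> 0 \<omega> j) (q + v)" for j
    using L1_bounded_mult_of_squares[OF g_meas \<eta>0[of j] gg component(1)[of "\<lambda>x. x\<^sup>2"]] site_measure_second_moment
      component(2)[of "\<lambda>x. x\<^sup>2" j] by (simp add: q_def v_def)
  \<comment> \<open>The noise accumulated up to time \<open>s\<close> is subtracted from the scheme
    as a whole. Bounding its increments one by one in absolute mean would give a bound growing with
    the number of steps.\<close>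
  define b where "b j s \<omega> = sqrt 2 * (noise B \<omega> ((j, j + 1), s) - noise B \<omega> ((j - 1, j), s))" for j s \<omega>
  define \<beta> where "\<beta> = sqrt 2 * ((q + t) + (q + t))"
  have \<beta>: "0 \<le> \<beta>" using q t by (simp add: \<beta>_def)
  have bond: "(j, j + 1) \<in> bonds" "(j - 1, j) \<in> bonds" for j
    by (auto simp: bonds_def intro!: image_eqI[of _ _ "j - 1"])
  have b: "L1_bounded M (\<lambda>\<omega>. g \<omega> * b j s \<omega>) \<beta>" if s: "0 \<le> s" "s \<le> t" for j s
  proof -
    have W: "L1_bounded M (\<lambda>\<omega>. g \<omega> * noise B \<omega> (c, s)) (q + t)" if c: "c \<in> bonds" for c
    proof -
      have bm: "brownian_motion M (B c)" using B c unfolding independent_brownian_motions_def by blast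
      note sec = brownian_motion_second_moment[OF M bm s(1)]
      have "L1_bounded M (\<lambda>\<omega>. g \<omega> * B c s \<omega>) (q + s)"
        using L1_bounded_mult_of_squares[OF g_meas independent_brownian_motions_measurable[OF B c s(1)] gg sec(1)]
        by (simp add: sec(2) q_def)
      then show ?thesis using c s by (simp add: L1_bounded_def)
    qed
    have "g \<omega> * b j s \<omega> = sqrt 2 * (g \<omega> * noise B \<omega> ((j, j + 1), s) - g \<omega> * noise B \<omega> ((j - 1, j), s))" for \<omega>
      unfolding b_def by (simp only: right_diff_distrib mult.left_commute)
    then show ?thesis
      unfolding \<beta>_def using L1_bounded_cmult[OF L1_bounded_diff[OF W[OF bond(1)[of j]] W[OF bond(2)[of j]]], of "sqrt 2"]
      by simp
  qed
  \<comment> \<open>Makes the recursion homogeneous: a bound y yields a drift contribution of at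
    most 4C(y + d), so y + d grows by the factor 1 + 4C\<tau> per step. The part with
    \<open>\<beta>\<close> pays for putting the noise back inside the drift.\<close>
  define d where "d = (4 * \<bar>deriv V 0\<bar> * (\<integral>\<omega>. \<bar>g \<omega>\<bar> \<partial>M) + 4 * C * \<beta>) / (4 * C)"
  have d: "0 \<le> d" using C_pos \<beta> by (simp add: d_def)
  let ?e = "\<lambda>\<tau> n j \<omega>. euler V \<tau> (noise B \<omega>) (\<eta> 0 \<omega>) n j"
  let ?Y = "\<lambda>\<tau> n j \<omega>. ?e \<tau> n j \<omega> - b j (\<tau> * real n) \<omega>"
  have e_meas: "?e \<tau> n j \<in> borel_measurable M" if "0 \<le> \<tau>" for \<tau> n j
    using measurable_compose[OF measurable_Pair[OF \<eta>(1) noise_measurable[OF B]] euler_measurable[OF that, of n j]] by simp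
  have main: "L1_bounded M (\<lambda>\<omega>. g \<omega> * ?Y \<tau> n j \<omega>) ((1 + 4 * C * \<tau>) ^ n * (q + v + \<beta> + d) - d)"
    if \<tau>: "0 \<le> \<tau>" and n: "\<tau> * n \<le> t" for \<tau> n j
    using n
  proof (induction n arbitrary: j)
    case 0
    show ?case
      using L1_bounded_diff[OF z b[OF order_refl t], of j j] by (simp add: right_diff_distrib)
  next
    case (Suc n)
    have n: "\<tau> * n \<le> t"
      using Suc.prems mult_left_mono[of "real n" "real (Suc n)" \<tau>] \<tau> by linarith
    let ?y = "(1 + 4 * C * \<tau>) ^ n * (q + v + \<beta> + d) - d"
    let ?f = "\<lambda>\<omega>. gl_drift V (euler V \<tau> (noise B \<omega>) (\<eta> 0 \<omega>) n) j"
    let ?R = "\<lambda>\<omega>. 4 * \<bar>deriv V 0\<bar> * g \<omega>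
      + C * ((\<bar>g \<omega> * ?e \<tau> n (j + 1) \<omega>\<bar> + \<bar>g \<omega> * ?e \<tau> n (j - 1) \<omega>\<bar>) + 2 * \<bar>g \<omega> * ?e \<tau> n j \<omega>\<bar>)"
    have "0 \<le> \<tau> * n" using \<tau> by simp
    note sum = L1_bounded_add[OF Suc.IH[OF n] b[OF this n]]
    have "g \<omega> * ?Y \<tau> n m \<omega> + g \<omega> * b m (\<tau> * n) \<omega> = g \<omega> * ?e \<tau> n m \<omega>" for m \<omega>
      by (simp only: distrib_left[symmetric] diff_add_cancel)
    then have "L1_bounded M (\<lambda>\<omega>. g \<omega> * ?e \<tau> n m \<omega>) (?y + \<beta>)" for m
      using sum[of m m] by (simp only:)
    note ge = L1_bounded_abs[OF this]
    have "L1_bounded M ?R (\<bar>4 * \<bar>deriv V 0\<bar>\<bar> * (\<integral>\<omega>. \<bar>g \<omega>\<bar> \<partial>M) + \<bar>C\<bar> * (((?y + \<beta>) + (?y + \<beta>)) + \<bar>2\<bar> * (?y + \<beta>)))"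
      by (intro L1_bounded_add L1_bounded_cmult ge) (simp add: L1_bounded_def g_int)
    moreover have "\<bar>4 * \<bar>deriv V 0\<bar>\<bar> * (\<integral>\<omega>. \<bar>g \<omega>\<bar> \<partial>M) + \<bar>C\<bar> * (((?y + \<beta>) + (?y + \<beta>)) + \<bar>2\<bar> * (?y + \<beta>)) = 4 * C * (?y + d)"
      using C_pos by (simp add: d_def field_simps)
    ultimately have R: "L1_bounded M ?R (4 * C * (?y + d))" by simp
    have "\<bar>g \<omega> * ?f \<omega>\<bar> \<le> \<bar>?R \<omega>\<bar>" for \<omega>
    proof -
      have "\<bar>deriv V (?e \<tau> n m \<omega>)\<bar> \<le> \<bar>deriv V 0\<bar> + C * \<bar>?e \<tau> n m \<omega>\<bar>" for m
        using V'_lipschitz[of "?e \<tau> n m \<omega>" 0] by simp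
      from this[of "j + 1"] this[of "j - 1"] this[of j]
      have "\<bar>?f \<omega>\<bar> \<le> 4 * \<bar>deriv V 0\<bar> + C * ((\<bar>?e \<tau> n (j + 1) \<omega>\<bar> + \<bar>?e \<tau> n (j - 1) \<omega>\<bar>) + 2 * \<bar>?e \<tau> n j \<omega>\<bar>)"
        unfolding gl_drift_def distrib_left by linarith
      from mult_left_mono[OF this, of "g \<omega>"] g1[of \<omega>] have "\<bar>g \<omega> * ?f \<omega>\<bar> \<le> ?R \<omega>"
        unfolding abs_mult g_abs by (simp add: algebra_simps)
      then show ?thesis by linarith
    qed
    then have "L1_bounded M (\<lambda>\<omega>. g \<omega> * ?f \<omega>) (4 * C * (?y + d))"
      by (rule L1_bounded_mono[OF R, rotated])
         (intro borel_measurable_times g_meas drift_measurable e_meas[OF \<tau>])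
    from L1_bounded_add[OF Suc.IH[OF n, of j] L1_bounded_cmult[OF this, of \<tau>], unfolded abs_of_nonneg[OF \<tau>]]
    have "L1_bounded M (\<lambda>\<omega>. g \<omega> * ?Y \<tau> n j \<omega> + \<tau> * (g \<omega> * ?f \<omega>)) (?y + \<tau> * (4 * C * (?y + d)))" .
    moreover have "g \<omega> * ?Y \<tau> (Suc n) j \<omega> = g \<omega> * ?Y \<tau> n j \<omega> + \<tau> * (g \<omega> * ?f \<omega>)" for \<omega>
      unfolding b_def euler.simps by (simp only: algebra_simps)
    moreover have "?y + \<tau> * (4 * C * (?y + d)) = (1 + 4 * C * \<tau>) ^ Suc n * (q + v + \<beta> + d) - d"
      by (simp add: algebra_simps)
    ultimately show ?case by (simp only:)
  qed
  define K where "K = exp (4 * C * t) * (q + v + \<beta> + d) + \<beta>"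
  let ?E = "\<lambda>n \<omega>. ?e (t / Suc n) (Suc n) i \<omega>"
  have E: "integrable M (\<lambda>\<omega>. g \<omega> * ?E n \<omega>)" "(\<integral>\<omega>. \<bar>g \<omega> * ?E n \<omega>\<bar> \<partial>M) \<le> K" for n
  proof -
    have \<tau>: "0 \<le> t / Suc n" and tt: "t / Suc n * Suc n = t" using t by simp_all
    have "g \<omega> * ?E n \<omega> = g \<omega> * (?E n \<omega> - b i t \<omega>) + g \<omega> * b i t \<omega>" for \<omega>
      by (simp only: algebra_simps)
    then have L1: "L1_bounded M (\<lambda>\<omega>. g \<omega> * ?E n \<omega>) (((1 + 4 * C * (t / Suc n)) ^ Suc n * (q + v + \<beta> + d) - d) + \<beta>)"
      using L1_bounded_add[OF main[of "t / Suc n" "Suc n" i, OF \<tau>, unfolded tt, OF order_refl] b[OF t order_refl, of i]]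
      by (simp only:)
    then show "integrable M (\<lambda>\<omega>. g \<omega> * ?E n \<omega>)" unfolding L1_bounded_def by (rule conjunct1)
    have "((1 + 4 * C * (t / Suc n)) ^ Suc n * (q + v + \<beta> + d) - d) + \<beta> \<le> K"
      using mult_right_mono[OF euler_growth_le[of t 1 n], of "q + v + \<beta> + d"] t q v \<beta> d by (simp add: K_def)
    then show "(\<integral>\<omega>. \<bar>g \<omega> * ?E n \<omega>\<bar> \<partial>M) \<le> K"
      using L1 unfolding L1_bounded_def by linarith
  qed
  have "integrable M (\<lambda>\<omega>. g \<omega> * \<eta> t \<omega> i)"
  proof (rule integrableI_bounded)
    have "(\<integral>\<^sup>+\<omega>. ennreal (norm (g \<omega> * \<eta> t \<omega> i)) \<partial>M) = (\<integral>\<^sup>+\<omega>. liminf (\<lambda>n. ennreal \<bar>g \<omega> * ?E n \<omega>\<bar>) \<partial>M)"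
    proof (rule nn_integral_cong_AE)
      show "AE \<omega> in M. ennreal (norm (g \<omega> * \<eta> t \<omega> i)) = liminf (\<lambda>n. ennreal \<bar>g \<omega> * ?E n \<omega>\<bar>)"
        using paths
      proof eventually_elim
        case (elim \<omega>)
        have "(\<lambda>n. ennreal \<bar>g \<omega> * ?E n \<omega>\<bar>) \<longlonglongrightarrow> ennreal \<bar>g \<omega> * \<eta> t \<omega> i\<bar>"
          by (intro tendsto_intros euler_converges[OF elim r t])
        from lim_imp_Liminf[OF _ this] show ?case by simp
      qed
    qed
    also have "\<dots> \<le> liminf (\<lambda>n. \<integral>\<^sup>+\<omega>. ennreal \<bar>g \<omega> * ?E n \<omega>\<bar> \<partial>M)"
      by (rule nn_integral_liminf) (use E(1) in measurable)
    also have "\<dots> \<le> ennreal K"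
    proof (rule Liminf_le)
      have "(\<integral>\<^sup>+\<omega>. ennreal \<bar>g \<omega> * ?E n \<omega>\<bar> \<partial>M) \<le> ennreal K" for n
      proof -
        have "(\<integral>\<^sup>+\<omega>. ennreal \<bar>g \<omega> * ?E n \<omega>\<bar> \<partial>M) = ennreal (\<integral>\<omega>. \<bar>g \<omega> * ?E n \<omega>\<bar> \<partial>M)"
          by (rule nn_integral_eq_integral[OF integrable_abs[OF E(1)]]) (rule AE_I2, rule abs_ge_zero)
        also have "\<dots> \<le> ennreal K" by (rule ennreal_leI[OF E(2)])
        finally show ?thesis .
      qed
      then show "\<forall>\<^sub>F n in sequentially. (\<integral>\<^sup>+\<omega>. ennreal \<bar>g \<omega> * ?E n \<omega>\<bar> \<partial>M) \<le> ennreal K"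
        by (intro always_eventually allI)
    qed simp
    finally show "(\<integral>\<^sup>+\<omega>. ennreal (norm (g \<omega> * \<eta> t \<omega> i)) \<partial>M) < \<infinity>"
      by (simp add: le_less_trans)
  qed measurable
  then show ?thesis by (simp add: g_def mult.commute)
qed

end

section \<open>The stationary dynamics\<close>

text \<open>For nonnegative terms summability means bounded finite partial sums, and the integers
  have only countably many finite subsets.\<close>

lemma weighted_space_measurable: "weighted_space r \<in> sets config_space"
proof -
  let ?f = "\<lambda>\<zeta> i. (\<zeta> i)\<^sup>2 * exp (- r * \<bar>real_of_int i\<bar>) :: real"
  let ?S = "\<lambda>F n. {\<zeta> \<in> space config_space. sum (?f \<zeta>) F \<le> real n}"
  have "weighted_space r = (\<Union>n. \<Inter>F\<in>{F. finite F}. ?S F n)"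
  proof (intro set_eqI iffI)
    fix \<zeta> :: config assume "\<zeta> \<in> weighted_space r"
    then have s: "?f \<zeta> summable_on UNIV" by (simp add: weighted_space_def)
    obtain n :: nat where n: "infsum (?f \<zeta>) UNIV \<le> real n" using real_arch_simple by blast
    have "sum (?f \<zeta>) F \<le> real n" if "finite F" for F
      using finite_sum_le_infsum[OF s that] n by (rule order_trans) auto
    then show "\<zeta> \<in> (\<Union>n. \<Inter>F\<in>{F. finite F}. ?S F n)" by (auto simp: space_PiM)
  next
    fix \<zeta> :: config assume "\<zeta> \<in> (\<Union>n. \<Inter>F\<in>{F. finite F}. ?S F n)"
    then obtain n :: nat where "\<And>F. finite F \<Longrightarrow> sum (?f \<zeta>) F \<le> real n" by auto
    then have "?f \<zeta> summable_on UNIV"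
      by (intro nonneg_bdd_above_summable_on) (auto intro!: bdd_aboveI[of _ "real n"])
    then show "\<zeta> \<in> weighted_space r" by (simp add: weighted_space_def)
  qed
  also have "\<dots> \<in> sets config_space"
  proof (intro sets.countable_UN image_subsetI sets.countable_INT'')
    show "countable {F :: int set. finite F}" by (rule countable_Collect_finite)
    show "?S F n \<in> sets config_space" for F n by measurable
    show "UNIV \<in> sets config_space" using sets.top[of config_space] by (simp add: space_PiM)
  qed
  finally show ?thesis .
qed

text \<open>Serves to translate the family of Brownian motions. Injectivity turns a product over the
  image of \<open>J\<close> into one over \<open>J\<close>.\<close>

lemma (in prob_space) indep_vars_reindex_same:
  assumes X: "indep_vars (\<lambda>_. K) X I" and f: "inj_on f I" "f ` I \<subseteq> I"
  shows "indep_vars (\<lambda>_. K) (\<lambda>i. X (f i)) I"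
  unfolding indep_vars_def2 indep_sets_def
proof (intro conjI ballI allI impI)
  let ?F = "\<lambda>i. {X i -` A \<inter> space M |A. A \<in> sets K}"
  note X' = X[unfolded indep_vars_def2 indep_sets_def]
  fix i assume "i \<in> I"
  then have "f i \<in> I" using f by auto
  then show "X (f i) \<in> M \<rightarrow>\<^sub>M K" "?F (f i) \<subseteq> events" using X' by blast+
next
  let ?F = "\<lambda>i. {X i -` A \<inter> space M |A. A \<in> sets K}"
  fix J A assume J: "J \<subseteq> I" "J \<noteq> {}" "finite J" and A: "A \<in> (\<Pi> i\<in>J. ?F (f i))"
  have inj: "inj_on f J" using f(1) J(1) by (rule inj_on_subset)
  define A' where "A' = (\<lambda>k. A (the_inv_into J f k))"
  have A': "A' (f j) = A j" if "j \<in> J" for j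
    using the_inv_into_f_f[OF inj that] by (simp add: A'_def)
  have "A' \<in> Pi (f ` J) ?F"
  proof (rule Pi_I)
    fix k assume "k \<in> f ` J"
    then obtain j where j: "j \<in> J" "k = f j" by blast
    then have "A j \<in> ?F k" using Pi_mem[OF A, of j] by blast
    then show "A' k \<in> ?F k" using A'[OF j(1)] j(2) by simp
  qed
  then have "prob (\<Inter>k\<in>f ` J. A' k) = (\<Prod>k\<in>f ` J. prob (A' k))"
    using X[unfolded indep_vars_def2 indep_sets_def] J f(2) by (metis (no_types, lifting) finite_imageI image_is_empty image_mono order_trans)
  then show "prob (\<Inter>j\<in>J. A j) = (\<Prod>j\<in>J. prob (A j))"
    using inj by (simp add: prod.reindex A' cong: INF_cong)
qed

section \<open>Translation invariance of dynamics, noise and Gibbs measure\<close>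

definition shift_bond :: "bond \<Rightarrow> bond" where
  "shift_bond b = (fst b + 1, snd b + 1)"

definition shift_noise :: "(bond \<times> real \<Rightarrow> real) \<Rightarrow> bond \<times> real \<Rightarrow> real" where
  "shift_noise \<beta> = (\<lambda>(b, t)\<in>bonds \<times> {0..}. \<beta> (shift_bond b, t))"

definition shift_config :: "config \<Rightarrow> config" where
  "shift_config \<zeta> j = \<zeta> (j + 1)"

lemma shift_bond_bonds: "b \<in> bonds \<Longrightarrow> shift_bond b \<in> bonds"
  by (auto simp: bonds_def shift_bond_def)

lemma shift_noise_measurable: "shift_noise \<in> noise_space \<rightarrow>\<^sub>M noise_space"
  unfolding shift_noise_def
proof (rule measurable_restrict)
  fix p :: "bond \<times> real" assume "p \<in> bonds \<times> {0..}"
  then show "(\<lambda>\<beta>. case p of (b, t) \<Rightarrow> \<beta> (shift_bond b, t)) \<in> borel_measurable noise_space"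
    using shift_bond_bonds by (auto intro!: measurable_component_singleton)
qed

lemma shift_config_measurable: "shift_config \<in> config_space \<rightarrow>\<^sub>M config_space"
  unfolding shift_config_def[abs_def]
  by (rule measurable_PiM_single') (auto intro: measurable_component_singleton)

lemma euler_shift:
  assumes "0 \<le> \<tau>"
  shows "euler V \<tau> (shift_noise \<beta>) (shift_config \<zeta>) k i = euler V \<tau> \<beta> \<zeta> k (i + 1)"
proof (induction k arbitrary: i)
  case 0
  then show ?case by (simp add: shift_config_def)
next
  case (Suc k)
  have bond: "(i, i + 1) \<in> bonds" "(i - 1, i) \<in> bonds"
    by (auto simp: bonds_def intro!: image_eqI[of _ _ "i - 1"])
  have noise: "shift_noise \<beta> ((i, i + 1), s) = \<beta> ((i + 1, i + 1 + 1), s)"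
    "shift_noise \<beta> ((i - 1, i), s) = \<beta> ((i + 1 - 1, i + 1), s)" if "0 \<le> s" for s
    using bond that by (simp_all add: shift_noise_def shift_bond_def)
  have drift: "gl_drift V (euler V \<tau> (shift_noise \<beta>) (shift_config \<zeta>) k) i
      = gl_drift V (euler V \<tau> \<beta> \<zeta> k) (i + 1)"
    unfolding gl_drift_def Suc.IH by simp
  have "0 \<le> \<tau> * real (Suc k)" "0 \<le> \<tau> * real k" using assms by simp_all
  then show ?case unfolding euler.simps Suc.IH drift by (simp only: noise)
qed

lemma euler_limit_shift:
  assumes "0 \<le> t"
  shows "euler_limit V t (shift_noise \<beta>) (shift_config \<zeta>) i = euler_limit V t \<beta> \<zeta> (i + 1)"
  unfolding euler_limit_def using assms by (subst euler_shift) auto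

text \<open>The translated noise comes again from independent Brownian motions on the bonds, so
  uniqueness of the law applies.\<close>

lemma noise_law_shift:
  assumes M: "prob_space M" and B: "independent_brownian_motions M bonds B"
  shows "distr (distr M noise_space (noise B)) noise_space shift_noise = distr M noise_space (noise B)"
proof -
  interpret prob_space M by fact
  let ?B = "\<lambda>b. B (shift_bond b)"
  have "inj_on shift_bond bonds" by (auto simp: inj_on_def shift_bond_def)
  then have "indep_vars (\<lambda>_. PiM {0..} (\<lambda>_. borel)) (\<lambda>b \<omega>. \<lambda>t\<in>{0..}. ?B b t \<omega>) bonds"
    using B shift_bond_bonds unfolding independent_brownian_motions_def
    by (intro indep_vars_reindex_same[where f = shift_bond and X = "\<lambda>b \<omega>. \<lambda>t\<in>{0..}. B b t \<omega>"]) auto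
  then have B': "independent_brownian_motions M bonds ?B"
    using B shift_bond_bonds unfolding independent_brownian_motions_def by blast
  have "distr (distr M noise_space (noise B)) noise_space shift_noise = distr M noise_space (\<lambda>\<omega>. shift_noise (noise B \<omega>))"
    by (subst distr_distr[OF shift_noise_measurable noise_measurable[OF B]]) (simp add: o_def)
  also have "(\<lambda>\<omega>. shift_noise (noise B \<omega>)) = noise ?B"
    using shift_bond_bonds by (auto simp: fun_eq_iff shift_noise_def restrict_def)
  also have "distr M noise_space (noise ?B) = distr M noise_space (noise B)"
    by (rule noise_law_unique[OF M B' M B])
  finally show ?thesis .
qed

lemma (in potential) gibbs_shift: "distr (gibbs l) config_space shift_config = gibbs l"
proof -
  have "distr (gibbs l) (gibbs l) (\<lambda>\<zeta>. \<lambda>n\<in>UNIV. \<zeta> (n + 1)) = gibbs l"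
    unfolding gibbs_def
    by (rule distr_PiM_reindex[where K = UNIV and I = UNIV and f = "\<lambda>n. n + 1" and M = "\<lambda>_. site_measure V l"])
       (auto simp: site_measure_prob_space)
  moreover have "distr (gibbs l) (gibbs l) (\<lambda>\<zeta>. \<lambda>n\<in>UNIV. \<zeta> (n + 1)) = distr (gibbs l) config_space shift_config"
    by (rule distr_cong) (auto simp: shift_config_def fun_eq_iff)
  ultimately show ?thesis by simp
qed

lemma gl_dynamics_mild_path:
  assumes "gl_dynamics M V r B \<eta>"
  shows "AE \<omega> in M. mild_path V (r / 2) (noise B \<omega>) (\<lambda>t. \<eta> t \<omega>)"
proof -
  have "AE \<omega> in M. gl_path V r (\<lambda>b t. B b t \<omega>) (\<lambda>t. \<eta> t \<omega>)"
    using assms unfolding gl_dynamics_def by blast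
  then show ?thesis
  proof eventually_elim
    case (elim \<omega>)
    have "mild_path V (r / 2) (\<lambda>(b, t). B b t \<omega>) (\<lambda>t. \<eta> t \<omega>)"
      by (rule gl_path_imp_mild_path) (use elim in simp)
    then show ?case by (subst mild_path_cong[of _ "\<lambda>(b, t). B b t \<omega>"]) auto
  qed
qed

section \<open>The dynamics on the product of configuration space and noise space\<close>

locale stationary_dynamics = potential V Cmin C for V Cmin C +
  fixes r t l :: real and M :: "'a measure" and B :: "bond \<Rightarrow> real \<Rightarrow> 'a \<Rightarrow> real" and \<eta> :: "real \<Rightarrow> 'a \<Rightarrow> config"
  assumes r: "0 < r" and t: "0 \<le> t"
    and dynamics: "gl_dynamics M V r B \<eta>"
    and initial_law: "distr M config_space (\<eta> 0) = gibbs l"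
begin

sublocale prob_space M
  using dynamics unfolding gl_dynamics_def by blast

lemma B_indep: "independent_brownian_motions M bonds B"
  and \<eta>_measurable: "\<And>s. 0 \<le> s \<Longrightarrow> \<eta> s \<in> measurable M config_space"
  and gl_paths: "AE \<omega> in M. gl_path V r (\<lambda>b t. B b t \<omega>) (\<lambda>t. \<eta> t \<omega>)"
  using dynamics unfolding gl_dynamics_def by blast+

lemmas AE_paths = gl_dynamics_mild_path[OF dynamics]

definition N where "N = distr M noise_space (noise B)"
definition \<nu> where "\<nu> = gibbs l \<Otimes>\<^sub>M N"
text \<open>The solution at time \<open>t\<close> as a function on the product space. There, unlike
  on \<open>M\<close>, one coordinate of the initial configuration can be translated while the noise
  stays fixed.\<close>

definition \<Psi> where "\<Psi> i p = euler_limit V t (snd p) (fst p) i"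

lemma N_prob_space: "prob_space N" and sets_N: "sets N = sets noise_space"
  unfolding N_def by (rule prob_space_distr[OF noise_measurable[OF B_indep]]) simp

lemma sets_\<nu>: "sets \<nu> = sets (config_space \<Otimes>\<^sub>M noise_space)"
  unfolding \<nu>_def by (rule sets_pair_measure_cong) (simp_all add: sets_N)

lemma joint_measurable: "(\<lambda>\<omega>. (\<eta> 0 \<omega>, noise B \<omega>)) \<in> M \<rightarrow>\<^sub>M config_space \<Otimes>\<^sub>M noise_space"
  by (intro measurable_Pair \<eta>_measurable noise_measurable B_indep order_refl)

text \<open>Independence of initial value and noise makes the joint law a product. This allows
  translating the configuration alone, and integrating over the noise first.\<close>

lemma joint_law: "distr M (config_space \<Otimes>\<^sub>M noise_space) (\<lambda>\<omega>. (\<eta> 0 \<omega>, noise B \<omega>)) = \<nu>"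
  unfolding \<nu>_def
proof (rule pair_measure_eqI[symmetric])
  interpret G: prob_space "gibbs l" by (rule gibbs_prob_space)
  interpret N: prob_space N by (rule N_prob_space)
  show "sigma_finite_measure (gibbs l)" "sigma_finite_measure N"
    by (rule G.sigma_finite_measure N.sigma_finite_measure)+
  show "sets (gibbs l \<Otimes>\<^sub>M N) = sets (distr M (config_space \<Otimes>\<^sub>M noise_space) (\<lambda>\<omega>. (\<eta> 0 \<omega>, noise B \<omega>)))"
    using sets_\<nu> by (simp only: \<nu>_def sets_distr)
  fix A D assume "A \<in> sets (gibbs l)" "D \<in> sets N"
  then have A: "A \<in> sets config_space" and D: "D \<in> sets noise_space" by (simp_all add: sets_N)
  have \<eta>0: "\<eta> 0 \<in> M \<rightarrow>\<^sub>M config_space" by (rule \<eta>_measurable) simp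
  note nm = noise_measurable[OF B_indep]
  have indep: "indep_set (sets (vimage_algebra (space M) (\<eta> 0) config_space))
      (sets (vimage_algebra (space M) (noise B) noise_space))"
    using dynamics unfolding gl_dynamics_def by blast
  have "\<eta> 0 -` A \<inter> space M \<in> sets (vimage_algebra (space M) (\<eta> 0) config_space)"
    "noise B -` D \<inter> space M \<in> sets (vimage_algebra (space M) (noise B) noise_space)"
    using A D by (auto intro: in_vimage_algebra)
  note indep_setD[OF indep this]
  moreover have "(\<lambda>\<omega>. (\<eta> 0 \<omega>, noise B \<omega>)) -` (A \<times> D) \<inter> space M = (\<eta> 0 -` A \<inter> space M) \<inter> (noise B -` D \<inter> space M)"
    by auto
  ultimately have "emeasure (distr M (config_space \<Otimes>\<^sub>M noise_space) (\<lambda>\<omega>. (\<eta> 0 \<omega>, noise B \<omega>))) (A \<times> D)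
      = ennreal (prob (\<eta> 0 -` A \<inter> space M) * prob (noise B -` D \<inter> space M))"
    using A D by (subst emeasure_distr[OF joint_measurable]) (simp_all add: emeasure_eq_measure)
  also have "\<dots> = emeasure (gibbs l) A * emeasure N D"
    unfolding initial_law[symmetric] N_def
    using A D by (simp add: emeasure_distr[OF \<eta>0] emeasure_distr[OF nm] emeasure_eq_measure ennreal_mult'')
  finally show "emeasure (gibbs l) A * emeasure N D
      = emeasure (distr M (config_space \<Otimes>\<^sub>M noise_space) (\<lambda>\<omega>. (\<eta> 0 \<omega>, noise B \<omega>))) (A \<times> D)" by simp
qed

lemma \<Psi>_measurable: "\<Psi> i \<in> borel_measurable (config_space \<Otimes>\<^sub>M noise_space)"
  unfolding \<Psi>_def[abs_def] by (rule euler_limit_measurable[OF t])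

lemma fst_component_measurable: "(\<lambda>p. fst p k) \<in> borel_measurable (config_space \<Otimes>\<^sub>M noise_space)"
  using measurable_compose[OF measurable_fst measurable_component_singleton[of k UNIV "\<lambda>_. borel"]] by simp

lemma integral_joint:
  fixes f :: "config \<times> (bond \<times> real \<Rightarrow> real) \<Rightarrow> real"
  assumes "f \<in> borel_measurable (config_space \<Otimes>\<^sub>M noise_space)"
  shows "integrable \<nu> f \<longleftrightarrow> integrable M (\<lambda>\<omega>. f (\<eta> 0 \<omega>, noise B \<omega>))"
    "(\<integral>p. f p \<partial>\<nu>) = (\<integral>\<omega>. f (\<eta> 0 \<omega>, noise B \<omega>) \<partial>M)"
  unfolding joint_law[symmetric]
  by (rule integrable_distr_eq[OF joint_measurable assms], rule integral_distr[OF joint_measurable assms])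

lemma \<Psi>_path: "AE \<omega> in M. \<Psi> i (\<eta> 0 \<omega>, noise B \<omega>) = \<eta> t \<omega> i"
  using AE_paths
proof eventually_elim
  case (elim \<omega>)
  then show ?case using euler_limit_eq[OF elim _ t, of i] r by (simp add: \<Psi>_def)
qed

lemma \<eta>_component_measurable: "0 \<le> s \<Longrightarrow> (\<lambda>\<omega>. \<eta> s \<omega> i) \<in> borel_measurable M"
  by (rule measurable_compose[OF \<eta>_measurable]) auto

lemma \<Psi>_weighted_integrable: "integrable \<nu> (\<lambda>p. \<Psi> i p * tilt_weight l (fst p k))"
proof -
  have m: "(\<lambda>p. \<Psi> i p * tilt_weight l (fst p k)) \<in> borel_measurable (config_space \<Otimes>\<^sub>M noise_space)"
    by (intro borel_measurable_times \<Psi>_measurable measurable_compose[OF fst_component_measurable tilt_weight_measurable])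
  have w: "integrable M (\<lambda>\<omega>. \<eta> t \<omega> i * tilt_weight l (\<eta> 0 \<omega> k))"
    by (rule weighted_moment[where B = B and r = "r / 2"])
       (use prob_space_axioms B_indep \<eta>_measurable initial_law r t \<eta>_component_measurable AE_paths in auto)
  have "integrable M (\<lambda>\<omega>. \<Psi> i (\<eta> 0 \<omega>, noise B \<omega>) * tilt_weight l (\<eta> 0 \<omega> k))"
  proof (rule integrable_cong_AE_imp[OF w])
    show "(\<lambda>\<omega>. \<Psi> i (\<eta> 0 \<omega>, noise B \<omega>) * tilt_weight l (\<eta> 0 \<omega> k)) \<in> borel_measurable M"
      using measurable_compose[OF joint_measurable m] by simp
    show "AE \<omega> in M. \<eta> t \<omega> i * tilt_weight l (\<eta> 0 \<omega> k) = \<Psi> i (\<eta> 0 \<omega>, noise B \<omega>) * tilt_weight l (\<eta> 0 \<omega> k)"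
      using \<Psi>_path[of i] by eventually_elim simp
  qed
  then show ?thesis unfolding integral_joint(1)[OF m] by simp
qed

definition \<epsilon> :: "nat \<Rightarrow> real" where "\<epsilon> m = 1 / real (Suc m)"

lemma \<epsilon>: "\<epsilon> \<longlonglongrightarrow> 0" "\<And>m. \<epsilon> m \<noteq> 0" "\<And>m. \<bar>\<epsilon> m\<bar> \<le> 1" "\<And>m. 0 < \<epsilon> m"
  unfolding \<epsilon>_def[abs_def] using LIMSEQ_inverse_real_of_nat by (auto simp: inverse_eq_divide)

definition sh where "sh k m p = (\<lambda>j. fst p j + \<epsilon> m * site_unit k j, snd p :: bond \<times> real \<Rightarrow> real)"

lemmas quotient = shift_difference_quotient[where N = N and \<epsilon> = \<epsilon> and l = l, OF N_prob_space sets_N _ _ \<epsilon>(1-3),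
    folded \<nu>_def, folded sh_def]

text \<open>Integration by parts with the constant function 1: all difference quotients vanish, so
  V' has mean \<open>l\<close>.\<close>

lemma mean_V': "integrable \<nu> (\<lambda>p. deriv V (fst p k) - l)" "(\<integral>p. deriv V (fst p k) - l \<partial>\<nu>) = 0"
proof -
  have 1: "(\<lambda>_. 1) \<in> borel_measurable (config_space \<Otimes>\<^sub>M noise_space)" by simp
  have m: "(\<lambda>p. tilt_weight l (fst p k)) \<in> borel_measurable (config_space \<Otimes>\<^sub>M noise_space)"
    by (intro measurable_compose[OF fst_component_measurable tilt_weight_measurable])
  have c: "(\<lambda>\<zeta>. tilt_weight l (\<zeta> k)) \<in> borel_measurable config_space" by measurable
  have \<eta>0: "\<eta> 0 \<in> M \<rightarrow>\<^sub>M config_space" by (rule \<eta>_measurable) simp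
  have "integrable (distr M config_space (\<eta> 0)) (\<lambda>\<zeta>. tilt_weight l (\<zeta> k))"
    unfolding initial_law using gibbs_integral_component(1)[OF tilt_weight_measurable] tilt_weight_integrable(1) by simp
  then have "integrable \<nu> (\<lambda>p. 1 * tilt_weight l (fst p k))"
    unfolding integrable_distr_eq[OF \<eta>0 c] mult_1 integral_joint(1)[OF m] by simp
  note q = quotient[where \<Phi> = "\<lambda>_. 1" and k = k, OF 1 this]
  show "integrable \<nu> (\<lambda>p. deriv V (fst p k) - l)" using q(3) by simp
  show "(\<integral>p. deriv V (fst p k) - l \<partial>\<nu>) = 0" using q(4) by (simp add: LIMSEQ_const_iff)
qed

section \<open>The response function: covariance, spatial decay, translation\<close>

definition response :: "int \<Rightarrow> real" where
  "response i = (\<integral>p. \<Psi> i p * (deriv V (fst p 0) - l) \<partial>\<nu>)"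

lemma response_integrand_measurable:
  "(\<lambda>p. \<Psi> i p * (deriv V (fst p k) - l)) \<in> borel_measurable (config_space \<Otimes>\<^sub>M noise_space)"
  by (intro borel_measurable_times borel_measurable_diff \<Psi>_measurable borel_measurable_const
      measurable_compose[OF fst_component_measurable V'_measurable])

text \<open>V' has mean \<open>l\<close> at every site, and centring one factor already gives the
  covariance.\<close>

lemma covariance_eq_response:
  "covariance M (\<lambda>\<omega>. deriv V (\<eta> 0 \<omega> 0)) (\<lambda>\<omega>. \<eta> t \<omega> i) = response i"
proof -
  note q = quotient[where \<Phi> = "\<Psi> i" and k = 0, OF \<Psi>_measurable \<Psi>_weighted_integrable]
  note [measurable] = \<eta>_component_measurable[OF order_refl, of 0] \<eta>_component_measurable[OF t, of i]
  note \<Psi>M = measurable_compose[OF joint_measurable \<Psi>_measurable[of i]]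
  note RM = measurable_compose[OF joint_measurable response_integrand_measurable[of i 0]]
  have m: "(\<lambda>p. deriv V (fst p 0) - l) \<in> borel_measurable (config_space \<Otimes>\<^sub>M noise_space)"
    by (intro borel_measurable_diff borel_measurable_const measurable_compose[OF fst_component_measurable V'_measurable])
  have AE1: "AE \<omega> in M. \<Psi> i (\<eta> 0 \<omega>, noise B \<omega>) * (deriv V (\<eta> 0 \<omega> 0) - l) = \<eta> t \<omega> i * (deriv V (\<eta> 0 \<omega> 0) - l)"
    using \<Psi>_path[of i] by eventually_elim simp
  have int1: "integrable M (\<lambda>\<omega>. \<eta> t \<omega> i)"
    using q(1) unfolding integral_joint(1)[OF \<Psi>_measurable]
    by (rule integrable_cong_AE_imp) (use \<Psi>_path[of i] in auto)
  have int2: "integrable M (\<lambda>\<omega>. \<eta> t \<omega> i * (deriv V (\<eta> 0 \<omega> 0) - l))"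
    using q(3) unfolding integral_joint(1)[OF response_integrand_measurable]
    by (rule integrable_cong_AE_imp) (use AE1 in auto)
  have resp: "response i = (\<integral>\<omega>. \<eta> t \<omega> i * (deriv V (\<eta> 0 \<omega> 0) - l) \<partial>M)"
    unfolding response_def integral_joint(2)[OF response_integrand_measurable]
    by (rule integral_cong_AE) (use RM AE1 in auto)
  have int3: "integrable M (\<lambda>\<omega>. deriv V (\<eta> 0 \<omega> 0) - l)"
    using mean_V'(1)[of 0] unfolding integral_joint(1)[OF m] by simp
  have "(\<integral>\<omega>. deriv V (\<eta> 0 \<omega> 0) - l \<partial>M) = 0"
    using mean_V'(2)[of 0] unfolding integral_joint(2)[OF m] by simp
  moreover have "integrable M (\<lambda>\<omega>. deriv V (\<eta> 0 \<omega> 0))"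
    using Bochner_Integration.integrable_add[OF int3 integrable_const[of l]] by simp
  ultimately have mean: "(\<integral>\<omega>. deriv V (\<eta> 0 \<omega> 0) \<partial>M) = l" by (simp add: prob_space)
  have "(\<integral>\<omega>. deriv V (\<eta> 0 \<omega> 0) * \<eta> t \<omega> i \<partial>M)
      = (\<integral>\<omega>. \<eta> t \<omega> i * (deriv V (\<eta> 0 \<omega> 0) - l) + l * \<eta> t \<omega> i \<partial>M)"
    by (simp add: algebra_simps)
  also have "\<dots> = response i + l * (\<integral>\<omega>. \<eta> t \<omega> i \<partial>M)"
    unfolding resp using int1 int2 by (subst Bochner_Integration.integral_add) auto
  finally show ?thesis unfolding covariance_def mean by simp
qed

text \<open>Locality of the flow. A shift of site 0 by \<open>\<epsilon> m\<close> lies below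
  \<open>\<epsilon> m\<close> times the weight exp(-|j|), with equality at j = 0. The weight changes
  by at most a factor exp 1 between neighbours, so the Lipschitz bound keeps the decay, uniformly in
  \<open>m\<close>.\<close>

lemma abs_response_le: "\<bar>response i\<bar> \<le> exp (4 * exp 1 * C * t) * exp (- \<bar>real_of_int i\<bar>)"
proof -
  note q = quotient[where \<Phi> = "\<Psi> i" and k = 0, OF \<Psi>_measurable \<Psi>_weighted_integrable]
  let ?K = "exp (4 * exp 1 * C * t) * exp (- \<bar>real_of_int i\<bar>)"
  let ?w = "\<lambda>j. exp (- \<bar>real_of_int j\<bar>)"
  have "\<bar>((\<integral>p. \<Psi> i (sh 0 m p) \<partial>\<nu>) - (\<integral>p. \<Psi> i p \<partial>\<nu>)) / \<epsilon> m\<bar> \<le> ?K" for m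
  proof -
    let ?d = "\<lambda>p. \<Psi> i (sh 0 m p) - \<Psi> i p"
    have int: "integrable \<nu> ?d" using q(1) q(2)[of m] by simp
    then have d_meas: "?d \<in> borel_measurable (config_space \<Otimes>\<^sub>M noise_space)"
      using borel_measurable_integrable[OF int] by (simp only: measurable_cong_sets[OF sets_\<nu> refl])
    have intM: "integrable M (\<lambda>\<omega>. ?d (\<eta> 0 \<omega>, noise B \<omega>))"
      using int integral_joint(1)[OF d_meas] by simp
    have "AE \<omega> in M. \<bar>?d (\<eta> 0 \<omega>, noise B \<omega>)\<bar> \<le> \<epsilon> m * ?K"
      using AE_paths
    proof eventually_elim
      case (elim \<omega>)
      have "\<bar>euler_limit V t (noise B \<omega>) (\<lambda>j. \<eta> 0 \<omega> j + \<epsilon> m * site_unit 0 j) i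
          - euler_limit V t (noise B \<omega>) (\<lambda>j. \<eta> 0 \<omega> j + 0) i\<bar> \<le> \<epsilon> m * exp (4 * exp 1 * C * t) * ?w i"
      proof (rule euler_limit_lipschitz[OF elim _ t, where A = 1])
        show "?w (j + 1) \<le> exp 1 * ?w j" "?w (j - 1) \<le> exp 1 * ?w j" for j
          by (simp_all flip: exp_add)
        show "\<bar>\<epsilon> m * site_unit 0 j\<bar> \<le> 1" for j
          using \<epsilon>(3)[of m] by (simp add: site_unit_def)
        show "\<bar>\<epsilon> m * site_unit 0 j - 0\<bar> \<le> \<epsilon> m * ?w j" for j
          using \<epsilon>(4)[of m] by (simp add: site_unit_def)
      qed (use r \<epsilon>(4)[of m] in auto)
      then show ?case by (simp add: \<Psi>_def sh_def mult.assoc)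
    qed
    then have "(\<integral>\<omega>. \<bar>?d (\<eta> 0 \<omega>, noise B \<omega>)\<bar> \<partial>M) \<le> \<epsilon> m * ?K"
      using intM by (intro integral_le_const) auto
    then have "\<bar>\<integral>\<omega>. ?d (\<eta> 0 \<omega>, noise B \<omega>) \<partial>M\<bar> \<le> \<epsilon> m * ?K"
      using integral_abs_bound[of M "\<lambda>\<omega>. ?d (\<eta> 0 \<omega>, noise B \<omega>)"] by linarith
    then have "\<bar>(\<integral>p. \<Psi> i (sh 0 m p) \<partial>\<nu>) - (\<integral>p. \<Psi> i p \<partial>\<nu>)\<bar> \<le> \<epsilon> m * ?K"
      using q(1) q(2)[of m] unfolding integral_joint(2)[OF d_meas, symmetric] by simp
    then show ?thesis using \<epsilon>(4)[of m] by (simp add: abs_divide divide_le_eq mult.commute)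
  qed
  then show ?thesis
    unfolding response_def by (intro tendsto_upperbound[OF tendsto_rabs[OF q(4)]]) auto
qed

lemma response_LIMSEQ: "(\<lambda>n. response (i + int n)) \<longlonglongrightarrow> 0"
proof (rule Lim_null_comparison)
  show "\<forall>\<^sub>F n in sequentially. norm (response (i + int n))
      \<le> exp (4 * exp 1 * C * t) * exp \<bar>real_of_int i\<bar> * exp (- 1) ^ n"
  proof (intro always_eventually allI)
    fix n
    have "exp (- \<bar>real_of_int (i + int n)\<bar>) \<le> exp (\<bar>real_of_int i\<bar> + real n * (- 1))" by simp
    also have "\<dots> = exp \<bar>real_of_int i\<bar> * exp (- 1) ^ n" by (simp only: exp_add exp_of_nat_mult)
    finally have "exp (4 * exp 1 * C * t) * exp (- \<bar>real_of_int (i + int n)\<bar>)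
        \<le> exp (4 * exp 1 * C * t) * (exp \<bar>real_of_int i\<bar> * exp (- 1) ^ n)" by (intro mult_left_mono) auto
    then show "norm (response (i + int n)) \<le> exp (4 * exp 1 * C * t) * exp \<bar>real_of_int i\<bar> * exp (- 1) ^ n"
      using abs_response_le[of "i + int n"] unfolding real_norm_def mult.assoc by linarith
  qed
  show "(\<lambda>n. exp (4 * exp 1 * C * t) * exp \<bar>real_of_int i\<bar> * exp (- 1) ^ n) \<longlonglongrightarrow> (0::real)"
    by (intro tendsto_mult_right_zero LIMSEQ_power_zero) simp
qed

text \<open>The measure \<open>\<nu>\<close> is invariant under simultaneous translation of
  configuration and noise, and the flow commutes with this translation.\<close>

lemma response_shift: "(\<integral>p. \<Psi> i p * (deriv V (fst p 1) - l) \<partial>\<nu>) = response (i - 1)"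
proof -
  let ?\<theta> = "\<lambda>(\<zeta>, \<beta>). (shift_config \<zeta>, shift_noise \<beta>)"
  interpret N: prob_space N by (rule N_prob_space)
  have N_shift: "distr N noise_space shift_noise = N"
    unfolding N_def by (rule noise_law_shift[OF prob_space_axioms B_indep])
  have sc: "shift_config \<in> gibbs l \<rightarrow>\<^sub>M config_space"
    using shift_config_measurable by (simp cong: measurable_cong_sets)
  have sn: "shift_noise \<in> N \<rightarrow>\<^sub>M noise_space"
    using shift_noise_measurable by (simp add: measurable_cong_sets[OF sets_N refl])
  have law: "distr \<nu> (config_space \<Otimes>\<^sub>M noise_space) ?\<theta> = \<nu>"
  proof -
    have "sigma_finite_measure (distr N noise_space shift_noise)"
      unfolding N_shift by (rule N.sigma_finite_measure)
    from pair_measure_distr[OF sc sn this] show ?thesis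
      unfolding \<nu>_def gibbs_shift N_shift by simp
  qed
  have \<theta>: "?\<theta> \<in> \<nu> \<rightarrow>\<^sub>M config_space \<Otimes>\<^sub>M noise_space"
    unfolding measurable_cong_sets[OF sets_\<nu> refl] split_beta'
    by (intro measurable_Pair measurable_compose[OF measurable_fst shift_config_measurable]
        measurable_compose[OF measurable_snd shift_noise_measurable])
  have "response (i - 1) = (\<integral>p. \<Psi> (i - 1) p * (deriv V (fst p 0) - l) \<partial>distr \<nu> (config_space \<Otimes>\<^sub>M noise_space) ?\<theta>)"
    unfolding law response_def ..
  also have "\<dots> = (\<integral>p. \<Psi> (i - 1) (?\<theta> p) * (deriv V (fst (?\<theta> p) 0) - l) \<partial>\<nu>)"
    by (rule integral_distr[OF \<theta> response_integrand_measurable])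
  also have "\<dots> = (\<integral>p. \<Psi> i p * (deriv V (fst p 1) - l) \<partial>\<nu>)"
    by (simp add: split_beta' \<Psi>_def euler_limit_shift[OF t]) (simp add: shift_config_def)
  finally show ?thesis by simp
qed

text \<open>Read off from the given solution: its initial value has law \<open>gibbs l\<close> and
  lies in the weighted space almost surely.\<close>

lemma AE_weighted: "AE \<zeta> in gibbs l. \<zeta> \<in> weighted_space r"
proof -
  have \<eta>0: "\<eta> 0 \<in> M \<rightarrow>\<^sub>M config_space" by (rule \<eta>_measurable) simp
  have "AE \<omega> in M. \<eta> 0 \<omega> \<in> weighted_space r"
    using gl_paths by eventually_elim (simp add: gl_path_def)
  moreover have "{\<zeta> \<in> space config_space. \<zeta> \<in> weighted_space r} \<in> sets config_space"
    using weighted_space_measurable[of r] by (simp add: space_PiM)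
  ultimately show ?thesis
    unfolding initial_law[symmetric] by (subst AE_distr_iff[OF \<eta>0])
qed

end

section \<open>The covariance identity\<close>

context stationary_dynamics
begin

text \<open>\<open>walk_difference_quotient\<close> is integrated over the initial configuration and
  compared with integration by parts at the sites 1 and 0; this identifies differences in
  \<open>i\<close>, and decay at infinity removes the constant. Nothing is assumed on how
  \<open>P \<zeta>\<close> depends on \<open>\<zeta>\<close>, so measurability in
  \<open>\<zeta>\<close> is produced along the way.\<close>

lemma response_eq_walk:
  fixes P :: "config \<Rightarrow> 'b measure" and W :: "config \<Rightarrow> bond \<Rightarrow> real \<Rightarrow> 'b \<Rightarrow> real"
    and \<xi> :: "config \<Rightarrow> real \<Rightarrow> 'b \<Rightarrow> config" and X :: "config \<Rightarrow> real \<Rightarrow> 'b \<Rightarrow> bond"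
  assumes joint: "\<And>\<zeta>. \<zeta> \<in> weighted_space r \<Longrightarrow> joint_process (P \<zeta>) V r (W \<zeta>) (\<xi> \<zeta>) (X \<zeta>) \<zeta> (0, 1)"
  shows "response i = (LINT \<zeta>:weighted_space r|gibbs l. (\<integral>\<omega>. of_bool (X \<zeta> t \<omega> = bond_at i) \<partial>P \<zeta>))"
proof -
  define p where "p \<zeta> j = (\<integral>\<omega>. of_bool (X \<zeta> t \<omega> = bond_at j) \<partial>P \<zeta> :: real)" for \<zeta> j
  \<comment> \<open>Written with the noise law \<open>N\<close>, the same for all
    \<open>\<zeta>\<close>, so that Fubini gives measurability in \<open>\<zeta>\<close>. For each
    admissible \<open>\<zeta>\<close> it equals an expectation under
    \<open>P \<zeta>\<close>.\<close>
  define D where "D j m \<zeta> = (\<integral>\<beta>. (\<Psi> j (sh 1 m (\<zeta>, \<beta>)) - \<Psi> j (sh 0 m (\<zeta>, \<beta>))) / \<epsilon> m \<partial>N)" for j m \<zeta>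
  let ?w = "indicator (weighted_space r) :: config \<Rightarrow> real"
  let ?K = "exp (4 * C * t)"
  interpret G: prob_space "gibbs l" by (rule gibbs_prob_space)
  interpret N: prob_space N by (rule N_prob_space)
  interpret GN: pair_prob_space "gibbs l" N ..
  note q = quotient[OF \<Psi>_measurable \<Psi>_weighted_integrable]
  have w_meas [measurable]: "?w \<in> borel_measurable (gibbs l)"
    using weighted_space_measurable[of r] by (intro borel_measurable_indicator) simp
  have walk: "(\<lambda>m. D j m \<zeta>) \<longlonglongrightarrow> p \<zeta> (j - 1) - p \<zeta> j" "\<bar>D j m \<zeta>\<bar> \<le> ?K"
    "prob_space (P \<zeta>)" "X \<zeta> t \<in> P \<zeta> \<rightarrow>\<^sub>M count_space UNIV"
    if \<zeta>: "\<zeta> \<in> weighted_space r" for \<zeta> j m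
  proof -
    have dyn: "gl_dynamics (P \<zeta>) V r (W \<zeta>) (\<xi> \<zeta>)" and wk: "walk_in_environment (P \<zeta>) V (\<xi> \<zeta>) (X \<zeta>)"
      and init: "AE \<omega> in P \<zeta>. \<xi> \<zeta> 0 \<omega> = \<zeta>" and start: "AE \<omega> in P \<zeta>. X \<zeta> 0 \<omega> = (0, 1)"
      using joint[OF \<zeta>] unfolding joint_process_def by auto
    have P: "prob_space (P \<zeta>)" and W: "independent_brownian_motions (P \<zeta>) bonds (W \<zeta>)"
      and \<xi>_meas: "\<And>s. 0 \<le> s \<Longrightarrow> \<xi> \<zeta> s \<in> P \<zeta> \<rightarrow>\<^sub>M config_space"
      using dyn unfolding gl_dynamics_def by blast+
    note mild = gl_dynamics_mild_path[OF dyn]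
    interpret P: prob_space "P \<zeta>" by (rule P)
    interpret E: environment_walk V Cmin C "P \<zeta>" "\<xi> \<zeta>" "X \<zeta>"
    proof
      show "AE \<omega> in P \<zeta>. \<forall>j. continuous_on {0..} (\<lambda>s. \<xi> \<zeta> s \<omega> j)"
        using mild by eventually_elim (intro allI, rule mild_path_continuous_on)
    qed (use \<xi>_meas wk start in auto)
    \<comment> \<open>The only link between \<open>P \<zeta>\<close> and \<open>M\<close>: both
      noises have the same law.\<close>
    have law: "N = distr (P \<zeta>) noise_space (noise (W \<zeta>))"
      unfolding N_def by (rule noise_law_unique[OF prob_space_axioms B_indep P W])
    have noise_section: "(\<lambda>\<beta>. euler_limit V t \<beta> \<zeta>' j) \<in> borel_measurable noise_space" for \<zeta>' j
    proof -
      have "(\<lambda>\<beta>. (\<zeta>', \<beta>)) \<in> noise_space \<rightarrow>\<^sub>M config_space \<Otimes>\<^sub>M noise_space"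
        by (rule measurable_Pair1') (simp add: space_PiM)
      from measurable_compose[OF this euler_limit_measurable[OF t, of j]] show ?thesis by simp
    qed
    have meas: "(\<lambda>\<omega>. euler_limit V t (noise (W \<zeta>) \<omega>) \<zeta>' j) \<in> borel_measurable (P \<zeta>)" for \<zeta>' j
      by (rule measurable_compose[OF noise_measurable[OF W] noise_section])
    have D_eq: "D j m \<zeta> = (\<integral>\<omega>. (euler_limit V t (noise (W \<zeta>) \<omega>) (\<lambda>j. \<zeta> j + \<epsilon> m * site_unit 1 j) j
      - euler_limit V t (noise (W \<zeta>) \<omega>) (\<lambda>j. \<zeta> j + \<epsilon> m * site_unit 0 j) j) / \<epsilon> m \<partial>P \<zeta>)" for j m
      unfolding D_def law \<Psi>_def sh_def fst_conv snd_conv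
      by (rule integral_distr[OF noise_measurable[OF W]])
         (intro borel_measurable_divide borel_measurable_diff borel_measurable_const noise_section)
    have r2: "0 \<le> r / 2" using r by simp
    note dq = E.walk_difference_quotient[OF mild r2 t init meas \<epsilon>(1,2)]
    show "(\<lambda>m. D j m \<zeta>) \<longlonglongrightarrow> p \<zeta> (j - 1) - p \<zeta> j"
      unfolding D_eq p_def by (rule dq(1))
    show "\<bar>D j m \<zeta>\<bar> \<le> ?K" unfolding D_eq by (rule dq(2))
    show "prob_space (P \<zeta>)" by (rule P)
    show "X \<zeta> t \<in> P \<zeta> \<rightarrow>\<^sub>M count_space UNIV" by (rule E.walk_measurable[OF t])
  qed
  have p_bounds: "0 \<le> p \<zeta> j" "p \<zeta> j \<le> 1" and p_lim: "(\<lambda>n. p \<zeta> (j + int n)) \<longlonglongrightarrow> 0"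
    if \<zeta>: "\<zeta> \<in> weighted_space r" for \<zeta> j
  proof -
    interpret P: prob_space "P \<zeta>" by (rule walk(3)[OF \<zeta>])
    have m: "(\<lambda>\<omega>. of_bool (X \<zeta> t \<omega> = b) :: real) \<in> borel_measurable (P \<zeta>)" for b
      by (rule measurable_compose[OF walk(4)[OF \<zeta>]]) auto
    show "0 \<le> p \<zeta> j" unfolding p_def by simp
    have "integrable (P \<zeta>) (\<lambda>\<omega>. of_bool (X \<zeta> t \<omega> = bond_at j) :: real)"
      by (rule P.integrable_const_bound[where B = 1]) (use m in auto)
    then show "p \<zeta> j \<le> 1" unfolding p_def by (rule P.integral_le_const) auto
    \<comment> \<open>For each \<omega> the walk sits at one bond, so the indicators vanish for
      large \<open>n\<close>; no rate of decay is claimed.\<close>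
    have "(\<lambda>n. p \<zeta> (j + int n)) \<longlonglongrightarrow> (\<integral>\<omega>. 0 \<partial>P \<zeta>)"
      unfolding p_def
    proof (rule integral_dominated_convergence[where w = "\<lambda>_. 1"])
      show "AE \<omega> in P \<zeta>. (\<lambda>n. of_bool (X \<zeta> t \<omega> = bond_at (j + int n)) :: real) \<longlonglongrightarrow> 0"
      proof (rule AE_I2, rule tendsto_eventually)
        fix \<omega>
        have "X \<zeta> t \<omega> \<noteq> bond_at (j + int n)" if "n > nat (fst (X \<zeta> t \<omega>) - j)" for n
          using that by (cases "X \<zeta> t \<omega>") auto
        then show "\<forall>\<^sub>F n in sequentially. (of_bool (X \<zeta> t \<omega> = bond_at (j + int n)) :: real) = 0"
          unfolding eventually_sequentially by (intro exI[of _ "Suc (nat (fst (X \<zeta> t \<omega>) - j))"]) auto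
      qed
    qed (use m in auto)
    then show "(\<lambda>n. p \<zeta> (j + int n)) \<longlonglongrightarrow> 0" by simp
  qed
  have diff_int: "integrable \<nu> (\<lambda>x. (\<Psi> j (sh 1 m x) - \<Psi> j (sh 0 m x)) / \<epsilon> m)" for j m
    using q(2)[of j 1 m] q(2)[of j 0 m] by simp
  have D_int: "integrable (gibbs l) (D j m)"
    and D_integral: "(\<integral>\<zeta>. D j m \<zeta> \<partial>gibbs l) = (\<integral>x. (\<Psi> j (sh 1 m x) - \<Psi> j (sh 0 m x)) / \<epsilon> m \<partial>\<nu>)" for j m
    using GN.integrable_fst'[OF diff_int[of j m, unfolded \<nu>_def]] GN.integral_fst'[OF diff_int[of j m, unfolded \<nu>_def]]
    unfolding D_def \<nu>_def by simp_all
  note D_meas [measurable] = borel_measurable_integrable[OF D_int]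
  \<comment> \<open>The indicator makes \<open>u\<close> and \<open>g\<close> usable for all
    \<open>\<zeta>\<close>: outside the weighted space \<open>P \<zeta>\<close> is arbitrary, and
    that set is null.\<close>
  define u where "u j \<zeta> = ?w \<zeta> * (p \<zeta> (j - 1) - p \<zeta> j)" for j \<zeta>
  define g where "g j \<zeta> = ?w \<zeta> * p \<zeta> j" for j \<zeta>
  have wD_lim: "(\<lambda>m. ?w \<zeta> * D j m \<zeta>) \<longlonglongrightarrow> u j \<zeta>" for j \<zeta>
    unfolding u_def using walk(1)[of \<zeta> j] by (cases "\<zeta> \<in> weighted_space r") (auto intro!: tendsto_mult)
  have u_meas [measurable]: "u j \<in> borel_measurable (gibbs l)" for j
    by (rule borel_measurable_LIMSEQ_real[OF wD_lim]) measurable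
  have wD_integral_lim: "(\<lambda>m. \<integral>\<zeta>. ?w \<zeta> * D j m \<zeta> \<partial>gibbs l) \<longlonglongrightarrow> (\<integral>\<zeta>. u j \<zeta> \<partial>gibbs l)" for j
  proof (rule integral_dominated_convergence[where w = "\<lambda>_. ?K"])
    show "AE \<zeta> in gibbs l. norm (?w \<zeta> * D j m \<zeta>) \<le> ?K" for m
      using walk(2) by (auto simp: indicator_def)
  qed (use wD_lim in auto)
  \<comment> \<open>The unshifted integral is inserted with both signs, so that integration by parts
    applies at the sites 1 and 0 separately.\<close>
  have wD_integral: "(\<integral>\<zeta>. ?w \<zeta> * D j m \<zeta> \<partial>gibbs l)
      = ((\<integral>x. \<Psi> j (sh 1 m x) \<partial>\<nu>) - (\<integral>x. \<Psi> j x \<partial>\<nu>)) / \<epsilon> m - ((\<integral>x. \<Psi> j (sh 0 m x) \<partial>\<nu>) - (\<integral>x. \<Psi> j x \<partial>\<nu>)) / \<epsilon> m" for j m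
  proof -
    have "(\<integral>\<zeta>. ?w \<zeta> * D j m \<zeta> \<partial>gibbs l) = (\<integral>\<zeta>. D j m \<zeta> \<partial>gibbs l)"
      by (rule integral_cong_AE) (use AE_weighted in \<open>auto elim!: eventually_mono\<close>)
    then show ?thesis
      unfolding D_integral using q(2)[of j 1 m] q(2)[of j 0 m] by (simp add: diff_divide_distrib)
  qed
  have quotient_lim: "(\<lambda>m. ((\<integral>x. \<Psi> j (sh 1 m x) \<partial>\<nu>) - (\<integral>x. \<Psi> j x \<partial>\<nu>)) / \<epsilon> m - ((\<integral>x. \<Psi> j (sh 0 m x) \<partial>\<nu>) - (\<integral>x. \<Psi> j x \<partial>\<nu>)) / \<epsilon> m)
      \<longlonglongrightarrow> response (j - 1) - response j" for j
    unfolding response_shift[symmetric] response_def[of j] by (intro tendsto_diff q(4))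
  have u_integral: "(\<integral>\<zeta>. u j \<zeta> \<partial>gibbs l) = response (j - 1) - response j" for j
    using LIMSEQ_unique[OF wD_integral_lim[unfolded wD_integral] quotient_lim] .
  have g_telescope: "(\<Sum>k<n. u (j + int (Suc k)) \<zeta>) = g j \<zeta> - g (j + int n) \<zeta>" for j n \<zeta>
    by (induction n) (auto simp: u_def g_def algebra_simps)
  have g_lim: "(\<lambda>n. g (j + int n) \<zeta>) \<longlonglongrightarrow> 0" for j \<zeta>
    unfolding g_def using p_lim[of \<zeta> j] by (cases "\<zeta> \<in> weighted_space r") auto
  \<comment> \<open>Measurability of the walk probability itself: it is the limit of telescoping
    sums of the differences \<open>u\<close>, each of which is a limit of measurable
    functions.\<close>
  have [measurable]: "g j \<in> borel_measurable (gibbs l)" for j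
  proof (rule borel_measurable_LIMSEQ_real)
    show "(\<lambda>n. \<Sum>k<n. u (j + int (Suc k)) \<zeta>) \<longlonglongrightarrow> g j \<zeta>" for \<zeta>
      unfolding g_telescope using tendsto_diff[OF tendsto_const g_lim, of "g j \<zeta>" j \<zeta>] by simp
  qed measurable
  have g_bound: "norm (g j \<zeta>) \<le> 1" for j \<zeta>
    unfolding g_def using p_bounds[of \<zeta> j] by (auto simp: indicator_def)
  have g_int: "integrable (gibbs l) (g j)" for j
    by (rule G.integrable_const_bound[where B = 1]) (use g_bound in auto)
  define Q where "Q j = (\<integral>\<zeta>. g j \<zeta> \<partial>gibbs l)" for j
  have "Q (j - 1) - Q j = response (j - 1) - response j" for j
  proof -
    have "Q (j - 1) - Q j = (\<integral>\<zeta>. g (j - 1) \<zeta> - g j \<zeta> \<partial>gibbs l)"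
      unfolding Q_def using g_int by simp
    also have "\<dots> = (\<integral>\<zeta>. u j \<zeta> \<partial>gibbs l)" by (simp add: u_def g_def right_diff_distrib)
    finally show ?thesis unfolding u_integral .
  qed
  note step = this
  \<comment> \<open>Response and averaged walk probability have the same increments in the site, so
    their difference can be evaluated at sites tending to infinity, where both vanish.\<close>
  have const: "response (i + int n) - Q (i + int n) = response i - Q i" for n
  proof (induction n)
    case (Suc n)
    then show ?case using step[of "i + int (Suc n)"] by (simp add: algebra_simps)
  qed simp
  have "(\<lambda>n. Q (i + int n)) \<longlonglongrightarrow> (\<integral>\<zeta>. 0 \<partial>gibbs l)"
    unfolding Q_def by (rule integral_dominated_convergence[where w = "\<lambda>_. 1"]) (use g_lim g_bound in auto)
  from tendsto_diff[OF response_LIMSEQ[of i] this]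
  have "response i - Q i = 0" unfolding const by (simp add: LIMSEQ_const_iff)
  then show ?thesis
    by (simp add: Q_def g_def p_def set_lebesgue_integral_def)
qed

end

theorem proposition4p1:
  fixes V :: "real \<Rightarrow> real" and Cmin Cmax \<rho> r t :: real and i :: int
    and M :: "'a measure" and B :: "bond \<Rightarrow> real \<Rightarrow> 'a \<Rightarrow> real" and \<eta> :: "real \<Rightarrow> 'a \<Rightarrow> config"
    and P :: "config \<Rightarrow> 'b measure" and W :: "config \<Rightarrow> bond \<Rightarrow> real \<Rightarrow> 'b \<Rightarrow> real"
    and \<xi> :: "config \<Rightarrow> real \<Rightarrow> 'b \<Rightarrow> config" and X :: "config \<Rightarrow> real \<Rightarrow> 'b \<Rightarrow> bond"
  assumes "\<And>x. V differentiable (at x)"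
    and "\<And>x. deriv V differentiable (at x)"
    and "0 < Cmin"
    and "\<And>x. Cmin \<le> deriv (deriv V) x"
    and "\<And>x. deriv (deriv V) x \<le> Cmax"
    and "0 < r"
    and "gl_dynamics M V r B \<eta>"
    and "distr M config_space (\<eta> 0) = invariant_measure V \<rho>"
    and "\<And>\<zeta>. \<zeta> \<in> weighted_space r \<Longrightarrow> joint_process (P \<zeta>) V r (W \<zeta>) (\<xi> \<zeta>) (X \<zeta>) \<zeta> (0, 1)"
    and "0 \<le> t"
  shows "covariance M (\<lambda>\<omega>. deriv V (\<eta> 0 \<omega> 0)) (\<lambda>\<omega>. \<eta> t \<omega> i)
       = (LINT \<zeta>:weighted_space r|invariant_measure V \<rho>.
            (\<integral>\<omega>. of_bool (X \<zeta> t \<omega> = (i, i + 1)) \<partial>P \<zeta>))"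
proof -
  interpret potential V Cmin Cmax
    by standard (use assms in auto)
  have gibbs: "invariant_measure V \<rho> = gibbs (chem_pot V \<rho>)"
    by (simp add: invariant_measure_def gibbs_def)
  interpret stationary_dynamics V Cmin Cmax r t "chem_pot V \<rho>" M B \<eta>
    by standard (use assms gibbs in auto)
  show ?thesis
    unfolding gibbs covariance_eq_response by (rule response_eq_walk[OF assms(9)])
qed

end
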